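(* Let $(X_p,T_p,\mu_q)$, $q\in(0,1/a_0)$, be a polynomial adic system and let $g$ be a cylindric function of rank $N$. Then: (a) if $g$ is not cohomologous to a constant in $L^\infty(X_p,\mu_q)$, then for $\mu_q$-a.e. $x$ there is a sequence of positive integers $l_n=l_n(x)\to\infty$ with $R^g_{x,l_n}>0$ such that $\varphi^g_{x,l_n}$ converges uniformly on $[0,1]$ to a continuous function (i.e. a limiting curve exists); (b) if $g$ is cohomologous to a constant in $L^\infty(X_p,\mu_q)$, then for $\mu_q$-a.e. $x$ there is no such sequence $l_n\to\infty$.
   Context: Let $p(x)=a_0+a_1x+\dots+a_dx^d$, $d\ge1$, all $a_i$ positive integers. The diagram $B_p$ has vertices $(n,k)$, $n\ge0$, $0\le k\le nd$; for every $n,k$ and $0\le j\le d$, $(n,k)$ and $(n+1,k+j)$ are joined by $a_j$ edges (edges of type $j$). Edges entering a vertex are linearly ordered canonically: first the $a_d$ edges of type $d$, then those of type $d-1$, ..., last the $a_0$ edges of type $0$ (parallel edges in a fixed order). $X_p$ is the set of infinite paths $x=(x_1,x_2,\dots)$ from $(0,0)$. Paths agreeing from some index on are compared by: $x\prec y$ iff at the largest index $i$ with $x_i\ne y_i$, $x_i$ precedes $y_i$. $T_p x$ is the successor of $x$. For $q\in(0,1/a_0)$ let $t_q\in(0,1)$ be the unique solution of $a_0q^d+a_1q^{d-1}t+\dots+a_dt^d=q^{d-1}$; $\mu_q$ is the product measure under which the $x_n$ are independent and every edge of type $j$ has probability $t_q^j/q^{j-1}$ (it is $T_p$-invariant and ergodic).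 A cylindric function of rank $N$ is constant on every cylinder $\{x:x_1=c_1,\dots,x_N=c_N\}$. For $x$ and integer $j\ge0$, $S^g_x(j)=\sum_{k=0}^{j-1}g(T_p^kx)$, $F^g_x$ is its piecewise-linear interpolation on $[0,\infty)$, $R^g_{x,l}=\max_{t\in[0,1]}|F^g_x(tl)-tF^g_x(l)|$ and, if $R^g_{x,l}>0$, $\varphi^g_{x,l}(t)=(F^g_x(tl)-tF^g_x(l))/R^g_{x,l}$. $g$ is cohomologous to a constant in $L^\infty$ if $g=c+h\circ T_p-h$ a.e. for some $c\in\mathbb R$, $h\in L^\infty$. *)

theory Defs
  imports "HOL-Probability.Probability"
begin

text \<open>Polynomial adic systems. The polynomial p is given by its degree d and the
coefficient function a (only a 0, ..., a d are relevant).
An edge between levels n and n+1 is encoded (together with the source vertex, which is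
determined by the earlier part of the path) by the pair (j, c): its type j (0 \<le> j \<le> d)
and its copy index c < a j among the parallel edges of that type.
An infinite path x = (x_1, x_2, ...) is represented by a function nat \<Rightarrow> nat \<times> nat
with x i standing for x_(i+1).\<close>

definition Xp :: "(nat \<Rightarrow> nat) \<Rightarrow> nat \<Rightarrow> (nat \<Rightarrow> nat \<times> nat) set" where
  "Xp a d = {x. \<forall>i. fst (x i) \<le> d \<and> snd (x i) < a (fst (x i))}"

text \<open>Second coordinate k of the vertex (n, k) through which the path x passes at level n.\<close>
definition vert :: "(nat \<Rightarrow> nat \<times> nat) \<Rightarrow> nat \<Rightarrow> nat" where
  "vert x n = (\<Sum>i<n. fst (x i))"

text \<open>Paths agreeing (as sequences of edges of the diagram) from some index on.\<close>
definition cofinal :: "(nat \<Rightarrow> nat \<times> nat) \<Rightarrow> (nat \<Rightarrow> nat \<times> nat) \<Rightarrow> bool" where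
  "cofinal x y \<longleftrightarrow> (\<exists>m. vert x m = vert y m \<and> (\<forall>i\<ge>m. x i = y i))"

definition edge_prec :: "nat \<times> nat \<Rightarrow> nat \<times> nat \<Rightarrow> bool" where
  "edge_prec e e' \<longleftrightarrow> fst e' < fst e \<or> (fst e = fst e' \<and> snd e < snd e')"

definition adic_less :: "(nat \<Rightarrow> nat \<times> nat) \<Rightarrow> (nat \<Rightarrow> nat \<times> nat) \<Rightarrow> bool" where
  "adic_less x y \<longleftrightarrow> cofinal x y \<and> x \<noteq> y \<and>
     (let i = (GREATEST i. x i \<noteq> y i) in edge_prec (x i) (y i))"

text \<open>The adic transformation: successor of x (set to x itself on maximal paths,
a set of measure zero).\<close>
definition Tp :: "(nat \<Rightarrow> nat) \<Rightarrow> nat \<Rightarrow> (nat \<Rightarrow> nat \<times> nat) \<Rightarrow> (nat \<Rightarrow> nat \<times> nat)" where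
  "Tp a d x = (if \<exists>y\<in>Xp a d. adic_less x y
     then (THE y. y \<in> Xp a d \<and> adic_less x y \<and>
                  (\<forall>z\<in>Xp a d. adic_less x z \<longrightarrow> z = y \<or> adic_less y z))
     else x)"

definition tq :: "(nat \<Rightarrow> nat) \<Rightarrow> nat \<Rightarrow> real \<Rightarrow> real" where
  "tq a d q = (THE t. 0 < t \<and> t < 1 \<and>
      (\<Sum>j\<le>d. real (a j) * q ^ (d - j) * t ^ j) = q ^ (d - 1))"

definition edge_weight :: "(nat \<Rightarrow> nat) \<Rightarrow> nat \<Rightarrow> real \<Rightarrow> nat \<times> nat \<Rightarrow> real" where
  "edge_weight a d q e = (if fst e \<le> d \<and> snd e < a (fst e)
      then tq a d q ^ fst e * q / q ^ fst e else 0)"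

definition edge_measure :: "(nat \<Rightarrow> nat) \<Rightarrow> nat \<Rightarrow> real \<Rightarrow> (nat \<times> nat) measure" where
  "edge_measure a d q = density (count_space UNIV) (\<lambda>e. ennreal (edge_weight a d q e))"

definition mu :: "(nat \<Rightarrow> nat) \<Rightarrow> nat \<Rightarrow> real \<Rightarrow> (nat \<Rightarrow> nat \<times> nat) measure" where
  "mu a d q = PiM UNIV (\<lambda>_. edge_measure a d q)"

definition cylindric :: "(nat \<Rightarrow> nat) \<Rightarrow> nat \<Rightarrow> nat \<Rightarrow> ((nat \<Rightarrow> nat \<times> nat) \<Rightarrow> real) \<Rightarrow> bool" where
  "cylindric a d N g \<longleftrightarrow> (\<forall>x\<in>Xp a d. \<forall>y\<in>Xp a d. (\<forall>i<N. x i = y i) \<longrightarrow> g x = g y)"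

definition cohom_const :: "(nat \<Rightarrow> nat) \<Rightarrow> nat \<Rightarrow> real \<Rightarrow> ((nat \<Rightarrow> nat \<times> nat) \<Rightarrow> real) \<Rightarrow> bool" where
  "cohom_const a d q g \<longleftrightarrow> (\<exists>c::real. \<exists>h. h \<in> borel_measurable (mu a d q) \<and>
      (\<exists>B. AE x in mu a d q. \<bar>h x\<bar> \<le> B) \<and>
      (AE x in mu a d q. g x = c + h (Tp a d x) - h x))"

definition Sg :: "(nat \<Rightarrow> nat) \<Rightarrow> nat \<Rightarrow> ((nat \<Rightarrow> nat \<times> nat) \<Rightarrow> real) \<Rightarrow> (nat \<Rightarrow> nat \<times> nat) \<Rightarrow> nat \<Rightarrow> real" where
  "Sg a d g x j = (\<Sum>k<j. g ((Tp a d ^^ k) x))"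

definition Fg :: "(nat \<Rightarrow> nat) \<Rightarrow> nat \<Rightarrow> ((nat \<Rightarrow> nat \<times> nat) \<Rightarrow> real) \<Rightarrow> (nat \<Rightarrow> nat \<times> nat) \<Rightarrow> real \<Rightarrow> real" where
  "Fg a d g x s = (let m = nat \<lfloor>s\<rfloor> in
      Sg a d g x m + (s - real m) * (Sg a d g x (Suc m) - Sg a d g x m))"

definition Rg :: "(nat \<Rightarrow> nat) \<Rightarrow> nat \<Rightarrow> ((nat \<Rightarrow> nat \<times> nat) \<Rightarrow> real) \<Rightarrow> (nat \<Rightarrow> nat \<times> nat) \<Rightarrow> nat \<Rightarrow> real" where
  "Rg a d g x l = (SUP t\<in>{0..1::real}. \<bar>Fg a d g x (t * real l) - t * Fg a d g x (real l)\<bar>)"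

definition phig :: "(nat \<Rightarrow> nat) \<Rightarrow> nat \<Rightarrow> ((nat \<Rightarrow> nat \<times> nat) \<Rightarrow> real) \<Rightarrow> (nat \<Rightarrow> nat \<times> nat) \<Rightarrow> nat \<Rightarrow> real \<Rightarrow> real" where
  "phig a d g x l t = (Fg a d g x (t * real l) - t * Fg a d g x (real l)) / Rg a d g x l"

definition has_limit_curve :: "(nat \<Rightarrow> nat) \<Rightarrow> nat \<Rightarrow> ((nat \<Rightarrow> nat \<times> nat) \<Rightarrow> real) \<Rightarrow> (nat \<Rightarrow> nat \<times> nat) \<Rightarrow> bool" where
  "has_limit_curve a d g x \<longleftrightarrow> (\<exists>l :: nat \<Rightarrow> nat. (\<forall>n. 0 < l n) \<and> filterlim l at_top sequentially \<and>
      (\<forall>n. 0 < Rg a d g x (l n)) \<and>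
      (\<exists>\<phi>. continuous_on {0..1} \<phi> \<and> uniform_limit {0..1} (\<lambda>n. phig a d g x (l n)) \<phi> sequentially))"

end

theory Submission
  imports Defs "HOL-Computational_Algebra.Polynomial" "HOL-Real_Asymp.Real_Asymp"
    "HOL-Complex_Analysis.Great_Picard"
begin

text \<open>
  Put z = t/q and let P be the generating polynomial of the type of a random edge. The sums of g
  over the paths to the vertices (n, k), weighted by q ^ n * z ^ k, are the coefficients of P ^ (n -
  N) * G with a fixed polynomial G. Let c = G(1). If G = c P ^ N, every tower of level N has
  g-average c and the partial sums of g - c along these towers form a bounded transfer function.
  Otherwise G - c P ^ N = (1 - x) ^ (r + 1) * E with E(1) nonzero, and a local limit theorem for
  differences of the coefficients of P ^ n shows that near the typical k the discrepancy of g along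
  the tower of (n, k) has the exact order rho = q ^ (-n) * z ^ (-k) * n ^ (-(r + 3) / 2), as long as
  a Hermite polynomial does not vanish at the normalised position of k. The discrepancy inside the
  subtowers m levels below is smaller by a factor exponentially small in m, which gives
  equicontinuity of the normalised curves; the Arzela-Ascoli theorem yields a limiting curve. Levels
  at which the position of k is good recur almost surely by the Borel zero-one law for independent
  blocks of edges. Conversely, the discrepancy of a coboundary is bounded, so a single step of the
  orbit at which g differs from c would become a jump of the limiting curve.
\<close>

section \<open>The adic order and the successor map\<close>

text \<open>The constant \<open>c\<close> is the integral of \<open>g\<close>, since q ^ n * z ^ k
  is the probability of a path to (n, k). Subtracting it is too crude for the upper bounds: the
  weighted discrepancy of a whole tower is of order n ^ (-(r + 2) / 2), larger than rho by sqrt n.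
  So along the tower of (n, k) the function is centred by its average over that very tower,
  \<open>slope n k\<close>; the curves do not see the constant, and what remains are increments of
  coefficients between vertices, each worth another factor 1 - x. The same cancellation governs the
  lower bound. Three times on the orbit (the entry to a copy of the tower of (n - 1, k), the end of
  its subtowers of type d, the exit) measure the deviation from a straight line by a determinant of
  tower sums and heights. Its leading terms cancel, and a Wronskian identity for derivatives of the
  Gaussian density leaves the r-th Hermite polynomial, although the discrepancy vanishes to order r
  + 1. To evaluate these limits the positions of k must converge, which compactness of a window
  provides.\<close>

lemma edge_prec_irrefl: "\<not> edge_prec e e"
  by (simp add: edge_prec_def)

lemma edge_prec_trans: "edge_prec e f \<Longrightarrow> edge_prec f g \<Longrightarrow> edge_prec e g"
  by (auto simp: edge_prec_def)

lemma edge_prec_total: "e \<noteq> f \<Longrightarrow> edge_prec e f \<or> edge_prec f e"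
  by (cases e; cases f) (auto simp: edge_prec_def)

lemma vert_0 [simp]: "vert x 0 = 0"
  by (simp add: vert_def)

lemma vert_Suc: "vert x (Suc n) = vert x n + fst (x n)"
  by (simp add: vert_def)

lemma vert_add_tail: "n \<le> m \<Longrightarrow> vert x m = vert x n + (\<Sum>i=n..<m. fst (x i))"
  by (induction m rule: dec_induct) (auto simp: vert_Suc)

lemma vert_eq_of_tail_eq:
  assumes "\<And>i. n \<le> i \<Longrightarrow> x i = y i" "n \<le> m"
  shows "vert x m = vert y m \<longleftrightarrow> vert x n = vert y n"
proof -
  have "(\<Sum>i=n..<m. fst (x i)) = (\<Sum>i=n..<m. fst (y i))"
    using assms by (intro sum.cong) auto
  thus ?thesis using vert_add_tail[OF assms(2)] by auto
qed

lemma vert_cong: "(\<And>i. i < n \<Longrightarrow> x i = y i) \<Longrightarrow> vert x n = vert y n"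
  by (simp add: vert_def)

text \<open>Trades the \<open>GREATEST\<close> of the definition for a witness. Equality of the
  vertices, known at some late level, descends to level \<open>Suc i\<close> because all edges in
  between agree.\<close>

lemma adic_less_iff:
  "adic_less x y \<longleftrightarrow> (\<exists>i. edge_prec (x i) (y i) \<and> (\<forall>j>i. x j = y j) \<and> vert x (Suc i) = vert y (Suc i))"
proof
  assume L: "adic_less x y"
  then obtain m where m: "vert x m = vert y m" "\<forall>i\<ge>m. x i = y i"
    by (auto simp: adic_less_def cofinal_def)
  have ne: "x \<noteq> y" using L by (simp add: adic_less_def)
  then obtain i0 where i0: "x i0 \<noteq> y i0" by blast
  have bnd: "\<forall>i. x i \<noteq> y i \<longrightarrow> i \<le> m" using m by (metis nle_le)
  define i where "i = (GREATEST i. x i \<noteq> y i)"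
  have 1: "x i \<noteq> y i" unfolding i_def by (rule GreatestI_nat[of "\<lambda>i. x i \<noteq> y i", OF i0]) (use bnd in auto)
  have 2: "x j = y j" if "j > i" for j
    using Greatest_le_nat[of "\<lambda>i. x i \<noteq> y i" j m] bnd that unfolding i_def by (meson leD)
  have "Suc i \<le> m" using 1 m by (metis not_less_eq_eq)
  with m have 3: "vert x (Suc i) = vert y (Suc i)"
    using vert_eq_of_tail_eq[of "Suc i" x y m] 2 by auto
  have "edge_prec (x i) (y i)" using L by (simp add: adic_less_def Let_def i_def)
  with 2 3 show "\<exists>i. edge_prec (x i) (y i) \<and> (\<forall>j>i. x j = y j) \<and> vert x (Suc i) = vert y (Suc i)" by blast
next
  assume "\<exists>i. edge_prec (x i) (y i) \<and> (\<forall>j>i. x j = y j) \<and> vert x (Suc i) = vert y (Suc i)"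
  then obtain i where i: "edge_prec (x i) (y i)" "\<forall>j>i. x j = y j" "vert x (Suc i) = vert y (Suc i)" by blast
  have ne: "x i \<noteq> y i" using i(1) edge_prec_irrefl by metis
  have "(GREATEST i. x i \<noteq> y i) = i"
    using ne i(2) by (intro Greatest_equality) (auto simp: not_less[symmetric])
  moreover have "cofinal x y" unfolding cofinal_def using i by (intro exI[of _ "Suc i"]) auto
  ultimately show "adic_less x y" using i ne by (auto simp: adic_less_def)
qed

lemma adic_less_irrefl: "\<not> adic_less x x"
  by (simp add: adic_less_def)

lemma adic_less_trans:
  assumes "adic_less x y" "adic_less y w"
  shows "adic_less x w"
proof -
  obtain i where i: "edge_prec (x i) (y i)" "\<forall>j>i. x j = y j" "vert x (Suc i) = vert y (Suc i)"
    using assms adic_less_iff by metis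
  obtain j where j: "edge_prec (y j) (w j)" "\<forall>i>j. y i = w i" "vert y (Suc j) = vert w (Suc j)"
    using assms adic_less_iff by metis
  define k where "k = max i j"
  have tail: "x l = w l" if "l > k" for l using that i j by (auto simp: k_def)
  have "edge_prec (x k) (w k)"
    using i j edge_prec_trans by (cases i j rule: linorder_cases) (auto simp: k_def max_def)
  moreover have "vert x (Suc k) = vert y (Suc k)"
    using vert_eq_of_tail_eq[of "Suc i" x y "Suc k"] i by (auto simp: k_def)
  moreover have "vert y (Suc k) = vert w (Suc k)"
    using vert_eq_of_tail_eq[of "Suc j" y w "Suc k"] j by (auto simp: k_def)
  ultimately show ?thesis using tail unfolding adic_less_iff by metis
qed

lemma adic_less_asym: "adic_less x y \<Longrightarrow> \<not> adic_less y x"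
  using adic_less_trans adic_less_irrefl by blast

text \<open>\<open>x\<close> supplies only the tail and need not pass through (m, k). This freedom
  lets tails be exchanged and lets a tower be cut according to its last edge.\<close>

definition tower :: "(nat \<Rightarrow> nat) \<Rightarrow> nat \<Rightarrow> nat \<Rightarrow> nat \<Rightarrow> (nat \<Rightarrow> nat \<times> nat) \<Rightarrow> (nat \<Rightarrow> nat \<times> nat) set" where
  "tower a d m k x = {y \<in> Xp a d. vert y m = k \<and> (\<forall>i\<ge>m. y i = x i)}"

definition edges :: "(nat \<Rightarrow> nat) \<Rightarrow> nat \<Rightarrow> (nat \<times> nat) set" where
  "edges a d = (SIGMA j:{..d}. {..<a j})"

lemma finite_edges [simp]: "finite (edges a d)"
  by (simp add: edges_def)

lemma Xp_iff: "x \<in> Xp a d \<longleftrightarrow> (\<forall>i. x i \<in> edges a d)"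
proof -
  have "e \<in> edges a d \<longleftrightarrow> fst e \<le> d \<and> snd e < a (fst e)" for e
    by (cases e) (simp add: edges_def)
  thus ?thesis by (simp add: Xp_def)
qed

lemma finite_tower [simp]: "finite (tower a d m k x)"
proof (rule finite_subset)
  show "tower a d m k x \<subseteq> (\<lambda>f i. if i < m then f i else x i) ` (PiE {..<m} (\<lambda>_. edges a d))"
  proof
    fix y assume y: "y \<in> tower a d m k x"
    have "y = (\<lambda>i. if i < m then restrict y {..<m} i else x i)"
      using y by (auto simp: tower_def fun_eq_iff)
    moreover have "restrict y {..<m} \<in> PiE {..<m} (\<lambda>_. edges a d)"
      using y by (auto simp: tower_def Xp_iff)
    ultimately show "y \<in> (\<lambda>f i. if i < m then f i else x i) ` (PiE {..<m} (\<lambda>_. edges a d))"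
      by (rule image_eqI)
  qed
  show "finite ((\<lambda>f i. if i < m then f i else x i) ` (PiE {..<m} (\<lambda>_. edges a d)))"
    by (intro finite_imageI finite_PiE) auto
qed

section \<open>The level-n tower of a path as a finite linearly ordered set\<close>

definition cls :: "(nat \<Rightarrow> nat) \<Rightarrow> nat \<Rightarrow> nat \<Rightarrow> (nat \<Rightarrow> nat \<times> nat) \<Rightarrow> (nat \<Rightarrow> nat \<times> nat) set" where
  "cls a d n x = tower a d n (vert x n) x"

lemma finite_cls [simp]: "finite (cls a d n x)"
  by (simp add: cls_def)

lemma cls_self: "x \<in> Xp a d \<Longrightarrow> x \<in> cls a d n x"
  by (simp add: cls_def tower_def)

lemma cls_Xp: "y \<in> cls a d n x \<Longrightarrow> y \<in> Xp a d"
  by (simp add: cls_def tower_def)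

lemma cls_eq: "y \<in> cls a d n x \<Longrightarrow> cls a d n y = cls a d n x"
  by (auto simp: cls_def tower_def)

lemma cls_mono: "m \<le> n \<Longrightarrow> cls a d m x \<subseteq> cls a d n x"
  using vert_eq_of_tail_eq[of m _ x n] by (auto simp: cls_def tower_def)

lemma cls_total:
  assumes "y \<in> cls a d n x" "w \<in> cls a d n x" "y \<noteq> w"
  shows "adic_less y w \<or> adic_less w y"
proof -
  have eq: "\<forall>i\<ge>n. y i = w i" "vert y n = vert w n" using assms by (auto simp: cls_def tower_def)
  obtain i0 where i0: "y i0 \<noteq> w i0" using assms by blast
  have bnd: "\<forall>i. y i \<noteq> w i \<longrightarrow> i \<le> n" using eq by (metis nle_le)
  define i where "i = (GREATEST i. y i \<noteq> w i)"
  have 1: "y i \<noteq> w i" unfolding i_def by (rule GreatestI_nat[of "\<lambda>i. y i \<noteq> w i", OF i0]) (use bnd in auto)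
  have c: "cofinal y w" "cofinal w y" using eq unfolding cofinal_def by metis+
  have i': "i = (GREATEST i. w i \<noteq> y i)" unfolding i_def by (rule arg_cong[where f=Greatest]) auto
  from edge_prec_total[OF 1] show ?thesis using c assms(3) i' i_def
    by (auto simp: adic_less_def)
qed

text \<open>If \<open>w\<close> lies outside the level-n class of \<open>x\<close>, the last index
  where they differ is at least n, so the comparison never looks at the first n edges. Level-n
  classes are thus compared as whole blocks.\<close>

lemma adic_less_upper_tail:
  assumes "adic_less x w" "w \<notin> cls a d n x" "w \<in> Xp a d"
    and "\<forall>i\<ge>n. y i = x i" "vert y n = vert x n"
    and "\<forall>i\<ge>n. v i = w i" "vert v n = vert w n"
  shows "adic_less y v"
proof -
  obtain i where i: "edge_prec (x i) (w i)" "\<forall>j>i. x j = w j" "vert x (Suc i) = vert w (Suc i)"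
    using assms adic_less_iff by metis
  have "i \<ge> n"
  proof (rule ccontr)
    assume "\<not> i \<ge> n"
    hence "\<forall>j\<ge>n. w j = x j" "vert x n = vert w n"
      using i vert_eq_of_tail_eq[of "Suc i" x w n] by auto
    thus False using assms by (auto simp: cls_def tower_def)
  qed
  moreover have "vert y (Suc i) = vert x (Suc i)" "vert v (Suc i) = vert w (Suc i)"
    using vert_eq_of_tail_eq[of n y x "Suc i"] vert_eq_of_tail_eq[of n v w "Suc i"] assms \<open>i \<ge> n\<close> by auto
  ultimately show ?thesis using i assms unfolding adic_less_iff by (intro exI[of _ i]) auto
qed

definition below :: "(nat \<Rightarrow> nat) \<Rightarrow> nat \<Rightarrow> nat \<Rightarrow> (nat \<Rightarrow> nat \<times> nat) \<Rightarrow> (nat \<Rightarrow> nat \<times> nat) set" where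
  "below a d n x = {y \<in> cls a d n x. adic_less y x}"

lemma finite_below [simp]: "finite (below a d n x)"
  by (simp add: below_def)

abbreviation pos :: "(nat \<Rightarrow> nat) \<Rightarrow> nat \<Rightarrow> nat \<Rightarrow> (nat \<Rightarrow> nat \<times> nat) \<Rightarrow> nat" where
  "pos a d n x \<equiv> card (below a d n x)"

lemma pos_mono:
  assumes "y \<in> cls a d n x" "w \<in> cls a d n x" "adic_less y w"
  shows "pos a d n y < pos a d n w"
proof (rule psubset_card_mono)
  have "y \<in> below a d n w" "y \<notin> below a d n y"
    using assms adic_less_irrefl cls_eq[OF assms(2)] by (auto simp: below_def)
  moreover have "below a d n y \<subseteq> below a d n w"
    using assms adic_less_trans cls_eq[OF assms(1)] cls_eq[OF assms(2)] by (auto simp: below_def)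
  ultimately show "below a d n y \<subset> below a d n w" by blast
qed simp

lemma Tp_eqI:
  assumes "y \<in> Xp a d" "adic_less x y" "\<And>w. w \<in> Xp a d \<Longrightarrow> adic_less x w \<Longrightarrow> w = y \<or> adic_less y w"
  shows "Tp a d x = y"
proof -
  have "(THE y. y \<in> Xp a d \<and> adic_less x y \<and>
                  (\<forall>z\<in>Xp a d. adic_less x z \<longrightarrow> z = y \<or> adic_less y z)) = y"
    using assms adic_less_asym by (intro the_equality) blast+
  thus ?thesis using assms by (auto simp: Tp_def)
qed

text \<open>The least element above \<open>x\<close> in the finite class is the successor among all
  paths: a larger path outside the class lies above the whole class by
  \<open>adic_less_upper_tail\<close>.\<close>

lemma Tp_succ:
  assumes x: "x \<in> Xp a d" and ex: "\<exists>y\<in>cls a d n x. adic_less x y"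
  shows "Tp a d x \<in> cls a d n x \<and> adic_less x (Tp a d x) \<and>
    (\<forall>w\<in>Xp a d. adic_less x w \<longrightarrow> w = Tp a d x \<or> adic_less (Tp a d x) w)"
proof -
  obtain y where y: "y \<in> cls a d n x" "adic_less x y"
    and least: "\<And>w. w \<in> cls a d n x \<Longrightarrow> adic_less x w \<Longrightarrow> card (below a d n y) \<le> card (below a d n w)"
    using ex_has_least_nat[of "\<lambda>y. y \<in> cls a d n x \<and> adic_less x y" _ "\<lambda>y. card (below a d n y)"] ex
    by metis
  have suc: "w = y \<or> adic_less y w" if w: "w \<in> Xp a d" "adic_less x w" for w
  proof (cases "w \<in> cls a d n x")
    case True
    with cls_total[OF y(1) this] least pos_mono[OF this y(1)] y w show ?thesis by (metis not_less)
  next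
    case False
    thus ?thesis using y w
      by (intro disjI2 adic_less_upper_tail[of x w a d n y w]) (auto simp: cls_def tower_def)
  qed
  have "Tp a d x = y"
    using y suc by (intro Tp_eqI) (auto dest: cls_Xp)
  with y suc show ?thesis by blast
qed

lemma ex_cls_of_adic_less:
  assumes "adic_less x y" "y \<in> Xp a d"
  shows "\<exists>n. y \<in> cls a d n x"
proof -
  obtain i where "\<forall>j>i. x j = y j" "vert x (Suc i) = vert y (Suc i)"
    using assms adic_less_iff by metis
  thus ?thesis using assms by (intro exI[of _ "Suc i"]) (auto simp: cls_def tower_def)
qed

lemma Tp_cls_or_fixed:
  assumes "x \<in> Xp a d"
  shows "Tp a d x = x \<or> (\<exists>n. Tp a d x \<in> cls a d n x)"
proof (cases "\<exists>y\<in>Xp a d. adic_less x y")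
  case True
  then obtain y n where "y \<in> cls a d n x" "adic_less x y" using ex_cls_of_adic_less by metis
  thus ?thesis using Tp_succ[OF assms] by blast
qed (auto simp: Tp_def)

lemma Tp_Xp: "x \<in> Xp a d \<Longrightarrow> Tp a d x \<in> Xp a d"
  using Tp_cls_or_fixed cls_Xp by metis

lemma Tp_pow_Xp: "x \<in> Xp a d \<Longrightarrow> (Tp a d ^^ i) x \<in> Xp a d"
  by (induction i) (auto simp: Tp_Xp)

lemma below_Tp:
  assumes x: "x \<in> Xp a d" and ex: "\<exists>y\<in>cls a d n x. adic_less x y"
  shows "below a d n (Tp a d x) = insert x (below a d n x)"
proof -
  note T = Tp_succ[OF x ex]
  have c: "cls a d n (Tp a d x) = cls a d n x" using T cls_eq by blast
  show ?thesis
  proof (intro set_eqI iffI)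
    fix y assume "y \<in> below a d n (Tp a d x)"
    hence y: "y \<in> cls a d n x" "adic_less y (Tp a d x)" using c by (auto simp: below_def)
    have "y = x \<or> adic_less y x"
      using cls_total[OF y(1) cls_self[OF x]] T y cls_Xp adic_less_asym adic_less_irrefl by metis
    thus "y \<in> insert x (below a d n x)" using y by (auto simp: below_def)
  next
    fix y assume "y \<in> insert x (below a d n x)"
    thus "y \<in> below a d n (Tp a d x)" using T c cls_self[OF x] adic_less_trans
      by (auto simp: below_def)
  qed
qed

text \<open>The primitive of \<open>f\<close> along the level-n tower, from its bottom up to but
  excluding \<open>x\<close>. Orbit sums inside a tower are differences of this function.\<close>

definition Fs :: "(nat \<Rightarrow> nat) \<Rightarrow> nat \<Rightarrow> nat \<Rightarrow> ((nat \<Rightarrow> nat \<times> nat) \<Rightarrow> real) \<Rightarrow> (nat \<Rightarrow> nat \<times> nat) \<Rightarrow> real" where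
  "Fs a d n f x = (\<Sum>y\<in>below a d n x. f y)"

lemma not_below_self: "x \<notin> below a d n x"
  by (simp add: below_def adic_less_irrefl)

lemma Fs_Tp:
  assumes "x \<in> Xp a d" "\<exists>y\<in>cls a d n x. adic_less x y"
  shows "Fs a d n f (Tp a d x) = Fs a d n f x + f x" "pos a d n (Tp a d x) = Suc (pos a d n x)"
  using below_Tp[OF assms] not_below_self[of x a d n] by (auto simp: Fs_def)

lemma cls_max:
  assumes "x \<in> Xp a d" "\<not> (\<exists>y\<in>cls a d n x. adic_less x y)"
  shows "cls a d n x = insert x (below a d n x)"
  using assms cls_total cls_self by (fastforce simp: below_def)

lemma pos_less:
  assumes "x \<in> Xp a d" shows "pos a d n x < card (cls a d n x)"
proof (rule psubset_card_mono)
  show "below a d n x \<subset> cls a d n x" using cls_self[OF assms] not_below_self[of x a d n]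
    by (auto simp: below_def)
qed simp

lemma not_max_iff_pos:
  assumes "x \<in> Xp a d"
  shows "(\<exists>y\<in>cls a d n x. adic_less x y) \<longleftrightarrow> Suc (pos a d n x) < card (cls a d n x)"
proof
  assume ex: "\<exists>y\<in>cls a d n x. adic_less x y"
  have "Suc (pos a d n x) = pos a d n (Tp a d x)" using Fs_Tp[OF assms ex] by simp
  also have "\<dots> < card (cls a d n (Tp a d x))" by (rule pos_less[OF Tp_Xp[OF assms]])
  finally show "Suc (pos a d n x) < card (cls a d n x)" using Tp_succ[OF assms ex] cls_eq by metis
next
  assume "Suc (pos a d n x) < card (cls a d n x)"
  thus "\<exists>y\<in>cls a d n x. adic_less x y"
    using cls_max[OF assms] not_below_self[of x a d n] by (metis card_insert_disjoint finite_below less_irrefl)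
qed

lemma Tp_pow_cls:
  assumes x: "x \<in> Xp a d" and "pos a d n x + i < card (cls a d n x)"
  shows "(Tp a d ^^ i) x \<in> cls a d n x \<and> pos a d n ((Tp a d ^^ i) x) = pos a d n x + i \<and>
    Fs a d n f ((Tp a d ^^ i) x) = Fs a d n f x + Sg a d f x i"
  using assms(2)
proof (induction i)
  case 0
  thus ?case using cls_self[OF x] by (simp add: Sg_def)
next
  case (Suc i)
  define y where "y = (Tp a d ^^ i) x"
  have y: "y \<in> cls a d n x" "pos a d n y = pos a d n x + i" "Fs a d n f y = Fs a d n f x + Sg a d f x i"
    using Suc by (auto simp: y_def)
  have yX: "y \<in> Xp a d" using y cls_Xp by blast
  have ex: "\<exists>w\<in>cls a d n y. adic_less y w"
    using not_max_iff_pos[OF yX, of n] y Suc.prems cls_eq[OF y(1)] by simp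
  show ?case using Fs_Tp[OF yX ex] Tp_succ[OF yX ex] y cls_eq[OF y(1)]
    by (auto simp: y_def Sg_def)
qed

lemma Fs_plus_max:
  assumes x: "x \<in> Xp a d" and "\<not> (\<exists>y\<in>cls a d n x. adic_less x y)"
  shows "Fs a d n f x + f x = (\<Sum>y\<in>cls a d n x. f y)"
  using cls_max[OF assms] not_below_self[of x a d n] by (simp add: Fs_def)

text \<open>This many steps leave the tower, so \<open>Tp_pow_cls\<close> reaches only the top path
  and its summand is added separately.\<close>

lemma Sg_to_top:
  assumes x: "x \<in> Xp a d"
  shows "Fs a d n f x + Sg a d f x (card (cls a d n x) - pos a d n x) = (\<Sum>y\<in>cls a d n x. f y)"
proof -
  define i where "i = card (cls a d n x) - pos a d n x - 1"
  have i: "pos a d n x + i < card (cls a d n x)" "card (cls a d n x) - pos a d n x = Suc i"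
    using pos_less[OF x, of n] by (auto simp: i_def)
  define y where "y = (Tp a d ^^ i) x"
  have y: "y \<in> cls a d n x" "pos a d n y = pos a d n x + i" "Fs a d n f y = Fs a d n f x + Sg a d f x i"
    using Tp_pow_cls[OF x i(1)] by (auto simp: y_def)
  have yX: "y \<in> Xp a d" using y cls_Xp by blast
  have "\<not> (\<exists>w\<in>cls a d n y. adic_less y w)"
    using not_max_iff_pos[OF yX, of n] y i cls_eq[OF y(1)] by simp
  from Fs_plus_max[OF yX this, of f] cls_eq[OF y(1)] y i show ?thesis
    by (simp add: Sg_def y_def)
qed

text \<open>Leaving a level-m tower at its top, the orbit enters the next one at its bottom: a path
  below \<open>Tp a d x\<close> in its class would still be above \<open>x\<close>, against the
  minimality of the successor.\<close>

lemma below_Tp_of_max: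
  assumes x: "x \<in> Xp a d" and mx: "\<not> (\<exists>y\<in>cls a d m x. adic_less x y)"
    and ex: "\<exists>y\<in>Xp a d. adic_less x y"
  shows "below a d m (Tp a d x) = {}"
proof -
  obtain y n where "y \<in> cls a d n x" "adic_less x y" using ex ex_cls_of_adic_less by metis
  hence T: "Tp a d x \<in> Xp a d" "adic_less x (Tp a d x)"
    "\<forall>w\<in>Xp a d. adic_less x w \<longrightarrow> w = Tp a d x \<or> adic_less (Tp a d x) w"
    using Tp_succ[OF x] cls_Xp by blast+
  have nc: "Tp a d x \<notin> cls a d m x" using mx T by blast
  have False if y: "y \<in> cls a d m (Tp a d x)" "adic_less y (Tp a d x)" for y
  proof -
    have "adic_less x y"
      using y by (intro adic_less_upper_tail[OF T(2) nc T(1)]) (auto simp: cls_def tower_def)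
    thus False using T y cls_Xp adic_less_asym adic_less_irrefl by metis
  qed
  thus ?thesis by (auto simp: below_def)
qed

section \<open>Tower sums and their generating polynomials\<close>

lemma in_edges: "e \<in> edges a d \<longleftrightarrow> fst e \<le> d \<and> snd e < a (fst e)"
  by (cases e) (simp add: edges_def)

lemma cylindricD:
  assumes "cylindric a d N f" "x \<in> Xp a d" "y \<in> Xp a d" "\<And>i. i < N \<Longrightarrow> x i = y i"
  shows "f x = f y"
  using assms unfolding cylindric_def by blast

lemma cylindric_diff_const:
  assumes "cylindric a d N f"
  shows "cylindric a d N (\<lambda>x. f x - c)"
  unfolding cylindric_def using cylindricD[OF assms] by (metis (no_types, lifting))

text \<open>Exchanging the tail beyond level m is a bijection between the two towers and, as N \<le>
  m, leaves the edges that \<open>f\<close> sees alone.\<close>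

lemma tower_sum_tail:
  assumes f: "cylindric a d N f" and m: "N \<le> m" and x: "x \<in> Xp a d" and x': "x' \<in> Xp a d"
  shows "(\<Sum>y\<in>tower a d m k x. f y) = (\<Sum>y\<in>tower a d m k x'. f y)"
proof (rule sum.reindex_bij_witness[where i = "\<lambda>y i. if i < m then y i else x i"
      and j = "\<lambda>y i. if i < m then y i else x' i"])
  fix y assume y: "y \<in> tower a d m k x"
  have v: "vert (\<lambda>i. if i < m then y i else x' i) m = vert y m" by (rule vert_cong) simp
  show "(\<lambda>i. if i < m then if i < m then y i else x' i else x i) = y"
    using y by (auto simp: tower_def fun_eq_iff)
  show t: "(\<lambda>i. if i < m then y i else x' i) \<in> tower a d m k x'"
    using y x' v by (auto simp: tower_def Xp_iff)
  show "f (\<lambda>i. if i < m then y i else x' i) = f y"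
    using f y t m unfolding cylindric_def tower_def by auto
next
  fix y assume y: "y \<in> tower a d m k x'"
  have v: "vert (\<lambda>i. if i < m then y i else x i) m = vert y m" by (rule vert_cong) simp
  show "(\<lambda>i. if i < m then if i < m then y i else x i else x' i) = y"
    using y by (auto simp: tower_def fun_eq_iff)
  show "(\<lambda>i. if i < m then y i else x i) \<in> tower a d m k x"
    using y x v by (auto simp: tower_def Xp_iff)
qed

text \<open>The constant tail is an arbitrary choice; for cylindric \<open>f\<close> and m \<ge> N
  the value does not depend on it by \<open>tower_sum_tail\<close>.\<close>

definition Gs :: "(nat \<Rightarrow> nat) \<Rightarrow> nat \<Rightarrow> ((nat \<Rightarrow> nat \<times> nat) \<Rightarrow> real) \<Rightarrow> nat \<Rightarrow> nat \<Rightarrow> real" where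
  "Gs a d f m k = (\<Sum>y\<in>tower a d m k (\<lambda>_. (0, 0)). f y)"

lemma const_path_Xp: "0 < a 0 \<Longrightarrow> (\<lambda>_. (0, 0)) \<in> Xp a d"
  by (simp add: Xp_def)

lemma tower_sum_eq_Gs:
  assumes "cylindric a d N f" "N \<le> m" "x \<in> Xp a d" "0 < a 0"
  shows "(\<Sum>y\<in>tower a d m k x. f y) = Gs a d f m k"
  unfolding Gs_def using assms const_path_Xp by (intro tower_sum_tail) auto

lemma cls_sum_eq_Gs:
  assumes "cylindric a d N f" "N \<le> m" "x \<in> Xp a d" "0 < a 0"
  shows "(\<Sum>y\<in>cls a d m x. f y) = Gs a d f m (vert x m)"
  unfolding cls_def by (rule tower_sum_eq_Gs[OF assms])

lemma tower_Suc_slice: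
  assumes "x \<in> Xp a d" "e \<in> edges a d"
  shows "{y \<in> tower a d (Suc m) k x. y m = e} =
    (if fst e \<le> k then tower a d m (k - fst e) (x(m := e)) else {})"
proof -
  have "(\<forall>i\<ge>m. y i = (x(m := e)) i) \<longleftrightarrow> y m = e \<and> (\<forall>i\<ge>Suc m. y i = x i)" for y
    by (auto simp: Suc_le_eq le_less) (metis Suc_lessI)
  thus ?thesis by (auto simp: tower_def vert_Suc)
qed

lemma upd_Xp: "x \<in> Xp a d \<Longrightarrow> e \<in> edges a d \<Longrightarrow> x(m := e) \<in> Xp a d"
  by (simp add: Xp_iff)

lemma slice_sum:
  assumes "cylindric a d N f" "N \<le> m" "x \<in> Xp a d" "0 < a 0" "e \<in> edges a d"
  shows "(\<Sum>y\<in>{y \<in> tower a d (Suc m) k x. y m = e}. f y) = (if fst e \<le> k then Gs a d f m (k - fst e) else 0)"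
  using assms by (simp add: tower_Suc_slice tower_sum_eq_Gs upd_Xp)

lemma Gs_Suc:
  assumes "cylindric a d N f" "N \<le> m" "0 < a 0"
  shows "Gs a d f (Suc m) k = (\<Sum>e\<in>edges a d. if fst e \<le> k then Gs a d f m (k - fst e) else 0)"
proof -
  let ?T = "tower a d (Suc m) k (\<lambda>_. (0, 0))"
  have "Gs a d f (Suc m) k = (\<Sum>e\<in>edges a d. \<Sum>y\<in>{y \<in> ?T. y m = e}. f y)"
    unfolding Gs_def
    by (rule sum.group[symmetric]) (simp, simp, auto simp: tower_def Xp_iff)
  also have "\<dots> = (\<Sum>e\<in>edges a d. if fst e \<le> k then Gs a d f m (k - fst e) else 0)"
    using slice_sum[OF assms(1,2) const_path_Xp[of a d, OF assms(3)] assms(3)] assms(3) by (intro sum.cong) auto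
  finally show ?thesis .
qed

lemma vert_le: "x \<in> Xp a d \<Longrightarrow> vert x m \<le> d * m"
proof (induction m)
  case (Suc m)
  moreover have "fst (x m) \<le> d" using Suc.prems by (simp add: Xp_def)
  ultimately show ?case by (simp add: vert_Suc)
qed simp

lemma Gs_eq_0: "k > d * m \<Longrightarrow> Gs a d f m k = 0"
proof -
  assume "k > d * m"
  hence "tower a d m k (\<lambda>_. (0, 0)) = {}" using vert_le[of _ a d m] by (fastforce simp: tower_def)
  thus ?thesis by (simp add: Gs_def)
qed

text \<open>The paths below \<open>x\<close> in its level m + 1 tower are those below it in its
  level m tower and all those whose edge at index m is smaller; the latter fill complete level m
  towers.\<close>

lemma Fs_Suc:
  assumes f: "cylindric a d N f" "N \<le> m" "x \<in> Xp a d" "0 < a 0"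
  shows "Fs a d (Suc m) f x = Fs a d m f x +
    (\<Sum>e\<in>{e \<in> edges a d. edge_prec e (x m)}. if fst e \<le> vert x (Suc m) then Gs a d f m (vert x (Suc m) - fst e) else 0)"
proof -
  let ?T = "cls a d (Suc m) x" and ?E = "{e \<in> edges a d. edge_prec e (x m)}"
  have split: "below a d (Suc m) x = below a d m x \<union> (\<Union>e\<in>?E. {y \<in> ?T. y m = e})"
  proof (intro set_eqI iffI)
    fix y assume "y \<in> below a d (Suc m) x"
    hence y: "y \<in> ?T" "adic_less y x" by (auto simp: below_def)
    obtain i where i: "edge_prec (y i) (x i)" "\<forall>j>i. y j = x j" "vert y (Suc i) = vert x (Suc i)"
      using y adic_less_iff by metis
    have "i \<le> m"
    proof (rule ccontr)
      assume "\<not> i \<le> m"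
      hence "y i = x i" using y by (simp add: cls_def tower_def)
      thus False using i edge_prec_irrefl by simp
    qed
    show "y \<in> below a d m x \<union> (\<Union>e\<in>?E. {y \<in> ?T. y m = e})"
    proof (cases "i = m")
      case True
      thus ?thesis using i y by (auto simp: cls_def tower_def Xp_iff)
    next
      case False
      with \<open>i \<le> m\<close> have "\<forall>j\<ge>m. y j = x j" "vert y m = vert x m"
        using i vert_eq_of_tail_eq[of "Suc i" y x m] by auto
      thus ?thesis using y by (auto simp: below_def cls_def tower_def)
    qed
  next
    fix y assume "y \<in> below a d m x \<union> (\<Union>e\<in>?E. {y \<in> ?T. y m = e})"
    thus "y \<in> below a d (Suc m) x"
    proof
      assume "y \<in> below a d m x"
      thus ?thesis using cls_mono[of m "Suc m" a d x] by (auto simp: below_def)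
    next
      assume "y \<in> (\<Union>e\<in>?E. {y \<in> ?T. y m = e})"
      hence "y \<in> ?T" "edge_prec (y m) (x m)" by auto
      moreover from this have "adic_less y x"
        unfolding adic_less_iff by (intro exI[of _ m]) (auto simp: cls_def tower_def)
      ultimately show ?thesis by (simp add: below_def)
    qed
  qed
  have disj: "below a d m x \<inter> (\<Union>e\<in>?E. {y \<in> ?T. y m = e}) = {}"
    using edge_prec_irrefl by (auto simp: below_def cls_def tower_def)
  have "Fs a d (Suc m) f x = Fs a d m f x + (\<Sum>y\<in>(\<Union>e\<in>?E. {y \<in> ?T. y m = e}). f y)"
    unfolding Fs_def split by (rule sum.union_disjoint) (use disj in auto)
  also have "(\<Sum>y\<in>(\<Union>e\<in>?E. {y \<in> ?T. y m = e}). f y) = (\<Sum>e\<in>?E. \<Sum>y\<in>{y \<in> ?T. y m = e}. f y)"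
    by (rule sum.UNION_disjoint) auto
  also have "\<dots> = (\<Sum>e\<in>?E. if fst e \<le> vert x (Suc m) then Gs a d f m (vert x (Suc m) - fst e) else 0)"
    unfolding cls_def using slice_sum[OF f] by (intro sum.cong) auto
  finally show ?thesis .
qed

text \<open>Here z stands for t/q, so that a path to the vertex (m, k) has weight q ^ m * z ^ k.\<close>

definition Ppoly :: "(nat \<Rightarrow> nat) \<Rightarrow> nat \<Rightarrow> real \<Rightarrow> real \<Rightarrow> real poly" where
  "Ppoly a d q z = (\<Sum>j\<le>d. monom (real (a j) * q * z ^ j) j)"

definition Gpoly :: "(nat \<Rightarrow> nat) \<Rightarrow> nat \<Rightarrow> real \<Rightarrow> real \<Rightarrow> ((nat \<Rightarrow> nat \<times> nat) \<Rightarrow> real) \<Rightarrow> nat \<Rightarrow> real poly" where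
  "Gpoly a d q z f m = (\<Sum>k\<le>d * m. monom (q ^ m * z ^ k * Gs a d f m k) k)"

lemma coeff_Ppoly: "coeff (Ppoly a d q z) j = (if j \<le> d then real (a j) * q * z ^ j else 0)"
  by (simp add: Ppoly_def coeff_sum)

lemma coeff_Gpoly: "coeff (Gpoly a d q z f m) k = q ^ m * z ^ k * Gs a d f m k"
  by (simp add: Gpoly_def coeff_sum Gs_eq_0)

text \<open>The weights q ^ m * z ^ k are multiplicative along edges, so the Pascal-type recursion
  for tower sums becomes a product of polynomials.\<close>

lemma Gpoly_Suc:
  assumes "cylindric a d N f" "N \<le> m" "0 < a 0"
  shows "Gpoly a d q z f (Suc m) = Ppoly a d q z * Gpoly a d q z f m"
proof (rule poly_eqI)
  fix k
  have "Gs a d f (Suc m) k = (\<Sum>j\<le>d. \<Sum>c<a j. if j \<le> k then Gs a d f m (k - j) else 0)"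
    unfolding Gs_Suc[OF assms] edges_def by (subst sum.Sigma) (auto intro!: sum.cong)
  also have "\<dots> = (\<Sum>j\<le>d. if j \<le> k then real (a j) * Gs a d f m (k - j) else 0)"
    by (intro sum.cong) auto
  finally have "coeff (Gpoly a d q z f (Suc m)) k =
      (\<Sum>j\<le>d. q ^ Suc m * z ^ k * (if j \<le> k then real (a j) * Gs a d f m (k - j) else 0))"
    by (simp add: coeff_Gpoly sum_distrib_left)
  also have "\<dots> = (\<Sum>j\<le>k. coeff (Ppoly a d q z) j * coeff (Gpoly a d q z f m) (k - j))"
  proof -
    have eq: "z ^ k = z ^ j * z ^ (k - j)" if "j \<le> k" for j
      using that by (simp flip: power_add)
    have "(\<Sum>j\<le>d. q ^ Suc m * z ^ k * (if j \<le> k then real (a j) * Gs a d f m (k - j) else 0))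
       = (\<Sum>j\<in>{..d} \<inter> {..k}. q ^ Suc m * z ^ k * (real (a j) * Gs a d f m (k - j)))"
      by (intro sum.mono_neutral_cong_right) auto
    also have "\<dots> = (\<Sum>j\<le>k. coeff (Ppoly a d q z) j * coeff (Gpoly a d q z f m) (k - j))"
      by (intro sum.mono_neutral_cong_left) (auto simp: coeff_Ppoly coeff_Gpoly eq)
    finally show ?thesis .
  qed
  also have "\<dots> = coeff (Ppoly a d q z * Gpoly a d q z f m) k" by (simp add: coeff_mult)
  finally show "coeff (Gpoly a d q z f (Suc m)) k = coeff (Ppoly a d q z * Gpoly a d q z f m) k" .
qed

lemma Gpoly_eq:
  assumes "cylindric a d N f" "N \<le> m" "0 < a 0"
  shows "Gpoly a d q z f m = Ppoly a d q z ^ (m - N) * Gpoly a d q z f N"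
  using assms(2)
  by (induction m rule: dec_induct) (simp_all add: Gpoly_Suc[OF assms(1) _ assms(3)] Suc_diff_le mult.assoc)

lemma cylindric_const: "cylindric a d N (\<lambda>_. c)"
  by (simp add: cylindric_def)

text \<open>Weighted tower heights are the coefficients of powers of \<open>Ppoly\<close>: the law
  of a sum of m independent edge types, once the edge weights sum to 1.\<close>

lemma Gpoly_one:
  assumes "0 < a 0"
  shows "Gpoly a d q z (\<lambda>_. 1) m = Ppoly a d q z ^ m"
proof -
  have "tower a d 0 0 (\<lambda>_. (0, 0)) = {\<lambda>_. (0, 0)}"
    using const_path_Xp[of a d] assms by (auto simp: tower_def)
  hence "Gpoly a d q z (\<lambda>_. 1) 0 = 1" by (simp add: Gpoly_def Gs_def monom_0 one_pCons)
  thus ?thesis using Gpoly_eq[OF cylindric_const[of a d 0 1] _ assms, of m q z] by simp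
qed

lemma Gs_diff: "Gs a d (\<lambda>x. f x - c * h x) m k = Gs a d f m k - c * Gs a d h m k"
  by (simp add: Gs_def sum_subtractf sum_distrib_left)

section \<open>A local limit theorem for differences of lattice distributions\<close>

text \<open>Real polynomials at complex points; at \<open>cis t\<close> the generating polynomial of
  a lattice law becomes its characteristic function.\<close>

definition cev :: "real poly \<Rightarrow> complex \<Rightarrow> complex" where
  "cev p w = poly (map_poly of_real p) w"

lemma cev_0 [simp]: "cev 0 w = 0"
  by (simp add: cev_def)

lemma cev_pCons [simp]: "cev (pCons c p) w = of_real c + w * cev p w"
  by (simp add: cev_def map_poly_pCons)

lemma cev_add: "cev (p + q) w = cev p w + cev q w"
proof -
  have "map_poly complex_of_real (p + q) = map_poly of_real p + map_poly of_real q"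
    by (rule poly_eqI) (simp add: coeff_map_poly)
  thus ?thesis by (simp add: cev_def)
qed

lemma cev_smult: "cev (smult c p) w = of_real c * cev p w"
  by (induction p) (simp_all add: algebra_simps)

lemma cev_mult: "cev (p * q) w = cev p w * cev q w"
  by (induction p) (simp_all add: cev_add cev_smult algebra_simps)

lemma cev_1 [simp]: "cev 1 w = 1"
  by (simp add: one_pCons)

lemma cev_power: "cev (p ^ n) w = cev p w ^ n"
  by (induction n) (simp_all add: cev_mult)

lemma cev_altdef: "cev p w = (\<Sum>j\<le>degree p. of_real (coeff p j) * w ^ j)"
  by (simp add: cev_def poly_altdef coeff_map_poly degree_map_poly)

lemma cev_of_real: "cev p (of_real x) = of_real (poly p x)"
  by (induction p) simp_all

lemma isCont_cev: "isCont (cev p) w"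
  unfolding cev_def by simp

lemma cev_measurable [measurable]: "cev p \<in> borel_measurable borel"
  unfolding cev_altdef by measurable

lemma norm_cev_le:
  assumes "norm w \<le> 1"
  shows "norm (cev p w) \<le> (\<Sum>j\<le>degree p. \<bar>coeff p j\<bar>)"
  unfolding cev_altdef
proof (rule order.trans[OF norm_sum], rule sum_mono)
  fix j
  have "norm (of_real (coeff p j) * w ^ j) = \<bar>coeff p j\<bar> * norm w ^ j" by (simp add: norm_mult norm_power)
  also have "\<dots> \<le> \<bar>coeff p j\<bar> * 1" using assms by (intro mult_left_mono power_le_one) auto
  finally show "norm (of_real (coeff p j) * w ^ j) \<le> \<bar>coeff p j\<bar>" by simp
qed

lemma cis_has_vector_derivative:
  "((\<lambda>t. cis (c * t)) has_vector_derivative \<i> * of_real c * cis (c * x)) (at x within S)"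
proof -
  have "((\<lambda>w. exp (\<i> * (of_real c * w))) has_field_derivative \<i> * of_real c * exp (\<i> * (of_real c * of_real x))) (at (of_real x))"
    by (auto intro!: derivative_eq_intros)
  from has_vector_derivative_real_field[OF this, of S] show ?thesis
    by (simp add: cis_conv_exp)
qed

lemma integral_cis_int:
  fixes m :: int
  shows "(LINT t|lborel. indicator {-pi..pi} t *\<^sub>R cis (of_int m * t)) = (if m = 0 then 2 * of_real pi else 0)"
proof (cases "m = 0")
  case False
  define F where "F = (\<lambda>t. (1 / (\<i> * of_int m)) * cis (of_int m * t))"
  have "(LINT t|lborel. indicator {-pi..pi} t *\<^sub>R cis (of_int m * t)) = F pi - F (-pi)"
  proof (rule integral_FTC_atLeastAtMost)
    fix x
    show "(F has_vector_derivative cis (of_int m * x)) (at x within {-pi..pi})"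
      unfolding F_def
      using has_vector_derivative_mult_right[OF cis_has_vector_derivative[of "of_int m" x "{-pi..pi}"], of "1 / (\<i> * of_int m)"] False
      by simp
  qed (auto intro!: continuous_intros simp: cis_conv_exp)
  moreover have "F pi = F (-pi)"
  proof -
    have "cis (of_int m * pi) = cis (- (of_int m * pi))"
      by (simp add: complex_eq_iff mult.commute[of _ pi])
    thus ?thesis by (simp add: F_def)
  qed
  ultimately show ?thesis using False by simp
qed (simp add: scaleR_conv_of_real)

lemma integrable_indicator_cont:
  fixes f :: "real \<Rightarrow> complex"
  assumes "continuous_on UNIV f"
  shows "integrable lborel (\<lambda>t. indicator {u..v} t *\<^sub>R f t)"
  using borel_integrable_atLeastAtMost'[of u v f] continuous_on_subset[OF assms]
  unfolding set_integrable_def by auto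

lemma coeff_fourier:
  "complex_of_real (coeff B k) = (1 / (2 * of_real pi)) *
     (LINT t|lborel. indicator {-pi..pi} t *\<^sub>R (cev B (cis t) * cis (- real k * t)))"
proof -
  have eq: "indicator {-pi..pi} t *\<^sub>R (cev B (cis t) * cis (- real k * t)) =
     (\<Sum>j\<le>degree B. of_real (coeff B j) * (indicator {-pi..pi} t *\<^sub>R cis (of_int (int j - int k) * t)))" for t
  proof -
    have "cis t ^ j * cis (- real k * t) = cis (of_int (int j - int k) * t)" for j
      by (subst Complex.DeMoivre, subst cis_mult) (simp add: left_diff_distrib)
    thus ?thesis
      by (simp add: cev_altdef sum_distrib_right sum_distrib_left mult.assoc scaleR_conv_of_real mult.left_commute)
  qed
  have int: "integrable lborel (\<lambda>t. indicator {-pi..pi} t *\<^sub>R cis (c * t))" for c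
    by (intro integrable_indicator_cont) (auto intro!: continuous_intros simp: cis_conv_exp)
  have "(LINT t|lborel. indicator {-pi..pi} t *\<^sub>R (cev B (cis t) * cis (- real k * t)))
     = (\<Sum>j\<le>degree B. of_real (coeff B j) * (LINT t|lborel. indicator {-pi..pi} t *\<^sub>R cis (of_int (int j - int k) * t)))"
    unfolding eq by (subst Bochner_Integration.integral_sum) (intro integrable_mult_right int sum.cong refl integral_mult_right_zero)+
  also have "\<dots> = (\<Sum>j\<le>degree B. if j = k then 2 * of_real pi * of_real (coeff B j) else 0)"
    unfolding integral_cis_int by (intro sum.cong) auto
  also have "\<dots> = 2 * of_real pi * of_real (coeff B k)"
    by (auto simp: coeff_eq_0)
  finally show ?thesis by simp
qed

section \<open>Gaussian kernels and the recursion for their Fourier integrals\<close>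

lemma integrable_power_gauss:
  assumes "v > 0"
  shows "integrable lborel (\<lambda>t::real. \<bar>t\<bar> ^ r * exp (- v * t\<^sup>2))"
proof -
  define c where "c = sqrt (2 * v)"
  have c: "c > 0" using assms by (simp add: c_def)
  have "integrable lborel (\<lambda>t. std_normal_density (0 + c * t) * \<bar>0 + c * t\<bar> ^ r)"
    using c by (intro lborel_integrable_real_affine integrable_std_normal_moment_abs) simp
  hence "integrable lborel (\<lambda>t. (sqrt (2 * pi) / c ^ r) * (std_normal_density (0 + c * t) * \<bar>0 + c * t\<bar> ^ r))"
    by (rule integrable_mult_right)
  also have "(\<lambda>t. (sqrt (2 * pi) / c ^ r) * (std_normal_density (0 + c * t) * \<bar>0 + c * t\<bar> ^ r)) =
     (\<lambda>t::real. \<bar>t\<bar> ^ r * exp (- v * t\<^sup>2))"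
    using c assms by (auto simp: fun_eq_iff std_normal_density_def abs_mult power_mult_distrib c_def)
  finally show ?thesis .
qed

text \<open>The limit of the rescaled Fourier integrand: the Gaussian comes from the characteristic
  functions, and every factor 1 - x contributes - i t, the limit of sqrt n * (1 - cis (t / sqrt
  n)).\<close>

definition gker :: "real \<Rightarrow> nat \<Rightarrow> real \<Rightarrow> real \<Rightarrow> complex" where
  "gker v r s t = (- \<i> * of_real t) ^ r * of_real (exp (- v * t\<^sup>2 / 2)) * cis (- s * t)"

text \<open>The r-th derivative of the density of the centred normal law with variance v.\<close>

definition gprof :: "real \<Rightarrow> nat \<Rightarrow> real \<Rightarrow> complex" where
  "gprof v r s = (1 / (2 * of_real pi)) * (LINT t|lborel. gker v r s t)"

lemma norm_gker: "norm (gker v r s t) = \<bar>t\<bar> ^ r * exp (- v * t\<^sup>2 / 2)"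
  by (simp add: gker_def norm_mult norm_power)

lemma gker_cont: "continuous_on S (gker v r s)"
  unfolding gker_def cis_conv_exp by (intro continuous_intros) auto

lemma integrable_gker:
  assumes "v > 0" shows "integrable lborel (gker v r s)"
proof (rule Bochner_Integration.integrable_bound)
  show "integrable lborel (\<lambda>t::real. \<bar>t\<bar> ^ r * exp (- (v / 2) * t\<^sup>2))"
    using assms by (intro integrable_power_gauss) simp
  show "gker v r s \<in> borel_measurable lborel"
    using borel_measurable_continuous_onI[OF gker_cont[of UNIV v r s]] by simp
qed (auto simp: norm_gker abs_mult)

text \<open>Integrates the t-derivative of \<open>gker\<close> over the line, where the boundary
  terms vanish. For r = 0 the truncated r - 1 is harmless because of the factor r.\<close>

lemma gprof_rec:
  assumes v: "v > 0"
  shows "of_real v * gprof v (Suc r) s = - of_real s * gprof v r s - of_nat r * gprof v (r - 1) s"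
proof -
  let ?D = "\<lambda>t. - \<i> * (of_real v * gker v (Suc r) s t + of_real s * gker v r s t + of_nat r * gker v (r - 1) s t)"
  have der: "(gker v r s has_vector_derivative ?D x) (at x within S)" for x S
  proof -
    have "((\<lambda>w. (- \<i> * w) ^ r * exp (- of_real v * w\<^sup>2 / 2) * exp (\<i> * (- of_real s * w))) has_field_derivative
        (of_nat r * (- \<i>) * (- \<i> * of_real x) ^ (r - 1)) * exp (- of_real v * (of_real x)\<^sup>2 / 2) * exp (\<i> * (- of_real s * of_real x))
        + (- \<i> * of_real x) ^ r * (- of_real v * of_real x) * exp (- of_real v * (of_real x)\<^sup>2 / 2) * exp (\<i> * (- of_real s * of_real x))
        + (- \<i> * of_real x) ^ r * exp (- of_real v * (of_real x)\<^sup>2 / 2) * (\<i> * - of_real s) * exp (\<i> * (- of_real s * of_real x)))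
        (at (of_real x))"
      by (rule derivative_eq_intros refl | simp add: algebra_simps)+
    from has_vector_derivative_real_field[OF this, of S]
    have "(gker v r s has_vector_derivative
        (of_nat r * (- \<i>) * (- \<i> * of_real x) ^ (r - 1)) * exp (- of_real v * (of_real x)\<^sup>2 / 2) * exp (\<i> * (- of_real s * of_real x))
        + (- \<i> * of_real x) ^ r * (- of_real v * of_real x) * exp (- of_real v * (of_real x)\<^sup>2 / 2) * exp (\<i> * (- of_real s * of_real x))
        + (- \<i> * of_real x) ^ r * exp (- of_real v * (of_real x)\<^sup>2 / 2) * (\<i> * - of_real s) * exp (\<i> * (- of_real s * of_real x)))
        (at x within S)"
      unfolding gker_def cis_conv_exp exp_of_real[symmetric] by simp
    thus ?thesis
      unfolding gker_def cis_conv_exp exp_of_real[symmetric]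
      by (rule has_vector_derivative_eq_rhs) (simp add: algebra_simps)
  qed
  have intD: "integrable lborel ?D"
    using integrable_gker[OF v] by simp
  have contD: "continuous_on S ?D" for S
    by (intro continuous_intros gker_cont)
  have 1: "(LINT t|lborel. indicator {- real n..real n} t *\<^sub>R ?D t) = gker v r s (real n) - gker v r s (- real n)" for n :: nat
    by (rule integral_FTC_atLeastAtMost) (use der contD in auto)
  have lim0: "(\<lambda>n. \<bar>real n\<bar> ^ r * exp (- v * (real n)\<^sup>2 / 2)) \<longlonglongrightarrow> 0"
    using v by real_asymp
  have 2: "(\<lambda>n. gker v r s (real n) - gker v r s (- real n)) \<longlonglongrightarrow> 0"
    using tendsto_diff[OF tendsto_norm_zero_cancel[of "\<lambda>n. gker v r s (real n)" sequentially]
       tendsto_norm_zero_cancel[of "\<lambda>n. gker v r s (- real n)" sequentially]] lim0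
    by (simp add: norm_gker)
  \<comment> \<open>The fundamental theorem gives the integral over [-n, n] only; dominated
    convergence passes to the whole line.\<close>
  have 3: "(\<lambda>n. LINT t|lborel. indicator {- real n..real n} t *\<^sub>R ?D t) \<longlonglongrightarrow> (LINT t|lborel. ?D t)"
  proof (rule integral_dominated_convergence[where w = "\<lambda>t. norm (?D t)"])
    show "integrable lborel (\<lambda>t. norm (?D t))" using intD by (rule integrable_norm)
    show "?D \<in> borel_measurable lborel" using intD by (rule borel_measurable_integrable)
    show "(\<lambda>t. indicator {- real n..real n} t *\<^sub>R ?D t) \<in> borel_measurable lborel" for n
      using intD by (intro borel_measurable_scaleR borel_measurable_indicator) (auto intro: borel_measurable_integrable)
    show "AE t in lborel. (\<lambda>n. indicator {- real n..real n} t *\<^sub>R ?D t) \<longlonglongrightarrow> ?D t"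
    proof (rule AE_I2, rule tendsto_eventually)
      fix t :: real
      obtain n0 :: nat where "\<bar>t\<bar> \<le> real n0" using real_arch_simple by blast
      thus "\<forall>\<^sub>F n in sequentially. indicator {- real n..real n} t *\<^sub>R ?D t = ?D t"
        by (intro eventually_sequentiallyI[of n0]) (auto simp: indicator_def)
    qed
    show "AE t in lborel. norm (indicator {- real n..real n} t *\<^sub>R ?D t) \<le> norm (?D t)" for n
      by (auto simp: indicator_def)
  qed
  have "(LINT t|lborel. ?D t) = 0"
    using LIMSEQ_unique[OF 3] 2 unfolding 1 by blast
  also have "(LINT t|lborel. ?D t) = - \<i> * (of_real v * (LINT t|lborel. gker v (Suc r) s t)
      + of_real s * (LINT t|lborel. gker v r s t) + of_nat r * (LINT t|lborel. gker v (r - 1) s t))"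
    using integrable_gker[OF v] by simp
  finally have "of_real v * (LINT t|lborel. gker v (Suc r) s t)
      + of_real s * (LINT t|lborel. gker v r s t) + of_nat r * (LINT t|lborel. gker v (r - 1) s t) = 0" by simp
  hence "(1 / (2 * of_real pi)) * (of_real v * (LINT t|lborel. gker v (Suc r) s t)
      + of_real s * (LINT t|lborel. gker v r s t) + of_nat r * (LINT t|lborel. gker v (r - 1) s t)) = 0" by simp
  thus ?thesis unfolding gprof_def by (simp add: field_simps add_eq_0_iff)
qed

text \<open>Fourier self-duality of the Gaussian: the characteristic function of the standard normal
  law at - s / sqrt v becomes this integral, up to a constant, after rescaling by sqrt v.\<close>

lemma gprof_0:
  assumes v: "v > 0"
  shows "gprof v 0 s = of_real (exp (- s\<^sup>2 / (2 * v)) / sqrt (2 * pi * v))"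
proof -
  let ?c = "sqrt v"
  have c: "?c > 0" using v by simp
  have "of_real (exp (- (- s / ?c)\<^sup>2 / 2)) = char std_normal_distribution (- s / ?c)"
    by (simp add: char_std_normal_distribution)
  also have "\<dots> = (LINT x|lborel. std_normal_density x *\<^sub>R cis ((- s / ?c) * x))"
    unfolding char_def cis_conv_exp[symmetric]
    by (subst integral_density) (auto simp: cis_conv_exp intro!: borel_measurable_continuous_onI continuous_intros)
  also have "\<dots> = ?c *\<^sub>R (LINT x|lborel. std_normal_density (?c * x) *\<^sub>R cis ((- s / ?c) * (?c * x)))"
    using c by (subst lborel_integral_real_affine[where c = ?c and t = 0]) auto
  also have "(\<lambda>x. std_normal_density (?c * x) *\<^sub>R cis ((- s / ?c) * (?c * x))) = (\<lambda>x. (1 / sqrt (2 * pi)) *\<^sub>R gker v 0 s x)"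
    using v by (auto simp: fun_eq_iff std_normal_density_def gker_def scaleR_conv_of_real power_mult_distrib)
  also have "?c *\<^sub>R (LINT x|lborel. (1 / sqrt (2 * pi)) *\<^sub>R gker v 0 s x) = of_real (?c / sqrt (2 * pi)) * (2 * of_real pi * gprof v 0 s)"
    by (simp add: gprof_def scaleR_conv_of_real)
  finally have "of_real (exp (- (- s / ?c)\<^sup>2 / 2)) = of_real (?c / sqrt (2 * pi) * (2 * pi)) * gprof v 0 s" by simp
  moreover have "?c / sqrt (2 * pi) * (2 * pi) = sqrt (2 * pi * v)"
  proof -
    have "?c / sqrt (2 * pi) * (2 * pi) = ?c * ((2 * pi) / sqrt (2 * pi))" by simp
    also have "(2 * pi) / sqrt (2 * pi) = sqrt (2 * pi)" by (rule real_div_sqrt) simp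
    finally show ?thesis by (simp add: real_sqrt_mult)
  qed
  ultimately have "of_real (exp (- (- s / ?c)\<^sup>2 / 2)) = of_real (sqrt (2 * pi * v)) * gprof v 0 s" by metis
  hence "gprof v 0 s = of_real (exp (- (- s / ?c)\<^sup>2 / 2)) / of_real (sqrt (2 * pi * v))"
    using v by (simp add: field_simps)
  thus ?thesis using v by (simp add: power_divide)
qed


text \<open>Mass on the neighbouring points 0 and 1 makes the law aperiodic, so that the
  characteristic function has modulus 1 only at multiples of 2 pi, and makes the variance
  positive.\<close>

locale lattice_law =
  fixes P :: "real poly"
  assumes coeff_nonneg: "coeff P j \<ge> 0"
    and coeff0: "coeff P 0 > 0" and coeff1: "coeff P 1 > 0" and poly_1: "poly P 1 = 1"
begin

definition mean :: real where "mean = (\<Sum>j\<le>degree P. coeff P j * real j)"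

definition var :: real where "var = (\<Sum>j\<le>degree P. coeff P j * (real j - mean)\<^sup>2)"

lemma sum_coeff: "(\<Sum>j\<le>degree P. coeff P j) = 1"
  using poly_1 by (simp add: poly_altdef)

lemma degree_pos: "degree P \<ge> 1"
  using coeff1 by (metis less_irrefl le_degree)

lemma mean_pos: "mean > 0"
proof -
  have "coeff P 1 * real 1 \<le> mean"
    unfolding mean_def using degree_pos coeff_nonneg by (intro member_le_sum) auto
  thus ?thesis using coeff1 by simp
qed

lemma var_pos: "var > 0"
proof -
  have "0 < coeff P 0 * (real 0 - mean)\<^sup>2 \<or> 0 < coeff P 1 * (real 1 - mean)\<^sup>2"
    using coeff0 coeff1 by (cases "mean = 0") auto
  moreover have "coeff P j * (real j - mean)\<^sup>2 \<le> var" if "j \<le> degree P" for j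
    unfolding var_def using that coeff_nonneg by (intro member_le_sum) auto
  ultimately show ?thesis using degree_pos by (metis le0 less_le_trans)
qed

text \<open>The rate in \<open>norm_cev_cis_le\<close>: the atoms u at 0 and v at 1 alone cost u * v
  * (1 - cos t) / (u + v) of modulus, and 1 - cos t is at least t ^ 2 / 8 on [-pi, pi].\<close>

definition kap :: real where "kap = coeff P 0 * coeff P 1 / (coeff P 0 + coeff P 1) / 8"

lemma kap_pos: "kap > 0"
  using coeff0 coeff1 by (simp add: kap_def)

lemma one_minus_cos_ge:
  assumes "\<bar>t\<bar> \<le> pi"
  shows "1 - cos t \<ge> t\<^sup>2 / 8"
proof -
  define y where "y = \<bar>t\<bar> / 2"
  \<comment> \<open>Half angle: 1 - cos t is twice the square of sin y, and sin y \<ge> y - y ^ 3 /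
    6 \<ge> y / 2 as long as y ^ 2 \<le> 3, which pi / 2 < 1.6 ensures.\<close>
  have y: "0 \<le> y" "y \<le> 1.6" using assms pi_less_4 pi_approx by (auto simp: y_def)
  have "\<bar>sin y - (\<Sum>m<3. sin_coeff m * y ^ m)\<bar> \<le> inverse (fact 3) * \<bar>y\<bar> ^ 3"
    by (rule Maclaurin_sin_bound)
  hence "\<bar>sin y - y\<bar> \<le> y ^ 3 / 6"
    using y by (simp add: eval_nat_numeral sin_coeff_def fact_numeral)
  moreover have "y ^ 3 / 6 \<le> y / 2"
  proof -
    have "y * y \<le> 1.6 * 1.6" using y by (intro mult_mono) auto
    hence "y * (y * y) \<le> y * 3" using y by (intro mult_left_mono) auto
    thus ?thesis by (simp add: eval_nat_numeral)
  qed
  ultimately have "sin y \<ge> y / 2" by linarith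
  hence "(y / 2)\<^sup>2 \<le> (sin y)\<^sup>2" using y by (intro power_mono) auto
  moreover have "cos t = 1 - 2 * (sin y)\<^sup>2"
    using cos_double_sin[of y] by (simp add: y_def)
  ultimately show ?thesis by (simp add: y_def power_divide)
qed

lemma norm_cev_cis_le:
  assumes t: "\<bar>t\<bar> \<le> pi"
  shows "norm (cev P (cis t)) \<le> exp (- kap * t\<^sup>2)"
proof -
  define u where "u = coeff P 0"
  define v where "v = coeff P 1"
  have uv: "u > 0" "v > 0" using coeff0 coeff1 by (auto simp: u_def v_def)
  define y where "y = u * v * (1 - cos t) / (u + v)"
  have set: "{..degree P} = insert 0 (insert 1 {2..degree P})" using degree_pos by auto
  have rest: "(\<Sum>j=2..degree P. coeff P j) = 1 - (u + v)"
    using sum_coeff unfolding set by (simp add: u_def v_def)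
  have "cev P (cis t) = (of_real u + of_real v * cis t) + (\<Sum>j=2..degree P. of_real (coeff P j) * cis t ^ j)"
    unfolding cev_altdef set by (simp add: u_def v_def)
  also have "norm \<dots> \<le> norm (of_real u + of_real v * cis t) + (\<Sum>j=2..degree P. coeff P j)"
    using coeff_nonneg
    by (intro norm_triangle_le add_mono order.refl order.trans[OF norm_sum] sum_mono) (auto simp: norm_mult norm_power)
  \<comment> \<open>Only these two terms are made to cancel; the others enter by the triangle
    inequality. The square of the left side is (u + v) ^ 2 - 2 * (u + v) * y, at most the square of
    u + v - y.\<close>
  also have "norm (of_real u + of_real v * cis t) \<le> u + v - y"
  proof (rule power2_le_imp_le)
    have "(norm (of_real u + of_real v * cis t))\<^sup>2 = (u + v * cos t)\<^sup>2 + (v * sin t)\<^sup>2"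
      by (simp add: cmod_power2)
    also have "\<dots> = u\<^sup>2 + 2 * u * v * cos t + v\<^sup>2 * ((cos t)\<^sup>2 + (sin t)\<^sup>2)"
      by algebra
    also have "(cos t)\<^sup>2 + (sin t)\<^sup>2 = 1" by simp
    also have "u\<^sup>2 + 2 * u * v * cos t + v\<^sup>2 * 1 = (u + v)\<^sup>2 - 2 * (u * v * (1 - cos t))"
      by (simp add: power2_eq_square algebra_simps)
    also have "u * v * (1 - cos t) = (u + v) * y" using uv by (simp add: y_def)
    also have "(u + v)\<^sup>2 - 2 * ((u + v) * y) \<le> (u + v - y)\<^sup>2"
      by (simp add: power2_eq_square algebra_simps)
    finally show "(norm (of_real u + of_real v * cis t))\<^sup>2 \<le> (u + v - y)\<^sup>2" .
    have "u * v * (1 - cos t) \<le> u * v * 2" using uv using cos_ge_minus_one[of t] by (intro mult_left_mono) auto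
    also have "\<dots> \<le> (u + v) * (u + v)" using uv by (simp add: algebra_simps)
    finally show "0 \<le> u + v - y" using uv by (simp add: y_def field_simps)
  qed
  finally have "norm (cev P (cis t)) \<le> 1 - y" using rest by simp
  also have "\<dots> \<le> exp (- y)" using exp_ge_add_one_self[of "- y"] by simp
  also have "\<dots> \<le> exp (- kap * t\<^sup>2)"
  proof -
    have "u * v * (t\<^sup>2 / 8) \<le> u * v * (1 - cos t)" using uv one_minus_cos_ge[OF t] by (intro mult_left_mono) auto
    hence "u * v * (t\<^sup>2 / 8) / (u + v) \<le> y" unfolding y_def
      using uv by (intro divide_right_mono) auto
    hence "kap * t\<^sup>2 \<le> y" unfolding kap_def u_def[symmetric] v_def[symmetric] by (simp add: mult.commute)
    thus ?thesis by simp
  qed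
  finally show ?thesis .
qed

lemma sum_centered: "(\<Sum>j\<le>degree P. coeff P j * (real j - mean)) = 0"
proof -
  have "(\<Sum>j\<le>degree P. coeff P j * (real j - mean)) = mean - (\<Sum>j\<le>degree P. coeff P j) * mean"
    unfolding mean_def[symmetric] sum_distrib_right
    by (simp add: right_diff_distrib sum_subtractf) (simp add: mean_def)
  thus ?thesis by (simp add: sum_coeff)
qed

text \<open>Taylor expansion of each exponential to second order; centring removes the linear term,
  and the remainder is a third absolute moment.\<close>

lemma centered_char_approx:
  "norm (cev P (cis t) * cis (- mean * t) - of_real (1 - var * t\<^sup>2 / 2))
     \<le> (\<Sum>j\<le>degree P. coeff P j * \<bar>real j - mean\<bar> ^ 3 / 6) * \<bar>t\<bar> ^ 3"
proof -
  let ?e = "\<lambda>x::real. 1 + \<i> * of_real x - of_real (x\<^sup>2 / 2)"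
  have "cis t ^ j * cis (- mean * t) = cis ((real j - mean) * t)" for j
    by (subst Complex.DeMoivre, subst cis_mult) (simp add: left_diff_distrib)
  hence 1: "cev P (cis t) * cis (- mean * t) = (\<Sum>j\<le>degree P. of_real (coeff P j) * cis ((real j - mean) * t))"
    by (simp add: cev_altdef sum_distrib_right mult.assoc)
  have "(\<Sum>j\<le>degree P. of_real (coeff P j) * ?e ((real j - mean) * t)) =
     of_real (\<Sum>j\<le>degree P. coeff P j) + \<i> * of_real t * of_real (\<Sum>j\<le>degree P. coeff P j * (real j - mean))
      - of_real (t\<^sup>2 / 2) * of_real (\<Sum>j\<le>degree P. coeff P j * (real j - mean)\<^sup>2)"
    unfolding of_real_sum sum_distrib_left sum.distrib[symmetric] sum_subtractf[symmetric]
    by (intro sum.cong) (simp_all add: field_simps power2_eq_square)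
  also have "\<dots> = of_real (1 - var * t\<^sup>2 / 2)"
    unfolding sum_coeff sum_centered var_def[symmetric] by simp
  finally have 2: "of_real (1 - var * t\<^sup>2 / 2) = (\<Sum>j\<le>degree P. of_real (coeff P j) * ?e ((real j - mean) * t))" ..
  have e: "norm (cis x - ?e x) \<le> \<bar>x\<bar> ^ 3 / 6" for x
  proof -
    have "(\<Sum>k\<le>2. (\<i> * of_real x) ^ k / fact k) = ?e x"
      by (simp add: numeral_2_eq_2 power2_eq_square algebra_simps)
    with iexp_approx1[of x 2] show ?thesis by (simp add: cis_conv_exp eval_nat_numeral)
  qed
  have "norm (cev P (cis t) * cis (- mean * t) - of_real (1 - var * t\<^sup>2 / 2)) =
     norm (\<Sum>j\<le>degree P. of_real (coeff P j) * (cis ((real j - mean) * t) - ?e ((real j - mean) * t)))"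
    unfolding 1 2 by (simp only: sum_subtractf[symmetric] right_diff_distrib)
  also have "\<dots> \<le> (\<Sum>j\<le>degree P. coeff P j * (\<bar>(real j - mean) * t\<bar> ^ 3 / 6))"
  proof (rule order.trans[OF norm_sum], rule sum_mono)
    fix j
    have "norm (of_real (coeff P j) * (cis ((real j - mean) * t) - ?e ((real j - mean) * t)))
      = coeff P j * norm (cis ((real j - mean) * t) - ?e ((real j - mean) * t))"
      using coeff_nonneg by (simp add: norm_mult)
    also have "\<dots> \<le> coeff P j * (\<bar>(real j - mean) * t\<bar> ^ 3 / 6)"
      by (intro mult_left_mono e coeff_nonneg)
    finally show "norm (of_real (coeff P j) * (cis ((real j - mean) * t) - ?e ((real j - mean) * t)))
      \<le> coeff P j * (\<bar>(real j - mean) * t\<bar> ^ 3 / 6)" .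
  qed
  also have "\<dots> = (\<Sum>j\<le>degree P. coeff P j * \<bar>real j - mean\<bar> ^ 3 / 6) * \<bar>t\<bar> ^ 3"
    unfolding sum_distrib_right by (intro sum.cong) (auto simp: abs_mult power_mult_distrib)
  finally show ?thesis .
qed

text \<open>Compares with (1 - var * t ^ 2 / (2 * n)) ^ n through |A ^ n - B ^ n| \<le> n * |A - B|
  in the unit disc; the third-order error leaves n ^ (-1/2) after the factor n.\<close>

lemma centered_char_limit:
  "(\<lambda>n. (cev P (cis (t / sqrt (real n))) * cis (- mean * (t / sqrt (real n)))) ^ n)
     \<longlonglongrightarrow> of_real (exp (- var * t\<^sup>2 / 2))"
proof -
  define M where "M = (\<Sum>j\<le>degree P. coeff P j * \<bar>real j - mean\<bar> ^ 3 / 6)"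
  define A where "A = (\<lambda>n::nat. cev P (cis (t / sqrt (real n))) * cis (- mean * (t / sqrt (real n))))"
  define B where "B = (\<lambda>n::nat. complex_of_real (1 - var * (t / sqrt (real n))\<^sup>2 / 2))"
  have A1: "norm (A n) \<le> 1" for n
  proof -
    have "norm (cev P (cis (t / sqrt (real n)))) \<le> (\<Sum>j\<le>degree P. \<bar>coeff P j\<bar>)"
      by (rule norm_cev_le) simp
    also have "\<dots> = 1" using sum_coeff coeff_nonneg by simp
    finally show ?thesis by (simp add: A_def norm_mult)
  qed
  have B1: "\<forall>\<^sub>F n in sequentially. norm (B n) \<le> 1"
  proof -
    have "(\<lambda>n. var * (t\<^sup>2 / real n) / 2) \<longlonglongrightarrow> 0" by real_asymp
    hence "(\<lambda>n. var * (t / sqrt (real n))\<^sup>2 / 2) \<longlonglongrightarrow> 0" by (simp add: power_divide)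
    hence "\<forall>\<^sub>F n in sequentially. var * (t / sqrt (real n))\<^sup>2 / 2 < 1"
      by (rule order_tendstoD) simp
    thus ?thesis
    proof eventually_elim
      case (elim n)
      moreover have "0 \<le> var * (t / sqrt (real n))\<^sup>2 / 2" using var_pos by simp
      ultimately show ?case unfolding B_def norm_of_real by linarith
    qed
  qed
  have diff: "(\<lambda>n. A n ^ n - B n ^ n) \<longlonglongrightarrow> 0"
  proof (rule Lim_null_comparison)
    show "(\<lambda>n. real n * (M * \<bar>t / sqrt (real n)\<bar> ^ 3)) \<longlonglongrightarrow> 0"
    proof -
      have "(\<lambda>n. M * \<bar>t\<bar> ^ 3 / sqrt (real n)) \<longlonglongrightarrow> 0" by real_asymp
      moreover have "real n * (M * \<bar>t / sqrt (real n)\<bar> ^ 3) = M * \<bar>t\<bar> ^ 3 / sqrt (real n)" for n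
      proof (cases "n = 0")
        case False
        have "sqrt (real n) ^ 3 = real n * sqrt (real n)" by (simp add: eval_nat_numeral)
        thus ?thesis using False by (simp add: power_divide abs_divide)
      qed simp
      ultimately show ?thesis by simp
    qed
    show "\<forall>\<^sub>F n in sequentially. norm (A n ^ n - B n ^ n) \<le> real n * (M * \<bar>t / sqrt (real n)\<bar> ^ 3)"
      using B1
    proof eventually_elim
      case (elim n)
      have "norm (A n ^ n - B n ^ n) \<le> real n * norm (A n - B n)"
        using A1 elim by (rule norm_power_diff)
      also have "\<dots> \<le> real n * (M * \<bar>t / sqrt (real n)\<bar> ^ 3)"
        unfolding A_def B_def M_def by (intro mult_left_mono centered_char_approx) auto
      finally show ?case .
    qed
  qed
  have "(\<lambda>n. complex_of_real ((1 + (- var * t\<^sup>2 / 2) / real n) ^ n)) \<longlonglongrightarrow> of_real (exp (- var * t\<^sup>2 / 2))"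
    by (intro tendsto_of_real tendsto_exp_limit_sequentially)
  moreover have "complex_of_real ((1 + (- var * t\<^sup>2 / 2) / real n) ^ n) = B n ^ n" for n
    by (simp add: B_def power_divide mult.commute)
  ultimately have "(\<lambda>n. B n ^ n) \<longlonglongrightarrow> of_real (exp (- var * t\<^sup>2 / 2))" by simp
  from tendsto_add[OF diff this] show ?thesis by (simp add: A_def)
qed

text \<open>\<open>coeff_fourier\<close> rescaled by sqrt n, with the phase split into the centring
  of each of the n factors and the normalised position of k.\<close>

lemma scaled_fourier:
  assumes n: "n > 0"
  shows "of_real (sqrt (real n) * coeff (P ^ n * A) k) = (1 / (2 * of_real pi)) *
    (LINT t|lborel. indicator {- pi * sqrt (real n)..pi * sqrt (real n)} t *\<^sub>R
      ((cev P (cis (t / sqrt (real n))) * cis (- mean * (t / sqrt (real n)))) ^ n * cev A (cis (t / sqrt (real n)))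
        * cis (- ((real k - real n * mean) / sqrt (real n)) * t)))"
proof -
  define c where "c = 1 / sqrt (real n)"
  have c: "c > 0" using n by (simp add: c_def)
  let ?f = "\<lambda>t. indicator {-pi..pi} t *\<^sub>R (cev (P ^ n * A) (cis t) * cis (- real k * t))"
  have "(LINT t|lborel. ?f t) = c *\<^sub>R (LINT t|lborel. ?f (c * t))"
    using c by (subst lborel_integral_real_affine[where c = c and t = 0]) auto
  also have "(\<lambda>t. ?f (c * t)) = (\<lambda>t. indicator {- pi * sqrt (real n)..pi * sqrt (real n)} t *\<^sub>R
      ((cev P (cis (t / sqrt (real n))) * cis (- mean * (t / sqrt (real n)))) ^ n * cev A (cis (t / sqrt (real n)))
        * cis (- ((real k - real n * mean) / sqrt (real n)) * t)))"
  proof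
    fix t
    have 1: "indicator {-pi..pi} (c * t) = (indicator {- pi * sqrt (real n)..pi * sqrt (real n)} t :: real)"
      using n by (auto simp: c_def indicator_def field_simps)
    have "cis (- mean * (t / sqrt (real n))) ^ n * cis (- ((real k - real n * mean) / sqrt (real n)) * t) = cis (- real k * (c * t))"
      by (subst Complex.DeMoivre, subst cis_mult) (rule arg_cong[where f = cis], use n in \<open>simp add: c_def field_simps\<close>)
    hence "cev (P ^ n * A) (cis (c * t)) * cis (- real k * (c * t)) =
       (cev P (cis (t / sqrt (real n))) * cis (- mean * (t / sqrt (real n)))) ^ n * cev A (cis (t / sqrt (real n)))
        * cis (- ((real k - real n * mean) / sqrt (real n)) * t)"
      by (simp add: cev_mult cev_power power_mult_distrib c_def mult_ac)
    with 1 show "?f (c * t) = indicator {- pi * sqrt (real n)..pi * sqrt (real n)} t *\<^sub>R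
      ((cev P (cis (t / sqrt (real n))) * cis (- mean * (t / sqrt (real n)))) ^ n * cev A (cis (t / sqrt (real n)))
        * cis (- ((real k - real n * mean) / sqrt (real n)) * t))" by simp
  qed
  finally show ?thesis unfolding of_real_mult coeff_fourier
    using n by (simp add: c_def scaleR_conv_of_real)
qed

lemma norm_one_minus_cis: "norm (1 - cis t) \<le> \<bar>t\<bar>"
  using iexp_approx1[of t 0] by (simp add: cis_conv_exp norm_minus_commute)

text \<open>One factor sqrt n accompanies each factor 1 - x, so that the integrand has a nontrivial
  limit; the rescaling of t supplies the remaining sqrt n of \<open>scaled_coeff_eq\<close>.\<close>

definition lint :: "nat \<Rightarrow> nat \<Rightarrow> real poly \<Rightarrow> real \<Rightarrow> real \<Rightarrow> complex" where
  "lint n r E s t = indicator {- pi * sqrt (real n)..pi * sqrt (real n)} t *\<^sub>R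
      ((cev P (cis (t / sqrt (real n))) * cis (- mean * (t / sqrt (real n)))) ^ n *
       (of_real (sqrt (real n)) * (1 - cis (t / sqrt (real n)))) ^ r * cev E (cis (t / sqrt (real n))) * cis (- s * t))"

lemma lint_meas [measurable]: "lint n r E s \<in> borel_measurable lborel"
proof -
  have [measurable]: "cis \<in> borel_measurable borel"
    unfolding cis_conv_exp by (intro borel_measurable_continuous_onI continuous_intros)
  have "(\<lambda>t. (cev P (cis (t / sqrt (real n))) * cis (- mean * (t / sqrt (real n)))) ^ n *
       (of_real (sqrt (real n)) * (1 - cis (t / sqrt (real n)))) ^ r * cev E (cis (t / sqrt (real n))) * cis (- s * t))
     \<in> borel_measurable borel"
    by measurable
  thus ?thesis unfolding lint_def
    by (intro borel_measurable_scaleR borel_measurable_indicator) auto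
qed

text \<open>The n factors, each at t / sqrt n, together give back kap * t ^ 2. The majorant is free
  of n and s, which serves both the limit theorem and \<open>coeff_bound\<close>.\<close>

lemma norm_lint_le:
  "norm (lint n r E s t) \<le> (\<Sum>j\<le>degree E. \<bar>coeff E j\<bar>) * (\<bar>t\<bar> ^ r * exp (- kap * t\<^sup>2))"
proof (cases "\<bar>t\<bar> \<le> pi * sqrt (real n)")
  case True
  let ?u = "t / sqrt (real n)"
  have u: "\<bar>?u\<bar> \<le> pi" using True by (cases "n = 0") (auto simp: abs_divide field_simps)
  have "norm (cev P (cis ?u)) ^ n \<le> exp (- kap * ?u\<^sup>2) ^ n"
    using norm_cev_cis_le[OF u] by (intro power_mono) auto
  also have "\<dots> = exp (- kap * t\<^sup>2)"
    using True by (cases "n = 0") (auto simp: exp_of_nat_mult[symmetric] power_divide)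
  finally have 1: "norm (cev P (cis ?u)) ^ n \<le> exp (- kap * t\<^sup>2)" .
  have "sqrt (real n) * norm (1 - cis ?u) \<le> sqrt (real n) * \<bar>?u\<bar>"
    by (intro mult_left_mono norm_one_minus_cis) auto
  also have "\<dots> \<le> \<bar>t\<bar>" by (cases "n = 0") (auto simp: abs_divide)
  finally have 2: "(sqrt (real n) * norm (1 - cis ?u)) ^ r \<le> \<bar>t\<bar> ^ r" by (intro power_mono) auto
  have 3: "norm (cev E (cis ?u)) \<le> (\<Sum>j\<le>degree E. \<bar>coeff E j\<bar>)" by (rule norm_cev_le) simp
  have "norm (lint n r E s t) \<le> norm (cev P (cis ?u)) ^ n * (sqrt (real n) * norm (1 - cis ?u)) ^ r * norm (cev E (cis ?u))"
    using True by (simp add: lint_def norm_mult norm_power power_mult_distrib indicator_def)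
  also have "\<dots> \<le> exp (- kap * t\<^sup>2) * \<bar>t\<bar> ^ r * (\<Sum>j\<le>degree E. \<bar>coeff E j\<bar>)"
    by (intro mult_mono 1 2 3) auto
  finally show ?thesis by (simp add: mult_ac)
next
  case False
  hence "lint n r E s t = 0" by (auto simp: lint_def indicator_def)
  thus ?thesis by (simp add: sum_nonneg)
qed

lemma scaled_coeff_eq:
  assumes n: "n > 0"
  shows "of_real (sqrt (real n) ^ Suc r * coeff (P ^ n * ([:1, -1:] ^ r * E)) k) =
    (1 / (2 * of_real pi)) * (LINT t|lborel. lint n r E ((real k - real n * mean) / sqrt (real n)) t)"
proof -
  let ?s = "(real k - real n * mean) / sqrt (real n)"
  have lint: "lint n r E ?s t = of_real (sqrt (real n) ^ r) * (indicator {- pi * sqrt (real n)..pi * sqrt (real n)} t *\<^sub>R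
      ((cev P (cis (t / sqrt (real n))) * cis (- mean * (t / sqrt (real n)))) ^ n * cev ([:1, -1:] ^ r * E) (cis (t / sqrt (real n)))
        * cis (- ?s * t)))" for t
    by (simp add: lint_def cev_mult cev_power power_mult_distrib scaleR_conv_of_real mult_ac)
  show ?thesis unfolding lint integral_mult_right_zero mult.left_commute[of "1 / (2 * of_real pi)"]
      scaled_fourier[OF n, of "[:1, -1:] ^ r * E" k, symmetric] by simp
qed

text \<open>Dominated convergence in the Fourier integral. Each factor 1 - x costs one sqrt n and
  differentiates the density once. Sequences n i, k i are used because the levels will be random
  ones along a path.\<close>

theorem local_limit:
  assumes n: "filterlim n at_top sequentially"
    and s: "(\<lambda>i. (real (k i) - real (n i) * mean) / sqrt (real (n i))) \<longlonglongrightarrow> s"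
  shows "(\<lambda>i. complex_of_real (sqrt (real (n i)) ^ Suc r * coeff (P ^ n i * ([:1, -1:] ^ r * E)) (k i)))
     \<longlonglongrightarrow> of_real (poly E 1) * gprof var r s"
proof -
  let ?s = "\<lambda>i. (real (k i) - real (n i) * mean) / sqrt (real (n i))"
  have sq: "filterlim (\<lambda>i. sqrt (real (n i))) at_top sequentially"
    by (rule filterlim_compose[OF sqrt_at_top], rule filterlim_compose[OF filterlim_real_sequentially n])
  have ev0: "\<forall>\<^sub>F i in sequentially. n i > 0"
    using eventually_compose_filterlim[OF eventually_gt_at_top n] .
  have "(\<lambda>i. LINT t|lborel. lint (n i) r E (?s i) t) \<longlonglongrightarrow> (LINT t|lborel. of_real (poly E 1) * gker var r s t)"
  proof (rule integral_dominated_convergence[where w = "\<lambda>t. (\<Sum>j\<le>degree E. \<bar>coeff E j\<bar>) * (\<bar>t\<bar> ^ r * exp (- kap * t\<^sup>2))"])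
    show "(\<lambda>t. of_real (poly E 1) * gker var r s t) \<in> borel_measurable lborel"
      using integrable_gker[OF var_pos, of r s] by (intro borel_measurable_times) auto
    show "integrable lborel (\<lambda>t. (\<Sum>j\<le>degree E. \<bar>coeff E j\<bar>) * (\<bar>t\<bar> ^ r * exp (- kap * t\<^sup>2)))"
      by (intro integrable_mult_right integrable_power_gauss kap_pos)
    show "AE t in lborel. (\<lambda>i. lint (n i) r E (?s i) t) \<longlonglongrightarrow> of_real (poly E 1) * gker var r s t"
    proof (rule AE_I2)
      fix t :: real
      have t0: "(\<lambda>i. t / sqrt (real (n i))) \<longlonglongrightarrow> 0"
        using sq by (rule real_tendsto_divide_at_top[OF tendsto_const])
      have cis0: "(\<lambda>i. cis (t / sqrt (real (n i)))) \<longlonglongrightarrow> 1"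
      proof -
        have "isCont cis 0" unfolding cis_conv_exp by (intro continuous_intros)
        from isCont_tendsto_compose[OF this t0] show ?thesis by simp
      qed
      have 1: "(\<lambda>i. (cev P (cis (t / sqrt (real (n i)))) * cis (- mean * (t / sqrt (real (n i))))) ^ n i)
         \<longlonglongrightarrow> of_real (exp (- var * t\<^sup>2 / 2))"
        by (rule filterlim_compose[OF centered_char_limit n])
      have 2: "(\<lambda>i. of_real (sqrt (real (n i))) * (1 - cis (t / sqrt (real (n i))))) \<longlonglongrightarrow> - \<i> * of_real t"
      proof -
        have "(\<lambda>i. of_real (sqrt (real (n i))) * (1 - cis (t / sqrt (real (n i)))) - (- \<i> * of_real t)) \<longlonglongrightarrow> 0"
        proof (rule Lim_null_comparison)
          show "(\<lambda>i. t\<^sup>2 / 2 / sqrt (real (n i))) \<longlonglongrightarrow> 0"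
            using sq by (rule real_tendsto_divide_at_top[OF tendsto_const])
          show "\<forall>\<^sub>F i in sequentially. norm (of_real (sqrt (real (n i))) * (1 - cis (t / sqrt (real (n i)))) - (- \<i> * of_real t))
             \<le> t\<^sup>2 / 2 / sqrt (real (n i))"
            using ev0
          proof eventually_elim
            case (elim i)
            let ?q = "sqrt (real (n i))"
            have q: "?q > 0" using elim by simp
            have "of_real ?q * (1 - cis (t / ?q)) - (- \<i> * of_real t) = - of_real ?q * (cis (t / ?q) - (1 + \<i> * of_real (t / ?q)))"
              using q by (simp add: field_simps)
            hence "norm (of_real ?q * (1 - cis (t / ?q)) - (- \<i> * of_real t)) = ?q * norm (cis (t / ?q) - (1 + \<i> * of_real (t / ?q)))"
              using q by (simp add: norm_mult)
            also have "\<dots> \<le> ?q * (\<bar>t / ?q\<bar> ^ 2 / 2)"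
              using iexp_approx1[of "t / ?q" 1] q by (intro mult_left_mono) (auto simp: cis_conv_exp numeral_2_eq_2)
            also have "\<dots> = t\<^sup>2 / 2 / ?q" using q unfolding power2_abs power_divide by (simp only: power2_eq_square) (simp add: field_simps)
            finally show ?case .
          qed
        qed
        thus ?thesis by (rule LIM_zero_cancel)
      qed
      have 3: "(\<lambda>i. cev E (cis (t / sqrt (real (n i))))) \<longlonglongrightarrow> of_real (poly E 1)"
        using isCont_tendsto_compose[OF isCont_cev cis0, of E] cev_of_real[of E 1] by simp
      have 4: "(\<lambda>i. cis (- ?s i * t)) \<longlonglongrightarrow> cis (- s * t)"
      proof -
        have "isCont cis (- s * t)" unfolding cis_conv_exp by (intro continuous_intros)
        thus ?thesis by (rule isCont_tendsto_compose) (intro tendsto_intros s)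
      qed
      have 5: "(\<lambda>i. (cev P (cis (t / sqrt (real (n i)))) * cis (- mean * (t / sqrt (real (n i))))) ^ n i *
         (of_real (sqrt (real (n i))) * (1 - cis (t / sqrt (real (n i))))) ^ r * cev E (cis (t / sqrt (real (n i)))) * cis (- ?s i * t))
         \<longlonglongrightarrow> of_real (exp (- var * t\<^sup>2 / 2)) * (- \<i> * of_real t) ^ r * of_real (poly E 1) * cis (- s * t)"
        by (intro tendsto_mult tendsto_power 1 2 3 4)
      have "\<forall>\<^sub>F i in sequentially. \<bar>t\<bar> / pi \<le> sqrt (real (n i))"
        using sq unfolding filterlim_at_top by blast
      hence "\<forall>\<^sub>F i in sequentially. (cev P (cis (t / sqrt (real (n i)))) * cis (- mean * (t / sqrt (real (n i))))) ^ n i *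
         (of_real (sqrt (real (n i))) * (1 - cis (t / sqrt (real (n i))))) ^ r * cev E (cis (t / sqrt (real (n i)))) * cis (- ?s i * t)
         = lint (n i) r E (?s i) t"
        by eventually_elim (auto simp: lint_def indicator_def field_simps abs_le_iff)
      from Lim_transform_eventually[OF 5 this]
      show "(\<lambda>i. lint (n i) r E (?s i) t) \<longlonglongrightarrow> of_real (poly E 1) * gker var r s t"
        by (simp add: gker_def mult_ac)
    qed
  qed (use norm_lint_le in auto)
  hence "(\<lambda>i. (1 / (2 * of_real pi)) * (LINT t|lborel. lint (n i) r E (?s i) t)) \<longlonglongrightarrow>
      (1 / (2 * of_real pi)) * (LINT t|lborel. of_real (poly E 1) * gker var r s t)"
    by (intro tendsto_mult tendsto_const)
  also have "(1 / (2 * of_real pi)) * (LINT t|lborel. of_real (poly E 1) * gker var r s t) = of_real (poly E 1) * gprof var r s"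
    by (simp add: gprof_def)
  finally show ?thesis
  proof (rule Lim_transform_eventually)
    show "\<forall>\<^sub>F i in sequentially. (1 / (2 * of_real pi)) * (LINT t|lborel. lint (n i) r E (?s i) t) =
       complex_of_real (sqrt (real (n i)) ^ Suc r * coeff (P ^ n i * ([:1, -1:] ^ r * E)) (k i))"
      using ev0 by eventually_elim (rule scaled_coeff_eq[symmetric])
  qed
qed

text \<open>Uniform in k, since only the majorant is integrated. \<open>Suc n\<close> in place of n
  covers n = 0, where \<open>C0\<close> is the bound, and otherwise costs a factor sqrt 2 per
  power.\<close>

theorem coeff_bound:
  "\<exists>C>0. \<forall>n k. \<bar>coeff (P ^ n * ([:1, -1:] ^ r * E)) k\<bar> \<le> C / sqrt (real (Suc n)) ^ Suc r"
proof -
  define w where "w = (\<lambda>t. (\<Sum>j\<le>degree E. \<bar>coeff E j\<bar>) * (\<bar>t\<bar> ^ r * exp (- kap * t\<^sup>2)))"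
  have w: "integrable lborel w" unfolding w_def
    by (intro integrable_mult_right integrable_power_gauss kap_pos)
  define K where "K = (LINT t|lborel. w t)"
  have w0: "w t \<ge> 0" for t by (simp add: w_def sum_nonneg)
  have K0: "K \<ge> 0" unfolding K_def by (rule integral_nonneg_AE) (simp add: w0)
  define C0 where "C0 = (\<Sum>j\<le>degree ([:1, -1:] ^ r * E). \<bar>coeff ([:1, -1:] ^ r * E) j\<bar>)"
  have pos: "\<bar>coeff (P ^ n * ([:1, -1:] ^ r * E)) k\<bar> * sqrt (real n) ^ Suc r \<le> K" if n: "n > 0" for n k
  proof -
    let ?s = "(real k - real n * mean) / sqrt (real n)"
    have "norm (complex_of_real (sqrt (real n) ^ Suc r * coeff (P ^ n * ([:1, -1:] ^ r * E)) k)) =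
       (1 / (2 * pi)) * norm (LINT t|lborel. lint n r E ?s t)"
      unfolding scaled_coeff_eq[OF n] by (simp add: norm_mult norm_divide)
    also have "\<dots> \<le> (1 / (2 * pi)) * K"
    proof (rule mult_left_mono)
      show "norm (LINT t|lborel. lint n r E ?s t) \<le> K" unfolding K_def
      proof (rule order.trans[OF integral_norm_bound])
        have bd: "norm (lint n r E ?s t) \<le> w t" for t unfolding w_def by (rule norm_lint_le)
        have "integrable lborel (lint n r E ?s)"
          using bd w0 by (intro Bochner_Integration.integrable_bound[OF w]) auto
        thus "(LINT t|lborel. norm (lint n r E ?s t)) \<le> integral\<^sup>L lborel w"
          using bd w by (intro integral_mono) auto
      qed
    qed simp
    also have "\<dots> \<le> 1 * K" using K0 pi_gt3 by (intro mult_right_mono) auto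
    finally show ?thesis by (simp add: norm_mult abs_mult mult_ac norm_power)
  qed
  have "\<bar>coeff (P ^ n * ([:1, -1:] ^ r * E)) k\<bar> \<le> (C0 + sqrt 2 ^ Suc r * K + 1) / sqrt (real (Suc n)) ^ Suc r" for n k
  proof (cases "n = 0")
    case True
    have "\<bar>coeff ([:1, -1:] ^ r * E) k\<bar> \<le> C0"
    proof (cases "k \<le> degree ([:1, -1:] ^ r * E)")
      case True
      thus ?thesis unfolding C0_def by (intro member_le_sum) auto
    next
      case False
      hence "coeff ([:1, -1:] ^ r * E) k = 0" by (intro coeff_eq_0) simp
      thus ?thesis by (simp add: C0_def sum_nonneg)
    qed
    thus ?thesis using True K0 by (auto intro: order.trans)
  next
    case False
    have "sqrt (real (Suc n)) ^ Suc r \<le> (sqrt 2 * sqrt (real n)) ^ Suc r"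
      using False by (intro power_mono) (auto simp: real_sqrt_mult[symmetric])
    hence "\<bar>coeff (P ^ n * ([:1, -1:] ^ r * E)) k\<bar> * sqrt (real (Suc n)) ^ Suc r
      \<le> \<bar>coeff (P ^ n * ([:1, -1:] ^ r * E)) k\<bar> * (sqrt 2 * sqrt (real n)) ^ Suc r" by (intro mult_left_mono) auto
    also have "\<dots> = sqrt 2 ^ Suc r * (\<bar>coeff (P ^ n * ([:1, -1:] ^ r * E)) k\<bar> * sqrt (real n) ^ Suc r)"
      by (simp add: power_mult_distrib mult_ac)
    also have "\<dots> \<le> sqrt 2 ^ Suc r * K" using pos[of n k] False by (intro mult_left_mono) auto
    also have "\<dots> \<le> C0 + sqrt 2 ^ Suc r * K + 1" by (simp add: C0_def sum_nonneg)
    finally show ?thesis by (simp add: pos_le_divide_eq)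
  qed
  moreover have "C0 + sqrt 2 ^ Suc r * K + 1 > 0" using K0 by (simp add: C0_def add_nonneg_pos sum_nonneg)
  ultimately show ?thesis by blast
qed

end

text \<open>The classical He_r in the scaling (-1) ^ r * v ^ (-r / 2) * He_r (s / sqrt v), generated
  by the recursion of \<open>gprof_rec\<close>.\<close>

fun hermite :: "real \<Rightarrow> nat \<Rightarrow> real poly" where
  "hermite v 0 = 1"
| "hermite v (Suc 0) = [:0, - 1 / v:]"
| "hermite v (Suc (Suc r)) = smult (- 1 / v) ([:0, 1:] * hermite v (Suc r) + smult (real (Suc r)) (hermite v r))"

lemma hermite_degree:
  assumes "v > 0" shows "degree (hermite v r) = r \<and> hermite v r \<noteq> 0"
  using assms
proof (induction v r rule: hermite.induct)
  case (3 v r)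
  have d: "degree ([:0, 1:] * hermite v (Suc r)) = Suc (Suc r)"
    using 3 by (subst degree_mult_eq) auto
  have "degree (smult (real (Suc r)) (hermite v r)) < Suc (Suc r)" using 3 by simp
  hence "degree ([:0, 1:] * hermite v (Suc r) + smult (real (Suc r)) (hermite v r)) = Suc (Suc r)"
    using degree_add_eq_left[of "smult (real (Suc r)) (hermite v r)" "[:0, 1:] * hermite v (Suc r)"] d by simp
  hence "degree (hermite v (Suc (Suc r))) = Suc (Suc r)" using 3(3) by (simp del: mult_pCons_left)
  thus ?case by (metis degree_0 nat.simps(3))
qed auto

definition gr :: "real \<Rightarrow> nat \<Rightarrow> real \<Rightarrow> real" where
  "gr v r s = exp (- s\<^sup>2 / (2 * v)) / sqrt (2 * pi * v) * poly (hermite v r) s"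

lemma gprof_eq_gr:
  assumes v: "v > 0"
  shows "gprof v r s = of_real (gr v r s)"
  using v
proof (induction v r rule: hermite.induct)
  case (1 v)
  thus ?case by (simp add: gprof_0 gr_def)
next
  case (2 v)
  have "of_real v * gprof v (Suc 0) s = of_real (v * gr v (Suc 0) s)"
    using gprof_rec[OF 2, of 0 s] gprof_0[OF 2, of s] 2 by (simp add: gr_def)
  thus ?case using 2 by simp
next
  case (3 v r)
  have "v * gr v (Suc (Suc r)) s = - s * gr v (Suc r) s - real (Suc r) * gr v r s"
    using 3(3) by (simp add: gr_def field_simps)
  hence "complex_of_real (v * gr v (Suc (Suc r)) s) = of_real (- s * gr v (Suc r) s - real (Suc r) * gr v r s)"
    by (simp only:)
  hence "of_real v * gprof v (Suc (Suc r)) s = of_real (v * gr v (Suc (Suc r)) s)"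
    using gprof_rec[OF 3(3), of "Suc r" s] 3 by simp
  thus ?case using 3(3) by simp
qed

lemma gr_0_pos: "v > 0 \<Longrightarrow> gr v 0 s > 0"
  by (simp add: gr_def)

text \<open>By the three-term recursion both products contain - s / v times the same product of
  \<open>gr\<close> of orders r + 1 and 0, which cancels. Nonvanishing of the determinant thus
  depends on a single Hermite polynomial.\<close>

lemma gr_wronskian:
  assumes v: "v > 0"
  shows "gr v (Suc (Suc r)) s * gr v 0 s - gr v (Suc r) s * gr v (Suc 0) s = - (real (Suc r) / v) * gr v 0 s * gr v r s"
  using v by (simp add: gr_def field_simps)

section \<open>Coefficient differences between nearby vertices\<close>

context lattice_law
begin

lemma local_limit_real:
  assumes n: "filterlim n at_top sequentially"
    and s: "(\<lambda>i. (real (k i) - real (n i) * mean) / sqrt (real (n i))) \<longlonglongrightarrow> s"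
  shows "(\<lambda>i. sqrt (real (n i)) ^ Suc r * coeff (P ^ n i * ([:1, -1:] ^ r * E)) (k i))
     \<longlonglongrightarrow> poly E 1 * gr var r s"
  using local_limit[OF assms, of r E] unfolding gprof_eq_gr[OF var_pos] of_real_mult[symmetric]
  by (rule tendsto_of_real_iff[THEN iffD1])

text \<open>Going back a fixed number of levels changes n * mean by a bounded amount, invisible at
  the scale sqrt n.\<close>

lemma shift_limit:
  assumes n: "filterlim n at_top sequentially"
    and s: "(\<lambda>i. (real (k i) - real (n i) * mean) / sqrt (real (n i))) \<longlonglongrightarrow> s"
  shows "filterlim (\<lambda>i. n i - m) at_top sequentially"
    and "(\<lambda>i. sqrt (real (n i)) / sqrt (real (n i - m))) \<longlonglongrightarrow> 1"
    and "(\<lambda>i. (real (k i) - real (n i - m) * mean) / sqrt (real (n i - m))) \<longlonglongrightarrow> s"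
proof -
  show n': "filterlim (\<lambda>i. n i - m) at_top sequentially"
    by (rule filterlim_compose[OF filterlim_minus_const_nat_at_top n])
  show ratio: "(\<lambda>i. sqrt (real (n i)) / sqrt (real (n i - m))) \<longlonglongrightarrow> 1"
  proof -
    have "((\<lambda>j::nat. sqrt (real j) / sqrt (real j - real m)) \<longlongrightarrow> 1) at_top" by real_asymp
    hence "((\<lambda>j::nat. sqrt (real j) / sqrt (real (j - m))) \<longlongrightarrow> 1) at_top"
      by (rule Lim_transform_eventually) (auto intro!: eventually_sequentiallyI[of m])
    from filterlim_compose[OF this n] show ?thesis .
  qed
  have z: "(\<lambda>i. real m * mean / sqrt (real (n i - m))) \<longlonglongrightarrow> 0"
    by (rule real_tendsto_divide_at_top[OF tendsto_const], rule filterlim_compose[OF sqrt_at_top],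
        rule filterlim_compose[OF filterlim_real_sequentially n'])
  have ev: "\<forall>\<^sub>F i in sequentially. n i > m"
    using eventually_compose_filterlim[OF eventually_gt_at_top n] .
  have "(\<lambda>i. (real (k i) - real (n i) * mean) / sqrt (real (n i)) * (sqrt (real (n i)) / sqrt (real (n i - m)))
      + real m * mean / sqrt (real (n i - m))) \<longlonglongrightarrow> s * 1 + 0"
    by (intro tendsto_intros s ratio z)
  hence "(\<lambda>i. (real (k i) - real (n i - m) * mean) / sqrt (real (n i - m))) \<longlonglongrightarrow> s * 1 + 0"
    by (rule Lim_transform_eventually) (use ev in eventually_elim, auto simp: field_simps of_nat_diff)
  thus "(\<lambda>i. (real (k i) - real (n i - m) * mean) / sqrt (real (n i - m))) \<longlonglongrightarrow> s" by simp
qed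

lemma local_limit_shift:
  assumes n: "filterlim n at_top sequentially"
    and s: "(\<lambda>i. (real (k i) - real (n i) * mean) / sqrt (real (n i))) \<longlonglongrightarrow> s"
  shows "(\<lambda>i. sqrt (real (n i)) ^ Suc r * coeff (P ^ (n i - m) * ([:1, -1:] ^ r * E)) (k i))
     \<longlonglongrightarrow> poly E 1 * gr var r s"
proof -
  note sh = shift_limit[OF n s, of m]
  have ev: "\<forall>\<^sub>F i in sequentially. n i > m"
    using eventually_compose_filterlim[OF eventually_gt_at_top n] .
  have "(\<lambda>i. sqrt (real (n i - m)) ^ Suc r * coeff (P ^ (n i - m) * ([:1, -1:] ^ r * E)) (k i))
     \<longlonglongrightarrow> poly E 1 * gr var r s"
    by (intro local_limit_real sh)
  from tendsto_mult[OF tendsto_power[OF sh(2), of "Suc r"] this]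
  have "(\<lambda>i. (sqrt (real (n i)) / sqrt (real (n i - m))) ^ Suc r *
      (sqrt (real (n i - m)) ^ Suc r * coeff (P ^ (n i - m) * ([:1, -1:] ^ r * E)) (k i))) \<longlonglongrightarrow> poly E 1 * gr var r s"
    by simp
  thus ?thesis
    by (rule Lim_transform_eventually) (use ev in eventually_elim, auto simp: power_divide)
qed

lemma step_factor:
  obtains B where "monom 1 i - P = [:1, -1:] * B"
proof -
  have "poly (monom 1 i - P) 1 = 0" by (simp add: poly_1 poly_monom)
  hence "[:-1, 1:] dvd monom 1 i - P" by (rule poly_eq_0_iff_dvd[THEN iffD1])
  then obtain C where "monom 1 i - P = [:-1, 1:] * C" by (elim dvdE)
  hence "monom 1 i - P = [:1, -1:] * (- C)" by simp
  thus ?thesis by (rule that)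
qed

text \<open>x ^ i and \<open>P\<close> agree at 1, so comparing a vertex with its neighbour along an
  edge of type i inserts one more factor 1 - x. This is the source of every later gain of n ^
  (-1/2).\<close>

lemma coeff_shift_diff:
  assumes "monom 1 i - P = [:1, -1:] * B"
  shows "coeff (P ^ j * ([:1, -1:] ^ r * E)) k - coeff (P ^ Suc j * ([:1, -1:] ^ r * E)) (k + i) =
     coeff (P ^ j * ([:1, -1:] ^ Suc r * (E * B))) (k + i)"
proof -
  have "P ^ j * ([:1, -1:] ^ Suc r * (E * B)) = P ^ j * ([:1, -1:] ^ r * E) * ([:1, -1:] * B)"
    by (simp only: power_Suc mult_ac)
  also have "\<dots> = monom 1 i * (P ^ j * ([:1, -1:] ^ r * E)) - P ^ Suc j * ([:1, -1:] ^ r * E)"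
    unfolding assms[symmetric] by (simp add: algebra_simps)
  finally show ?thesis by (simp add: coeff_monom_mult)
qed

lemma step_bound:
  "\<exists>C>0. \<forall>i\<le>D. \<forall>j k. \<bar>coeff (P ^ j * ([:1, -1:] ^ r * E)) k - coeff (P ^ Suc j * ([:1, -1:] ^ r * E)) (k + i)\<bar>
      \<le> C / sqrt (real (Suc j)) ^ Suc (Suc r)"
proof -
  have "\<exists>C>0. \<forall>j k. \<bar>coeff (P ^ j * ([:1, -1:] ^ r * E)) k - coeff (P ^ Suc j * ([:1, -1:] ^ r * E)) (k + i)\<bar>
      \<le> C / sqrt (real (Suc j)) ^ Suc (Suc r)" for i
  proof -
    obtain B where B: "monom 1 i - P = [:1, -1:] * B" by (rule step_factor)
    show ?thesis using coeff_bound[of "Suc r" "E * B"] unfolding coeff_shift_diff[OF B] by blast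
  qed
  then obtain C where C: "\<And>i. C i > 0" "\<And>i j k. \<bar>coeff (P ^ j * ([:1, -1:] ^ r * E)) k - coeff (P ^ Suc j * ([:1, -1:] ^ r * E)) (k + i)\<bar>
      \<le> C i / sqrt (real (Suc j)) ^ Suc (Suc r)" by metis
  have "C i \<le> (\<Sum>i\<le>D. C i)" if "i \<le> D" for i
    using that C(1) less_imp_le by (intro member_le_sum) auto
  moreover have "(\<Sum>i\<le>D. C i) > 0" using C(1) by (intro sum_pos) auto
  ultimately show ?thesis
    by (intro exI[of _ "\<Sum>i\<le>D. C i"]) (meson C(2) divide_right_mono order.trans zero_le_power real_sqrt_ge_zero of_nat_0_le_iff)
qed

lemma multistep_bound:
  "\<exists>C>0. \<forall>m j k k'. k' \<le> k \<longrightarrow> k \<le> k' + D * m \<longrightarrow>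
     \<bar>coeff (P ^ j * ([:1, -1:] ^ r * E)) k' - coeff (P ^ (j + m) * ([:1, -1:] ^ r * E)) k\<bar>
      \<le> C * real m / sqrt (real (Suc j)) ^ Suc (Suc r)"
proof -
  let ?u = "\<lambda>j k. coeff (P ^ j * ([:1, -1:] ^ r * E)) k"
  obtain C where C: "C > 0" "\<And>i j k. i \<le> D \<Longrightarrow> \<bar>?u j k - ?u (Suc j) (k + i)\<bar> \<le> C / sqrt (real (Suc j)) ^ Suc (Suc r)"
    using step_bound[of D r E] by blast
  have "\<bar>?u j k' - ?u (j + m) k\<bar> \<le> C * real m / sqrt (real (Suc j)) ^ Suc (Suc r)"
    if "k' \<le> k" "k \<le> k' + D * m" for m j k k'
    using that
  proof (induction m arbitrary: k)
    case (Suc m)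
    \<comment> \<open>Greedy last step: as much of k - k' as one edge allows, so that the rest fits
      into the remaining m steps.\<close>
    define i where "i = min D (k - k')"
    have i: "i \<le> D" "k' \<le> k - i" "k - i \<le> k' + D * m" "k - i + i = k" using Suc.prems by (auto simp: i_def)
    have "\<bar>?u (j + m) (k - i) - ?u (Suc (j + m)) (k - i + i)\<bar> \<le> C / sqrt (real (Suc (j + m))) ^ Suc (Suc r)"
      by (rule C(2)[OF i(1)])
    also have "\<dots> \<le> C / sqrt (real (Suc j)) ^ Suc (Suc r)"
      using C(1) by (intro divide_left_mono power_mono mult_pos_pos zero_less_power) auto
    finally have "\<bar>?u (j + m) (k - i) - ?u (j + Suc m) k\<bar> \<le> C / sqrt (real (Suc j)) ^ Suc (Suc r)"
      using i(4) by simp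
    moreover have "\<bar>?u j k' - ?u (j + m) (k - i)\<bar> \<le> C * real m / sqrt (real (Suc j)) ^ Suc (Suc r)"
      by (rule Suc.IH[OF i(2,3)])
    ultimately have "\<bar>?u j k' - ?u (j + Suc m) k\<bar> \<le> C * real m / sqrt (real (Suc j)) ^ Suc (Suc r) + C / sqrt (real (Suc j)) ^ Suc (Suc r)"
      by linarith
    also have "\<dots> = C * real (Suc m) / sqrt (real (Suc j)) ^ Suc (Suc r)"
      by (simp add: add_divide_distrib[symmetric] algebra_simps)
    finally show ?case .
  qed auto
  thus ?thesis using C(1) by blast
qed

text \<open>The value is mean - D, minus the derivative of x ^ D - P at 1. Its sign is read off from
  the quotient on (0, 1), where the constant coefficient alone forces B to be at most - coeff P
  0.\<close>

lemma step_factor_nonzero: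
  assumes "degree P \<le> D" "D \<ge> 1" and B: "monom 1 D - P = [:1, -1:] * B"
  shows "poly B 1 < 0"
proof -
  have le: "poly B x \<le> - coeff P 0" if x: "0 < x" "x < 1" for x
  proof -
    have "(1 - x) * poly B x = x ^ D - poly P x"
      using arg_cong[OF B, of "\<lambda>p. poly p x"] by (simp add: poly_monom algebra_simps)
    also have "\<dots> = (\<Sum>j\<le>degree P. coeff P j * (x ^ D - x ^ j))"
      by (simp add: right_diff_distrib sum_subtractf sum_distrib_right[symmetric] sum_coeff poly_altdef)
    also have "\<dots> = coeff P 0 * (x ^ D - 1) + (\<Sum>j\<in>{..degree P} - {0}. coeff P j * (x ^ D - x ^ j))"
      by (subst sum.remove[of _ 0]) auto
    also have "\<dots> \<le> coeff P 0 * (x ^ D - 1) + 0"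
      using x assms coeff_nonneg
      by (intro add_left_mono sum_nonpos mult_nonneg_nonpos) (auto intro!: power_decreasing)
    also have "\<dots> \<le> coeff P 0 * (x - 1)"
    proof -
      have "x ^ D \<le> x" using x assms power_decreasing[of 1 D x] by simp
      hence "coeff P 0 * (x ^ D - 1) \<le> coeff P 0 * (x - 1)" using coeff0 by (intro mult_left_mono) auto
      thus ?thesis by simp
    qed
    finally have "(1 - x) * poly B x \<le> (1 - x) * (- coeff P 0)" by (simp add: algebra_simps)
    thus ?thesis using x by (simp only: mult_le_cancel_left_pos diff_gt_0_iff_gt)
  qed
  have "(poly B \<longlongrightarrow> poly B 1) (at_left 1)"
  proof -
    have "isCont (poly B) 1" by simp
    thus ?thesis unfolding isCont_def by (rule filterlim_at_split[THEN iffD1, THEN conjunct1])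
  qed
  moreover have "\<forall>\<^sub>F x in at_left 1. poly B x \<le> - coeff P 0"
    using eventually_at_left_real[of 0 "1::real"] by (auto elim!: eventually_mono intro: le)
  ultimately have "poly B 1 \<le> - coeff P 0" by (intro tendsto_upperbound) auto
  thus ?thesis using coeff0 by simp
qed

text \<open>With u', p' one level lower, u' * p - u * p' = (u' - u) * p - u * (p' - p). Each
  increment carries an extra factor 1 - x, which improves the order from n ^ (-(r + 3) / 2) to n ^
  (-(r + 4) / 2), and the limits of the four factors form the left side of
  \<open>gr_wronskian\<close>.\<close>

lemma wronskian_limit:
  assumes n: "filterlim n at_top sequentially"
    and s: "(\<lambda>i. (real (k i) - real (n i) * mean) / sqrt (real (n i))) \<longlonglongrightarrow> s"
    and kD: "\<And>i. k i \<ge> D"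
    and B: "monom 1 D - P = [:1, -1:] * B"
    and nN: "\<And>i. n i > N"
  shows "(\<lambda>i. sqrt (real (n i)) ^ (r + 4) *
     (coeff (P ^ (n i - Suc N) * ([:1, -1:] ^ Suc r * E)) (k i - D) * coeff (P ^ n i) (k i)
      - coeff (P ^ (n i - N) * ([:1, -1:] ^ Suc r * E)) (k i) * coeff (P ^ (n i - 1)) (k i - D)))
     \<longlonglongrightarrow> - (poly E 1 * poly B 1 * (real (Suc r) / var) * gr var 0 s * gr var r s)"
proof -
  define u where "u = (\<lambda>m i k. coeff (P ^ (n i - m) * ([:1, -1:] ^ Suc r * E)) k)"
  define p where "p = (\<lambda>m i k. coeff (P ^ (n i - m)) k)"
  define X1 where "X1 = (\<lambda>i. coeff (P ^ (n i - Suc N) * ([:1, -1:] ^ Suc (Suc r) * (E * B))) (k i))"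
  define X2 where "X2 = (\<lambda>i. coeff (P ^ (n i - 1) * ([:1, -1:] ^ Suc 0 * (1 * B))) (k i))"
  have X1: "u (Suc N) i (k i - D) - u N i (k i) = X1 i" for i
    using coeff_shift_diff[OF B, of "n i - Suc N" "Suc r" E "k i - D"] kD[of i] nN[of i]
    by (simp add: u_def X1_def Suc_diff_Suc)
  have X2: "p 1 i (k i - D) - p 0 i (k i) = X2 i" for i
    using coeff_shift_diff[OF B, of "n i - 1" 0 1 "k i - D"] kD[of i] nN[of i]
    by (simp add: p_def X2_def)
  have l1: "(\<lambda>i. sqrt (real (n i)) ^ Suc (Suc (Suc r)) * X1 i) \<longlonglongrightarrow> poly (E * B) 1 * gr var (Suc (Suc r)) s"
    unfolding X1_def by (rule local_limit_shift[OF n s])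
  have l2: "(\<lambda>i. sqrt (real (n i)) ^ Suc (Suc 0) * X2 i) \<longlonglongrightarrow> poly (1 * B) 1 * gr var (Suc 0) s"
    unfolding X2_def by (rule local_limit_shift[OF n s])
  have l3: "(\<lambda>i. sqrt (real (n i)) ^ Suc (Suc r) * u N i (k i)) \<longlonglongrightarrow> poly E 1 * gr var (Suc r) s"
    unfolding u_def by (rule local_limit_shift[OF n s])
  have l4: "(\<lambda>i. sqrt (real (n i)) ^ Suc 0 * p 0 i (k i)) \<longlonglongrightarrow> gr var 0 s"
    using local_limit_shift[OF n s, of 0 0 1] by (simp add: p_def)
  have "(\<lambda>i. (sqrt (real (n i)) ^ Suc (Suc (Suc r)) * X1 i) * (sqrt (real (n i)) ^ Suc 0 * p 0 i (k i))
      - (sqrt (real (n i)) ^ Suc (Suc r) * u N i (k i)) * (sqrt (real (n i)) ^ Suc (Suc 0) * X2 i))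
     \<longlonglongrightarrow> poly (E * B) 1 * gr var (Suc (Suc r)) s * gr var 0 s - poly E 1 * gr var (Suc r) s * (poly (1 * B) 1 * gr var (Suc 0) s)"
    by (intro tendsto_intros l1 l2 l3 l4)
  moreover have "poly (E * B) 1 * gr var (Suc (Suc r)) s * gr var 0 s - poly E 1 * gr var (Suc r) s * (poly (1 * B) 1 * gr var (Suc 0) s)
     = poly E 1 * poly B 1 * (gr var (Suc (Suc r)) s * gr var 0 s - gr var (Suc r) s * gr var (Suc 0) s)"
    by (simp add: algebra_simps)
  moreover have "(sqrt (real (n i)) ^ Suc (Suc (Suc r)) * X1 i) * (sqrt (real (n i)) ^ Suc 0 * p 0 i (k i))
      - (sqrt (real (n i)) ^ Suc (Suc r) * u N i (k i)) * (sqrt (real (n i)) ^ Suc (Suc 0) * X2 i)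
      = sqrt (real (n i)) ^ (r + 4) * (u (Suc N) i (k i - D) * p 0 i (k i) - u N i (k i) * p 1 i (k i - D))" for i
  proof -
    have alg: "(h * h * h * c * (x - y)) * (h * w) - (h * h * c * y) * (h * h * (z - w)) = h * h * h * h * c * (x * w - y * z)"
      for h c x y z w :: real by algebra
    have e4: "h ^ (r + 4) = h * h * h * h * h ^ r" for h :: real by (simp add: power_add power4_eq_xxxx)
    show ?thesis unfolding X1[symmetric] X2[symmetric] e4 power_Suc power_0
      using alg[of "sqrt (real (n i))" "sqrt (real (n i)) ^ r" "u (Suc N) i (k i - D)" "u N i (k i)" "p 0 i (k i)" "p 1 i (k i - D)"]
      by (simp only: mult.assoc mult_1_right)
  qed
  ultimately have "(\<lambda>i. sqrt (real (n i)) ^ (r + 4) * (u (Suc N) i (k i - D) * p 0 i (k i) - u N i (k i) * p 1 i (k i - D)))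
     \<longlonglongrightarrow> poly E 1 * poly B 1 * (gr var (Suc (Suc r)) s * gr var 0 s - gr var (Suc r) s * gr var (Suc 0) s)"
    by (simp only:)
  moreover have "poly E 1 * poly B 1 * (- (real (Suc r) / var) * gr var 0 s * gr var r s) =
     - (poly E 1 * poly B 1 * (real (Suc r) / var) * gr var 0 s * gr var r s)" by (simp add: mult.assoc)
  ultimately show ?thesis unfolding gr_wronskian[OF var_pos] by (simp only: u_def p_def diff_zero)
qed

end

section \<open>Orbits inside a tower\<close>

lemma pos_inj:
  assumes "y \<in> cls a d n x" "w \<in> cls a d n x" "pos a d n y = pos a d n w"
  shows "y = w"
  using cls_total[OF assms(1,2)] pos_mono[OF assms(1,2)] pos_mono[OF assms(2,1)] assms(3) by auto

lemma Tp_pow_hit: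
  assumes x: "x \<in> Xp a d" and y: "y \<in> cls a d n x" and le: "pos a d n x \<le> pos a d n y"
  shows "(Tp a d ^^ (pos a d n y - pos a d n x)) x = y"
proof -
  have "pos a d n y < card (cls a d n x)" using pos_less[OF cls_Xp[OF y], of n] cls_eq[OF y] by simp
  hence "pos a d n x + (pos a d n y - pos a d n x) < card (cls a d n x)" using le by simp
  note * = Tp_pow_cls[OF x this]
  show ?thesis by (rule pos_inj[of _ a d n x]) (use * y le in auto)
qed

lemma ex_cls_min:
  assumes "y \<in> Xp a d"
  shows "\<exists>w\<in>cls a d m y. below a d m w = {}"
proof -
  obtain w where w: "w \<in> cls a d m y" and least: "\<And>v. v \<in> cls a d m y \<Longrightarrow> pos a d m w \<le> pos a d m v"
    using ex_has_least_nat[of "\<lambda>w. w \<in> cls a d m y" y "pos a d m"] cls_self[OF assms] by metis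
  have "below a d m w = {}"
  proof (rule ccontr)
    assume "below a d m w \<noteq> {}"
    then obtain v where v: "v \<in> cls a d m y" "adic_less v w" using cls_eq[OF w] by (auto simp: below_def)
    thus False using pos_mono[OF v(1) w v(2)] least[OF v(1)] by simp
  qed
  thus ?thesis using w by blast
qed

lemma Sg_add: "Sg a d f x (i + j) = Sg a d f x i + Sg a d f ((Tp a d ^^ i) x) j"
proof (induction j)
  case (Suc j)
  have "(Tp a d ^^ (i + j)) x = (Tp a d ^^ j) ((Tp a d ^^ i) x)"
    by (subst add.commute) (simp add: funpow_add)
  thus ?case using Suc by (simp add: Sg_def)
qed (simp add: Sg_def)

lemma Sg_Suc: "Sg a d f x (Suc i) = Sg a d f x i + f ((Tp a d ^^ i) x)"
  by (simp add: Sg_def)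

text \<open>A stretch of orbit that is shorter than every level-m tower meets at most two of them.\<close>

lemma Sg_modulus:
  assumes y: "y \<in> Xp a d" and t: "pos a d n y + t < card (cls a d n y)"
    and h: "\<And>w. w \<in> cls a d n y \<Longrightarrow> t < card (cls a d m w)" and mn: "m \<le> n"
    and F: "\<And>w. w \<in> cls a d n y \<Longrightarrow> \<bar>Fs a d m f w\<bar> \<le> B" and fb: "\<And>w. w \<in> Xp a d \<Longrightarrow> \<bar>f w\<bar> \<le> b"
  shows "\<bar>Sg a d f y t\<bar> \<le> 3 * B + b"
proof -
  have b0: "b \<ge> 0" using fb[OF y] by linarith
  have yc: "y \<in> cls a d n y" by (rule cls_self[OF y])
  have B0: "B \<ge> 0" using F[OF yc] by linarith
  show ?thesis
  proof (cases "pos a d m y + t < card (cls a d m y)")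
    case True
    from Tp_pow_cls[OF y True, of f] have "Sg a d f y t = Fs a d m f ((Tp a d ^^ t) y) - Fs a d m f y" by simp
    moreover have "(Tp a d ^^ t) y \<in> cls a d n y" using Tp_pow_cls[OF y t] by blast
    ultimately show ?thesis using F[of "(Tp a d ^^ t) y"] F[OF yc] B0 b0 by linarith
  next
    case False
    \<comment> \<open>Steps from y to the top of its level-m tower; one step later the orbit is at
      the bottom of the next. The bound collects two values of \<open>Fs\<close> before the
      crossing, the summand at the top, and one value of \<open>Fs\<close> after it.\<close>
    define t1 where "t1 = card (cls a d m y) - pos a d m y - 1"
    have t1: "pos a d m y + t1 < card (cls a d m y)" "Suc t1 \<le> t" "pos a d m y + Suc t1 = card (cls a d m y)"
      using False pos_less[OF y, of m] by (auto simp: t1_def)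
    define v where "v = (Tp a d ^^ t1) y"
    have v: "v \<in> cls a d m y" "pos a d m v = pos a d m y + t1" "Sg a d f y t1 = Fs a d m f v - Fs a d m f y"
      using Tp_pow_cls[OF y t1(1), of f] by (auto simp: v_def)
    have vX: "v \<in> Xp a d" using v cls_Xp by blast
    have vn: "v \<in> cls a d n y" using v(1) cls_mono[OF mn] by blast
    have mx: "\<not> (\<exists>w\<in>cls a d m v. adic_less v w)"
      using not_max_iff_pos[OF vX, of m] v t1 cls_eq[OF v(1)] by simp
    have "pos a d n y + t1 < card (cls a d n y)" using t t1 by simp
    from Tp_pow_cls[OF y this] have pv: "pos a d n v = pos a d n y + t1" by (simp add: v_def)
    have ex: "\<exists>w\<in>cls a d n v. adic_less v w"
      using not_max_iff_pos[OF vX, of n] pv t t1 cls_eq[OF vn] by simp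
    define w where "w = Tp a d v"
    have w: "w = (Tp a d ^^ Suc t1) y" by (simp add: w_def v_def)
    have wn: "w \<in> cls a d n y" using Tp_succ[OF vX ex] cls_eq[OF vn] by (simp add: w_def)
    have wX: "w \<in> Xp a d" using wn cls_Xp by blast
    have bw: "below a d m w = {}"
      unfolding w_def using below_Tp_of_max[OF vX mx] ex cls_Xp by blast
    define t2 where "t2 = t - Suc t1"
    have t2: "pos a d m w + t2 < card (cls a d m w)" using bw h[OF wn] by (simp add: t2_def)
    have "Sg a d f w t2 = Fs a d m f ((Tp a d ^^ t2) w)"
      using Tp_pow_cls[OF wX t2, of f] bw by (simp add: Fs_def)
    moreover have "(Tp a d ^^ t2) w \<in> cls a d n y"
      using Tp_pow_cls[OF wX t2] cls_mono[OF mn, of a d w] cls_eq[OF wn] by blast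
    moreover have "Sg a d f y t = Sg a d f y t1 + f v + Sg a d f w t2"
      using Sg_add[of a d f y "Suc t1" t2] t1 by (simp add: t2_def Sg_Suc v_def w)
    ultimately show ?thesis using F[OF vn] F[OF yc] F[of "(Tp a d ^^ t2) w"] fb[OF vX] v(3) by linarith
  qed
qed

text \<open>j may be the exact time of leaving the tower, where no value of \<open>Fs\<close> is at
  hand; there the vanishing total replaces it.\<close>

lemma Sg_in_cls_bound:
  assumes x: "x \<in> Xp a d" and j: "pos a d n x + j \<le> card (cls a d n x)"
    and tot: "(\<Sum>y\<in>cls a d n x. f y) = 0"
    and F: "\<And>w. w \<in> cls a d n x \<Longrightarrow> \<bar>Fs a d n f w\<bar> \<le> B"
  shows "\<bar>Sg a d f x j\<bar> \<le> 2 * B"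
proof -
  note Fx = F[OF cls_self[OF x]]
  show ?thesis
  proof (cases "pos a d n x + j < card (cls a d n x)")
    case True
    from Tp_pow_cls[OF x True, of f] have "Sg a d f x j = Fs a d n f ((Tp a d ^^ j) x) - Fs a d n f x"
      "(Tp a d ^^ j) x \<in> cls a d n x" by auto
    thus ?thesis using F[of "(Tp a d ^^ j) x"] Fx by linarith
  next
    case False
    hence "card (cls a d n x) - pos a d n x = j" using j by simp
    thus ?thesis using Sg_to_top[OF x, of n f] tot Fx by simp
  qed
qed

lemma pos_eq_Fs: "real (pos a d n x) = Fs a d n (\<lambda>_. 1) x"
  by (simp add: Fs_def)

lemma card_cls_eq_Gs:
  assumes "x \<in> Xp a d" "0 < a 0"
  shows "real (card (cls a d n x)) = Gs a d (\<lambda>_. 1) n (vert x n)"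
  using cls_sum_eq_Gs[OF cylindric_const[of a d 0 1] _ assms, of n] by simp

text \<open>The orbit of x passes through a complete copy of the tower of (n-1, k); it is entered at time j,
  and i is the time it takes to traverse the copies of the tower of (n-2, k-d) at its beginning.\<close>

lemma orbit_three_points:
  assumes x: "x \<in> Xp a d" and a: "\<forall>j\<le>d. 0 < a j" and d: "d \<ge> 1" and g: "cylindric a d N g"
    and n: "n \<ge> N + 2" and xe: "x (n - 1) = (d, 0)" and k: "k = vert x n" "k \<ge> d"
    and H1: "Gs a d (\<lambda>_. 1) (n - 1) k > 0" and H2: "Gs a d (\<lambda>_. 1) (n - 2) (k - (d - 1)) > 0"
  shows "\<exists>j i h. real i = real (a d) * Gs a d (\<lambda>_. 1) (n - 2) (k - d) \<and> real h = Gs a d (\<lambda>_. 1) (n - 1) k \<and> i \<le> h \<and> 0 < h \<and>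
     pos a d n x + j + h \<le> card (cls a d n x) \<and>
     Sg a d g x (j + i) - Sg a d g x j = real (a d) * Gs a d g (n - 2) (k - d) \<and>
     Sg a d g x (j + h) - Sg a d g x j = Gs a d g (n - 1) k"
proof -
  have a0: "0 < a 0" using a by simp
  obtain m where m: "n = Suc (Suc m)" "m \<ge> N" using n by (intro that[of "n - 2"]) auto
  \<comment> \<open>The largest edge in the order, while x (n - 1) = (d, 0) is the smallest: the
    copy of the tower of (n - 1, k) entered through \<open>e\<close> lies entirely above
    \<open>x\<close>.\<close>
  define e where "e = (0::nat, a 0 - 1)"
  \<comment> \<open>The first edge after all those of type d. Below the bottom of the subtower with
    this edge lie exactly the \<open>a d\<close> copies of the tower of (n - 2, k - d);
    \<open>H2\<close> makes the subtower nonempty.\<close>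
  define e' where "e' = (d - 1, 0::nat)"
  have eE: "e \<in> edges a d" "e' \<in> edges a d" using a a0 d by (auto simp: e_def e'_def in_edges)
  define x1 where "x1 = (x(Suc m := e))(m := e')"
  have x1X: "x1 \<in> Xp a d" using x eE by (simp add: x1_def upd_Xp)
  have "Gs a d (\<lambda>_. 1) m (k - (d - 1)) = (\<Sum>y\<in>tower a d m (k - (d - 1)) x1. 1)"
    using tower_sum_eq_Gs[OF cylindric_const[of a d 0 1] _ x1X a0, of m "k - (d - 1)"] by simp
  hence "tower a d m (k - (d - 1)) x1 \<noteq> {}" using H2 m by auto
  then obtain y where y: "y \<in> tower a d m (k - (d - 1)) x1" by blast
  hence yX: "y \<in> Xp a d" and ym: "vert y m = k - (d - 1)" and yt: "\<And>i. i \<ge> m \<Longrightarrow> y i = x1 i" by (auto simp: tower_def)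
  have ye: "y m = e'" "y (Suc m) = e" "\<And>i. i \<ge> n \<Longrightarrow> y i = x i"
    using yt m by (auto simp: x1_def)
  have "vert y (Suc m) = k - (d - 1) + (d - 1)" by (simp add: vert_Suc ym ye(1) e'_def)
  hence yv1: "vert y (Suc m) = k" using k(2) by simp
  have "vert y (Suc (Suc m)) = k" unfolding vert_Suc[of y "Suc m"] yv1 ye(2) by (simp add: e_def)
  hence yv: "vert y (Suc m) = k" "vert y n = k" using yv1 m(1) by simp_all
  obtain u where u: "u \<in> cls a d m y" "below a d m u = {}" using ex_cls_min[OF yX] by blast
  have uX: "u \<in> Xp a d" using u cls_Xp by blast
  have uy: "u \<in> cls a d (Suc m) y" using subsetD[OF cls_mono u(1), of "Suc m"] by simp
  obtain w where w: "w \<in> cls a d (Suc m) y" "below a d (Suc m) w = {}" using ex_cls_min[OF yX] by blast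
  have wX: "w \<in> Xp a d" using w cls_Xp by blast
  have uw: "u \<in> cls a d (Suc m) w" using uy cls_eq[OF w(1)] by simp
  have uv: "vert u (Suc m) = k" "u m = e'" using uy u(1) yv(1) ye(1) by (simp_all add: cls_def tower_def)
  have wv: "vert w (Suc m) = k" "w (Suc m) = e" using w(1) yv(1) ye(2) by (simp_all add: cls_def tower_def)
  have wn: "w \<in> cls a d n x"
  proof -
    have "w \<in> cls a d n y" using subsetD[OF cls_mono w(1), of n] m(1) by simp
    thus ?thesis unfolding cls_def tower_def yv(2) k(1)[symmetric] using ye(3) by auto
  qed
  have "adic_less x w"
    unfolding adic_less_iff
  proof (intro exI[of _ "Suc m"] conjI allI impI)
    show "edge_prec (x (Suc m)) (w (Suc m))" using xe wv(2) d m(1) by (simp add: edge_prec_def e_def)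
    show "x j = w j" if "Suc m < j" for j using wn that m(1) by (simp add: cls_def tower_def)
    show "vert x (Suc (Suc m)) = vert w (Suc (Suc m))" using wn m(1) by (simp add: cls_def tower_def)
  qed
  hence le: "pos a d n x \<le> pos a d n w" using pos_mono[OF cls_self[OF x] wn] by simp
  define j where "j = pos a d n w - pos a d n x"
  have Tj: "(Tp a d ^^ j) x = w" unfolding j_def by (rule Tp_pow_hit[OF x wn le])
  define i where "i = pos a d (Suc m) u"
  define h where "h = card (cls a d (Suc m) w)"
  have h: "real h = Gs a d (\<lambda>_. 1) (Suc m) k" unfolding h_def using card_cls_eq_Gs[of w a d, OF wX a0] wv by simp
  have ih: "i < h" unfolding i_def h_def using pos_less[OF uX, of "Suc m"] cls_eq[OF uw] by simp
  have Ti: "(Tp a d ^^ i) w = u"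
    using Tp_pow_hit[OF wX uw] w(2) by (simp add: i_def)
  have FsU: "Fs a d (Suc m) f u = real (a d) * Gs a d f m (k - d)" if f: "cylindric a d N f" for f
  proof -
    have "Fs a d (Suc m) f u = (\<Sum>e\<in>{e \<in> edges a d. edge_prec e e'}. if fst e \<le> k then Gs a d f m (k - fst e) else 0)"
      unfolding Fs_Suc[OF f m(2) uX a0] uv using u(2) by (simp add: Fs_def)
    also have "{e \<in> edges a d. edge_prec e e'} = {d} \<times> {..<a d}"
    proof -
      have "edge_prec e e' \<longleftrightarrow> fst e = d" if "e \<in> edges a d" for e
        using that d by (cases e) (auto simp: e'_def edge_prec_def in_edges)
      thus ?thesis by (auto simp: in_edges)
    qed
    also have "(\<Sum>e\<in>{d} \<times> {..<a d}. if fst e \<le> k then Gs a d f m (k - fst e) else 0) = (\<Sum>e\<in>{d} \<times> {..<a d}. Gs a d f m (k - d))"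
      using k by (intro sum.cong) auto
    also have "\<dots> = real (a d) * Gs a d f m (k - d)" by simp
    finally show ?thesis .
  qed
  have i: "real i = real (a d) * Gs a d (\<lambda>_. 1) m (k - d)"
    unfolding i_def pos_eq_Fs by (rule FsU[OF cylindric_const])
  have "below a d n w \<inter> cls a d (Suc m) w = {}"
    using w(2) by (auto simp: below_def)
  moreover have "below a d n w \<union> cls a d (Suc m) w \<subseteq> cls a d n x"
  proof -
    have "cls a d (Suc m) w \<subseteq> cls a d n w" by (rule cls_mono) (simp add: m(1))
    thus ?thesis using cls_eq[OF wn] by (auto simp: below_def)
  qed
  ultimately have "pos a d n w + h \<le> card (cls a d n x)"
    unfolding h_def by (subst card_Un_disjoint[symmetric]) (auto intro: card_mono)
  hence fits: "pos a d n x + j + h \<le> card (cls a d n x)" using le by (simp add: j_def)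
  have S1: "Sg a d g x (j + i) - Sg a d g x j = real (a d) * Gs a d g m (k - d)"
  proof -
    have "pos a d (Suc m) w + i < card (cls a d (Suc m) w)" using ih w(2) by (simp add: h_def)
    from Tp_pow_cls[OF wX this, of g] have "Sg a d g w i = Fs a d (Suc m) g u" using Ti w(2) by (simp add: Fs_def)
    thus ?thesis using Sg_add[of a d g x j i] Tj FsU[OF g] by simp
  qed
  have S2: "Sg a d g x (j + h) - Sg a d g x j = Gs a d g (Suc m) k"
  proof -
    have "Sg a d g w h = (\<Sum>y\<in>cls a d (Suc m) w. g y)"
      using Sg_to_top[OF wX, of "Suc m" g] w(2) by (simp add: Fs_def h_def)
    also have "\<dots> = Gs a d g (Suc m) k" using cls_sum_eq_Gs[OF g _ wX a0, of "Suc m"] m wv by simp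
    finally show ?thesis using Sg_add[of a d g x j h] Tj by simp
  qed
  have "n - 2 = m" "n - 1 = Suc m" using m by auto
  thus ?thesis using i h ih fits S1 S2 by (intro exI[of _ j] exI[of _ i] exI[of _ h]) auto
qed

section \<open>Discrepancy bounds for cylindric functions\<close>

text \<open>\<open>weights\<close> is the defining equation of t divided by q ^ (d - 1), with t = q
  * z: the edge probabilities q * z ^ j sum to 1.\<close>

locale adic_system =
  fixes a :: "nat \<Rightarrow> nat" and d :: nat and q z :: real
  assumes d1: "d \<ge> 1" and apos: "j \<le> d \<Longrightarrow> 0 < a j" and q0: "0 < q" and z0: "0 < z"
    and weights: "(\<Sum>j\<le>d. real (a j) * q * z ^ j) = 1"
begin

abbreviation P :: "real poly" where "P \<equiv> Ppoly a d q z"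

lemma a0: "0 < a 0" using apos by simp

lemma deg_P: "degree P \<le> d"
  by (rule degree_le) (simp add: coeff_Ppoly)

sublocale lattice_law P
proof
  show "coeff P j \<ge> 0" for j using q0 z0 by (simp add: coeff_Ppoly)
  show "coeff P 0 > 0" using q0 z0 apos[of 0] by (simp add: coeff_Ppoly)
  show "coeff P 1 > 0" using q0 z0 apos[of 1] d1 by (simp add: coeff_Ppoly)
  show "poly P 1 = 1" using weights by (simp add: Ppoly_def poly_sum poly_monom)
qed

text \<open>The largest edge probability q * z ^ j, as z ^ j is monotone in j. It is below 1 because
  edges of types 0 and d both have positive probability.\<close>

definition theta :: real where "theta = q * max 1 (z ^ d)"

lemma theta: "0 < theta" "theta < 1"
proof -
  show "0 < theta" using q0 z0 by (simp add: theta_def)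
  have "(\<Sum>j\<in>{0, d}. real (a j) * q * z ^ j) \<le> 1"
    unfolding weights[symmetric] using q0 z0 by (intro sum_mono2) auto
  hence s: "real (a 0) * q + real (a d) * q * z ^ d \<le> 1" using d1 by simp
  have "1 * q \<le> real (a 0) * q" "1 * (q * z ^ d) \<le> real (a d) * (q * z ^ d)"
    using q0 z0 apos[of 0] apos[of d] by (intro mult_right_mono; simp)+
  hence "q + q * z ^ d \<le> 1" using s by simp
  moreover have "0 < q * z ^ d" using q0 z0 by simp
  ultimately have "q < 1" "q * z ^ d < 1" using q0 by linarith+
  thus "theta < 1" by (simp add: theta_def max_def)
qed

lemma weight_le_theta:
  assumes "i \<le> d * m"
  shows "q ^ m * z ^ i \<le> theta ^ m"
proof -
  have "z ^ i \<le> max 1 (z ^ d) ^ m"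
  proof (cases "z \<le> 1")
    case True
    hence "z ^ i \<le> 1" using z0 by (intro power_le_one) auto
    also have "1 \<le> max 1 (z ^ d) ^ m" by (intro one_le_power) simp
    finally show ?thesis .
  next
    case False
    hence "z ^ i \<le> z ^ (d * m)" using assms by (intro power_increasing) auto
    also have "\<dots> = (z ^ d) ^ m" by (simp add: power_mult)
    also have "\<dots> \<le> max 1 (z ^ d) ^ m" using z0 by (intro power_mono) auto
    finally show ?thesis .
  qed
  thus ?thesis using q0 by (simp add: theta_def power_mult_distrib)
qed

definition wt :: "nat \<Rightarrow> nat \<Rightarrow> real" where "wt n k = q ^ n * z ^ k"

lemma wt_pos: "wt n k > 0"
  using q0 z0 by (simp add: wt_def)

lemma wt_step: "k' \<le> k \<Longrightarrow> k \<le> k' + d * m \<Longrightarrow> wt (j + m) k \<le> wt j k' * theta ^ m"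
proof -
  assume h: "k' \<le> k" "k \<le> k' + d * m"
  have "wt (j + m) k = wt j k' * (q ^ m * z ^ (k - k'))"
    using h(1) by (simp add: wt_def power_add flip: power_add[of z k' "k - k'"])
  also have "\<dots> \<le> wt j k' * theta ^ m"
    using weight_le_theta[of "k - k'" m] h wt_pos[of j k'] by (intro mult_left_mono) auto
  finally show ?thesis .
qed

definition Hs :: "nat \<Rightarrow> nat \<Rightarrow> real" where "Hs = Gs a d (\<lambda>_. 1)"

lemma coeff_P_power: "coeff (P ^ n) k = wt n k * Hs n k"
  using Gpoly_one[of a d q z n] a0 coeff_Gpoly[of a d q z "\<lambda>_. 1" n k] by (simp add: wt_def Hs_def)

end

text \<open>\<open>E1\<close> makes r + 1 the exact order of the zero at 1. Such a factorisation
  exists when c is the value of \<open>Gpoly\<close> at 1 and the left side of \<open>factor\<close>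
  is not zero.\<close>

locale adic_function = adic_system +
  fixes N :: nat and g :: "(nat \<Rightarrow> nat \<times> nat) \<Rightarrow> real" and c :: real and r :: nat and E :: "real poly"
  assumes cyl: "cylindric a d N g"
    and factor: "Gpoly a d q z g N - smult c (P ^ N) = [:1, -1:] ^ Suc r * E"
    and E1: "poly E 1 \<noteq> 0"
begin

text \<open>From level N on, the weighted discrepancy of the tower of (n, k) with respect to the
  global average c, by \<open>Dh_eq\<close>.\<close>

definition Dh :: "nat \<Rightarrow> nat \<Rightarrow> real" where
  "Dh n k = coeff (P ^ (n - N) * ([:1, -1:] ^ Suc r * E)) k"

lemma Dh_eq:
  assumes "n \<ge> N"
  shows "Dh n k = wt n k * (Gs a d g n k - c * Hs n k)"
proof -
  have "P ^ (n - N) * ([:1, -1:] ^ Suc r * E) = Gpoly a d q z g n - smult c (P ^ n)"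
    unfolding factor[symmetric] Gpoly_eq[OF cyl assms a0]
    using assms by (simp add: algebra_simps flip: power_add)
  thus ?thesis unfolding Dh_def
    by (simp only: coeff_diff coeff_smult coeff_Gpoly coeff_P_power wt_def) (simp add: algebra_simps)
qed

lemma Gs_eq:
  assumes "n \<ge> N"
  shows "Gs a d g n k = Dh n k / wt n k + c * Hs n k"
  using Dh_eq[OF assms, of k] wt_pos[of n k] by simp

definition Ph :: "nat \<Rightarrow> nat \<Rightarrow> real" where "Ph n k = coeff (P ^ n) k"

lemma Hs_eq: "Hs n k = Ph n k / wt n k"
  using coeff_P_power[of n k] wt_pos[of n k] by (simp add: Ph_def)

lemma Dh_multistep:
  "\<exists>C>0. \<forall>j m k k'. N \<le> j \<longrightarrow> k' \<le> k \<longrightarrow> k \<le> k' + d * m \<longrightarrow>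
     \<bar>Dh j k' - Dh (j + m) k\<bar> \<le> C * real m / sqrt (real (Suc (j - N))) ^ (r + 3)"
proof -
  obtain C where C: "C > 0" "\<And>m j k k'. k' \<le> k \<Longrightarrow> k \<le> k' + d * m \<Longrightarrow>
     \<bar>coeff (P ^ j * ([:1, -1:] ^ Suc r * E)) k' - coeff (P ^ (j + m) * ([:1, -1:] ^ Suc r * E)) k\<bar>
      \<le> C * real m / sqrt (real (Suc j)) ^ Suc (Suc (Suc r))"
    using multistep_bound[of d "Suc r" E] by blast
  have "\<bar>Dh j k' - Dh (j + m) k\<bar> \<le> C * real m / sqrt (real (Suc (j - N))) ^ (r + 3)"
    if "N \<le> j" "k' \<le> k" "k \<le> k' + d * m" for j m k k'
    using C(2)[OF that(2,3), of "j - N"] that(1) unfolding Dh_def by (simp add: eval_nat_numeral)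
  thus ?thesis using C(1) by blast
qed

lemma Ph_multistep:
  "\<exists>C>0. \<forall>j m k k'. k' \<le> k \<longrightarrow> k \<le> k' + d * m \<longrightarrow>
     \<bar>Ph j k' - Ph (j + m) k\<bar> \<le> C * real m / sqrt (real (Suc j)) ^ 2"
  using multistep_bound[of d 0 1] by (simp add: Ph_def eval_nat_numeral) blast

lemma Dh_bound: "\<exists>C>0. \<forall>n k. \<bar>Dh n k\<bar> \<le> C / sqrt (real (Suc (n - N))) ^ (r + 2)"
  using coeff_bound[of "Suc r" E] unfolding Dh_def by (auto simp: eval_nat_numeral)

definition rho :: "nat \<Rightarrow> nat \<Rightarrow> real" where
  "rho n k = 1 / (wt n k * sqrt (real n) ^ (r + 3))"

text \<open>Size, in units of rho, of the centred sum over a subtower m levels down: theta ^ m from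
  the path weight and a polynomial loss for replacing level n - m by n. The exponent r + 5 is (r +
  2) + 3 from the second term in \<open>centered_Dh_bound\<close>.\<close>

definition bb :: "nat \<Rightarrow> real" where "bb m = theta ^ m * real (m + N + 1) ^ (r + 5)"

definition slope :: "nat \<Rightarrow> nat \<Rightarrow> real" where "slope n k = Gs a d g n k / Hs n k"

lemma bb_nonneg: "bb m \<ge> 0"
  using theta by (simp add: bb_def)

lemma summable_bb: "summable bb"
proof (rule summable_comparison_test_bigo)
  show "summable (\<lambda>m. norm (sqrt theta ^ m))" using theta by (simp add: norm_power summable_geometric)
  have "bb \<in> O(\<lambda>m. (sqrt theta) ^ m)" unfolding bb_def using theta
  proof -
    have th: "0 < theta" "theta < 1" by (rule theta)+
    have "(\<lambda>m. (theta powr real m) * real (m + N + 1) ^ (r + 5)) \<in> O(\<lambda>m. (theta powr (real m / 2)))"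
      using th by real_asymp
    moreover have "theta powr (real m / 2) = sqrt theta ^ m" for m
      using th by (simp add: powr_half_sqrt[symmetric] powr_powr flip: powr_realpow)
    ultimately show "(\<lambda>m. theta ^ m * real (m + N + 1) ^ (r + 5)) \<in> O(\<lambda>m. sqrt theta ^ m)"
      using th by (simp add: powr_realpow)
  qed
  thus "bb \<in> O(\<lambda>m. sqrt theta ^ m)" .
qed

definition tail :: "nat \<Rightarrow> real" where "tail M = (\<Sum>m. bb (m + M))"

lemma tail_tendsto: "tail \<longlonglongrightarrow> 0"
  unfolding tail_def by (rule suminf_exist_split2[OF summable_bb])

lemma tail_ge:
  assumes "finite A" "\<And>m. m \<in> A \<Longrightarrow> m \<ge> M"
  shows "(\<Sum>m\<in>A. bb m) \<le> tail M"
proof -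
  have "(\<Sum>m\<in>A. bb m) = (\<Sum>m\<in>(\<lambda>m. m - M) ` A. bb (m + M))"
    using assms by (subst sum.reindex) (auto intro!: inj_onI sum.cong simp: eq_diff_iff)
  also have "\<dots> \<le> tail M" unfolding tail_def
    using assms bb_nonneg summable_ignore_initial_segment[OF summable_bb, of M] by (intro sum_le_suminf) auto
  finally show ?thesis .
qed

lemma inv_sqrt_le:
  assumes "x \<le> l * y" "1 \<le> l" "0 < x" "0 < y"
  shows "1 / sqrt y ^ e \<le> l ^ e / sqrt x ^ e"
proof -
  have "sqrt x ^ e \<le> (l * sqrt y) ^ e"
  proof (rule power_mono)
    have "sqrt x \<le> sqrt (l * y)" using assms by simp
    also have "\<dots> = sqrt l * sqrt y" by (simp add: real_sqrt_mult)
    also have "\<dots> \<le> l * sqrt y"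
      using assms real_sqrt_le_mono[of l "l * l"] by (intro mult_right_mono) auto
    finally show "sqrt x \<le> l * sqrt y" .
  qed (use assms in auto)
  thus ?thesis using assms by (simp add: field_simps power_mult_distrib)
qed

text \<open>With n = j + m the expression is (Dh j k' - Dh n k) - Dh n k / Ph n k * (Ph j k' - Ph n
  k), so only increments occur. In powers of 1 / sqrt n the orders are r + 3 and (r + 1) + 2; the
  lower bound on \<open>Ph\<close> controls the quotient.\<close>

lemma centered_Dh_bound:
  assumes dl: "\<delta> > 0"
  shows "\<exists>C>0. \<forall>j m k k'. N \<le> j \<longrightarrow> 0 < j + m \<longrightarrow> k' \<le> k \<longrightarrow> k \<le> k' + d * m \<longrightarrow> Ph (j + m) k \<ge> \<delta> / sqrt (real (j + m)) \<longrightarrow>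
     \<bar>Dh j k' - Dh (j + m) k / Ph (j + m) k * Ph j k'\<bar> \<le> C * real (m + N + 1) ^ (r + 5) / sqrt (real (j + m)) ^ (r + 3)"
proof -
  obtain C1 where C1: "C1 > 0" "\<And>j m k k'. N \<le> j \<Longrightarrow> k' \<le> k \<Longrightarrow> k \<le> k' + d * m \<Longrightarrow>
     \<bar>Dh j k' - Dh (j + m) k\<bar> \<le> C1 * real m / sqrt (real (Suc (j - N))) ^ (r + 3)" using Dh_multistep by blast
  obtain C2 where C2: "C2 > 0" "\<And>j m k k'. k' \<le> k \<Longrightarrow> k \<le> k' + d * m \<Longrightarrow>
     \<bar>Ph j k' - Ph (j + m) k\<bar> \<le> C2 * real m / sqrt (real (Suc j)) ^ 2" using Ph_multistep by blast
  obtain C3 where C3: "C3 > 0" "\<And>n k. \<bar>Dh n k\<bar> \<le> C3 / sqrt (real (Suc (n - N))) ^ (r + 2)" using Dh_bound by blast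
  have "\<bar>Dh j k' - Dh (j + m) k / Ph (j + m) k * Ph j k'\<bar>
      \<le> (C1 + C3 * C2 / \<delta>) * real (m + N + 1) ^ (r + 5) / sqrt (real (j + m)) ^ (r + 3)"
    if h: "N \<le> j" "0 < j + m" "k' \<le> k" "k \<le> k' + d * m" "Ph (j + m) k \<ge> \<delta> / sqrt (real (j + m))" for j m k k'
  proof -
    define n where "n = j + m"
    define L where "L = real (m + N + 1)"
    define S where "S = sqrt (real n)"
    have L1: "1 \<le> L" by (simp add: L_def)
    have mL: "real m \<le> L" by (simp add: L_def)
    have S: "S > 0" using h(2) unfolding S_def n_def real_sqrt_gt_0_iff of_nat_0_less_iff .
    have p: "Ph n k \<ge> \<delta> / S" using h by (simp add: S_def n_def)
    have p0: "Ph n k > 0" using p dl S by (smt (verit) divide_pos_pos)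
    \<comment> \<open>j may be as small as N, so n and j - N are not comparable by a fixed constant;
      the factor m + N + 1 pays for this and ends up in \<open>bb\<close>.\<close>
    have nL1: "real n \<le> L * real (Suc (j - N))"
    proof -
      have "n \<le> (j - N) + (m + N)" using h by (simp add: n_def)
      also have "\<dots> \<le> (m + N + 1) * Suc (j - N)" by simp
      finally show ?thesis unfolding L_def of_nat_mult[symmetric] of_nat_le_iff .
    qed
    have nL2: "real n \<le> L * real (Suc j)" using nL1 h L1 by (smt (verit, best) Suc_le_mono diff_le_self mult_left_mono of_nat_mono)
    have nL3: "real n \<le> L * real (Suc (n - N))" using nL1 h L1 by (smt (verit, best) Suc_le_mono diff_le_mono le_add1 mult_left_mono n_def of_nat_mono)
    have n0: "real n > 0" using h(2) unfolding n_def of_nat_0_less_iff .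
    have b1: "\<bar>Dh j k' - Dh n k\<bar> \<le> C1 * L ^ (r + 5) / S ^ (r + 3)"
    proof -
      have "\<bar>Dh j k' - Dh n k\<bar> \<le> C1 * real m * (1 / sqrt (real (Suc (j - N))) ^ (r + 3))"
        using C1(2)[OF h(1,3,4)] by (simp add: n_def)
      also have "\<dots> \<le> C1 * L * (L ^ (r + 3) / S ^ (r + 3))"
        unfolding S_def using C1(1) mL L1 by (intro mult_mono inv_sqrt_le nL1 n0) auto
      also have "\<dots> = C1 * L ^ (r + 4) / S ^ (r + 3)" by (simp add: eval_nat_numeral)
      also have "\<dots> \<le> C1 * L ^ (r + 5) / S ^ (r + 3)"
        using C1(1) L1 S by (intro divide_right_mono mult_left_mono power_increasing) auto
      finally show ?thesis .
    qed
    have b2: "\<bar>Ph j k' - Ph n k\<bar> \<le> C2 * L ^ 3 / S ^ 2"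
    proof -
      have "\<bar>Ph j k' - Ph n k\<bar> \<le> C2 * real m * (1 / sqrt (real (Suc j)) ^ 2)"
        using C2(2)[OF h(3,4), of j] by (simp add: n_def)
      also have "\<dots> \<le> C2 * L * (L ^ 2 / S ^ 2)"
        unfolding S_def using C2(1) mL L1 by (intro mult_mono inv_sqrt_le nL2 n0) auto
      finally show ?thesis by (simp add: eval_nat_numeral)
    qed
    have b3: "\<bar>Dh n k / Ph n k\<bar> \<le> C3 / \<delta> * L ^ (r + 2) / S ^ (r + 1)"
    proof -
      have "\<bar>Dh n k\<bar> \<le> C3 * (1 / sqrt (real (Suc (n - N))) ^ (r + 2))" using C3(2)[of n k] by simp
      also have "\<dots> \<le> C3 * (L ^ (r + 2) / S ^ (r + 2))"
        unfolding S_def using C3(1) L1 by (intro mult_left_mono inv_sqrt_le nL3 n0) auto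
      finally have "\<bar>Dh n k / Ph n k\<bar> \<le> (C3 * (L ^ (r + 2) / S ^ (r + 2))) / (\<delta> / S)"
        unfolding abs_divide using p p0 dl S C3(1) L1 by (intro frac_le) auto
      also have "\<dots> = C3 / \<delta> * L ^ (r + 2) / S ^ (r + 1)" using S dl by (simp add: field_simps)
      finally show ?thesis .
    qed
    have "Dh j k' - Dh n k / Ph n k * Ph j k' = (Dh j k' - Dh n k) - (Dh n k / Ph n k) * (Ph j k' - Ph n k)"
      using p0 by (simp add: field_simps)
    also have "\<bar>\<dots>\<bar> \<le> \<bar>Dh j k' - Dh n k\<bar> + \<bar>Dh n k / Ph n k\<bar> * \<bar>Ph j k' - Ph n k\<bar>"
      by (metis abs_mult abs_triangle_ineq4)
    also have "\<dots> \<le> C1 * L ^ (r + 5) / S ^ (r + 3) + (C3 / \<delta> * L ^ (r + 2) / S ^ (r + 1)) * (C2 * L ^ 3 / S ^ 2)"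
      using b1 b2 b3 dl C3(1) L1 S by (intro add_mono mult_mono) auto
    also have "\<dots> = (C1 + C3 * C2 / \<delta>) * L ^ (r + 5) / S ^ (r + 3)"
      using S dl by (simp add: field_simps power_add eval_nat_numeral)
    finally show ?thesis by (simp add: n_def L_def S_def)
  qed
  moreover have "C1 + C3 * C2 / \<delta> > 0" using C1(1) C2(1) C3(1) dl by (intro add_pos_pos divide_pos_pos mult_pos_pos)
  ultimately show ?thesis by (intro exI[of _ "C1 + C3 * C2 / \<delta>"]) simp
qed

lemma g_bounded: "\<exists>B>0. \<forall>x\<in>Xp a d. \<bar>g x\<bar> \<le> B"
proof -
  define S where "S = (\<Union>k\<le>d * N. tower a d N k (\<lambda>_. (0, 0)))"
  have fin: "finite S" by (simp add: S_def)
  have "\<bar>g x\<bar> \<le> 1 + (\<Sum>y\<in>S. \<bar>g y\<bar>)" if x: "x \<in> Xp a d" for x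
  proof -
    define y where "y = (\<lambda>i. if i < N then x i else (0, 0))"
    have yX: "y \<in> Xp a d" using x const_path_Xp[of a d, OF a0] by (simp add: y_def Xp_iff)
    have "\<forall>i<N. x i = y i" by (simp add: y_def)
    hence "g x = g y" using cyl x yX unfolding cylindric_def by blast
    moreover have "y \<in> S" using yX vert_le[OF yX, of N] by (auto simp: S_def tower_def y_def)
    hence "\<bar>g y\<bar> \<le> (\<Sum>y\<in>S. \<bar>g y\<bar>)" using fin by (intro member_le_sum) auto
    ultimately show ?thesis by simp
  qed
  moreover have "1 + (\<Sum>y\<in>S. \<bar>g y\<bar>) > 0" by (simp add: add_pos_nonneg sum_nonneg)
  ultimately show ?thesis by blast
qed

lemma Hs_nonneg: "Hs n k \<ge> 0"
  by (simp add: Hs_def Gs_def)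

lemma slope_bound:
  assumes B: "\<And>x. x \<in> Xp a d \<Longrightarrow> \<bar>g x\<bar> \<le> B" and B0: "B > 0"
  shows "\<bar>slope n k\<bar> \<le> B"
proof -
  have "\<bar>Gs a d g n k\<bar> \<le> (\<Sum>y\<in>tower a d n k (\<lambda>_. (0, 0)). \<bar>g y\<bar>)" unfolding Gs_def by (rule sum_abs)
  also have "\<dots> \<le> (\<Sum>y\<in>tower a d n k (\<lambda>_. (0, 0)). B * 1)"
    using B by (intro sum_mono) (auto simp: tower_def)
  also have "\<dots> = B * Hs n k" by (simp add: Hs_def Gs_def)
  finally show ?thesis using Hs_nonneg[of n k] B0
    by (cases "Hs n k = 0") (auto simp: slope_def abs_divide field_simps)
qed

lemma Gs_centered: "Gs a d (\<lambda>x. g x - s) n k = Gs a d g n k - s * Hs n k"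
  using Gs_diff[of a d g s "\<lambda>_. 1" n k] by (simp add: Hs_def)

lemma Gs_centered_bound:
  assumes dl: "\<delta> > 0"
  shows "\<exists>C>0. \<forall>j m k k'. N \<le> j \<longrightarrow> 0 < j + m \<longrightarrow> k' \<le> k \<longrightarrow> k \<le> k' + d * m \<longrightarrow> Ph (j + m) k \<ge> \<delta> / sqrt (real (j + m)) \<longrightarrow>
     \<bar>Gs a d (\<lambda>x. g x - slope (j + m) k) j k'\<bar> \<le> C * bb m * rho (j + m) k"
proof -
  obtain C where C: "C > 0" "\<And>j m k k'. N \<le> j \<Longrightarrow> 0 < j + m \<Longrightarrow> k' \<le> k \<Longrightarrow> k \<le> k' + d * m \<Longrightarrow> Ph (j + m) k \<ge> \<delta> / sqrt (real (j + m)) \<Longrightarrow>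
     \<bar>Dh j k' - Dh (j + m) k / Ph (j + m) k * Ph j k'\<bar> \<le> C * real (m + N + 1) ^ (r + 5) / sqrt (real (j + m)) ^ (r + 3)"
    using centered_Dh_bound[OF dl] by blast
  have "\<bar>Gs a d (\<lambda>x. g x - slope (j + m) k) j k'\<bar> \<le> C * bb m * rho (j + m) k"
    if h: "N \<le> j" "0 < j + m" "k' \<le> k" "k \<le> k' + d * m" "Ph (j + m) k \<ge> \<delta> / sqrt (real (j + m))" for j m k k'
  proof -
    define n where "n = j + m"
    have n: "n \<ge> N" "n > 0" using h by (auto simp: n_def)
    have "\<delta> / sqrt (real n) > 0" using dl n by simp
    hence p0: "Ph n k > 0" using h(5) unfolding n_def by linarith
    have w: "wt n k > 0" "wt j k' > 0" by (rule wt_pos)+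
    have sl: "slope n k = Dh n k / Ph n k + c"
      unfolding slope_def Gs_eq[OF n(1)] Hs_eq using w p0 by (simp add: field_simps)
    have "Gs a d (\<lambda>x. g x - slope n k) j k' = (Dh j k' - Dh n k / Ph n k * Ph j k') / wt j k'"
      unfolding Gs_centered Gs_eq[OF h(1)] sl Hs_eq using w by (simp add: field_simps)
    hence "\<bar>Gs a d (\<lambda>x. g x - slope n k) j k'\<bar> = \<bar>Dh j k' - Dh n k / Ph n k * Ph j k'\<bar> * (1 / wt j k')"
      using w by (simp add: abs_divide)
    also have "\<dots> \<le> (C * real (m + N + 1) ^ (r + 5) / sqrt (real n) ^ (r + 3)) * (theta ^ m / wt n k)"
    proof (rule mult_mono)
      show "\<bar>Dh j k' - Dh n k / Ph n k * Ph j k'\<bar> \<le> C * real (m + N + 1) ^ (r + 5) / sqrt (real n) ^ (r + 3)"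
        using C(2)[OF h] by (simp add: n_def)
      show "1 / wt j k' \<le> theta ^ m / wt n k"
        using wt_step[OF h(3,4), of j] w by (simp add: field_simps n_def)
    qed (use C(1) w in auto)
    also have "\<dots> = C * bb m * rho n k" by (simp add: bb_def rho_def mult_ac)
    finally show ?thesis by (simp add: n_def)
  qed
  thus ?thesis using C(1) by (intro exI[of _ C]) simp
qed

lemma rho_pos: "n > 0 \<Longrightarrow> rho n k > 0"
  using wt_pos by (simp add: rho_def)

text \<open>Lets the bounded contribution of level N be absorbed into \<open>tail\<close> times
  \<open>rho\<close>.\<close>

lemma bb_rho_ge_1:
  assumes "n > 0" "k \<le> d * n"
  shows "bb n * rho n k \<ge> 1"
proof -
  have "wt n k \<le> theta ^ n" using wt_step[of 0 k n 0] assms by (simp add: wt_def)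
  moreover have "sqrt (real n) ^ (r + 3) \<le> real (n + N + 1) ^ (r + 5)"
  proof -
    have "sqrt (real n) \<le> sqrt (real n * real n)" using assms by (intro real_sqrt_le_mono) simp
    hence "sqrt (real n) ^ (r + 3) \<le> real (n + N + 1) ^ (r + 3)" by (intro power_mono) auto
    also have "\<dots> \<le> real (n + N + 1) ^ (r + 5)" by (intro power_increasing) auto
    finally show ?thesis .
  qed
  ultimately have "wt n k * sqrt (real n) ^ (r + 3) \<le> bb n"
    unfolding bb_def using theta by (intro mult_mono) auto
  thus ?thesis using wt_pos[of n k] assms by (simp add: rho_def)
qed

text \<open>By \<open>Fs_Suc\<close> the paths below y form complete subtowers at levels N, ..., j0
  - 1, boundedly many at each, plus a bounded remainder at level N. Those of level j lie n - j
  levels down, so their sizes add up to a tail of the series of \<open>bb\<close>.\<close>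

lemma Fs_bound:
  assumes dl: "\<delta> > 0"
  shows "\<exists>C>0. \<forall>n j0 y. N \<le> j0 \<longrightarrow> j0 \<le> n \<longrightarrow> 0 < n \<longrightarrow> y \<in> Xp a d \<longrightarrow> Ph n (vert y n) \<ge> \<delta> / sqrt (real n) \<longrightarrow>
     \<bar>Fs a d j0 (\<lambda>x. g x - slope n (vert y n)) y\<bar> \<le> C * tail (n - j0) * rho n (vert y n)"
proof -
  obtain C where C: "C > 0" "\<And>j m k k'. N \<le> j \<Longrightarrow> 0 < j + m \<Longrightarrow> k' \<le> k \<Longrightarrow> k \<le> k' + d * m \<Longrightarrow> Ph (j + m) k \<ge> \<delta> / sqrt (real (j + m)) \<Longrightarrow>
     \<bar>Gs a d (\<lambda>x. g x - slope (j + m) k) j k'\<bar> \<le> C * bb m * rho (j + m) k"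
    using Gs_centered_bound[OF dl] by blast
  obtain B where B: "B > 0" "\<And>x. x \<in> Xp a d \<Longrightarrow> \<bar>g x\<bar> \<le> B" using g_bounded by blast
  define K where "K = real (card (edges a d))"
  \<comment> \<open>Both \<open>g\<close> and its tower averages are bounded by B, so the centred
    function is bounded by 2 * B; the sum dominates the height of any level-N tower.\<close>
  define C6 where "C6 = 2 * B * (\<Sum>k\<le>d * N. Hs N k)"
  have C60: "C6 \<ge> 0" using B Hs_nonneg by (simp add: C6_def sum_nonneg)
  have "\<bar>Fs a d j0 (\<lambda>x. g x - slope n (vert y n)) y\<bar> \<le> (C6 + K * C + 1) * tail (n - j0) * rho n (vert y n)"
    if h: "N \<le> j0" "j0 \<le> n" "0 < n" "y \<in> Xp a d" "Ph n (vert y n) \<ge> \<delta> / sqrt (real n)" for n j0 y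
  proof -
    define k where "k = vert y n"
    define f where "f = (\<lambda>x. g x - slope n k)"
    have f: "cylindric a d N f" unfolding f_def by (rule cylindric_diff_const[OF cyl])
    have rho0: "rho n k > 0" by (rule rho_pos[OF h(3)])
    have fb: "\<bar>f x\<bar> \<le> 2 * B" if "x \<in> Xp a d" for x
      using B(2)[OF that] slope_bound[OF B(2) B(1), of n k] unfolding f_def by linarith
    have base: "\<bar>Fs a d N f y\<bar> \<le> C6"
    proof -
      have "\<bar>Fs a d N f y\<bar> \<le> (\<Sum>w\<in>below a d N y. \<bar>f w\<bar>)" unfolding Fs_def by (rule sum_abs)
      also have "\<dots> \<le> (\<Sum>w\<in>below a d N y. 2 * B)"
        using fb cls_Xp by (intro sum_mono) (auto simp: below_def)
      also have "\<dots> = 2 * B * real (pos a d N y)" by simp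
      also have "\<dots> \<le> 2 * B * Hs N (vert y N)"
        using pos_less[OF h(4), of N] card_cls_eq_Gs[of y a d N, OF h(4) a0] B(1)
        by (intro mult_left_mono) (auto simp: Hs_def)
      also have "\<dots> \<le> C6" unfolding C6_def using B(1) vert_le[OF h(4), of N] Hs_nonneg
        by (intro mult_left_mono member_le_sum) auto
      finally show ?thesis .
    qed
    have step: "\<bar>Fs a d i f y\<bar> \<le> C6 + (\<Sum>j=N..<i. K * (C * bb (n - j) * rho n k))" if "N \<le> i" "i \<le> n" for i
      using that
    proof (induction i rule: dec_induct)
      case base
      thus ?case using \<open>\<bar>Fs a d N f y\<bar> \<le> C6\<close> by simp
    next
      case (step j)
      let ?E = "{e \<in> edges a d. edge_prec e (y j)}"
      let ?t = "\<lambda>e. if fst e \<le> vert y (Suc j) then Gs a d f j (vert y (Suc j) - fst e) else 0"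
      have nn: "0 \<le> C * bb (n - j) * rho n k" using C(1) bb_nonneg rho0 by (simp add: less_imp_le)
      have t: "\<bar>?t e\<bar> \<le> C * bb (n - j) * rho n k" if e: "e \<in> edges a d" for e
      proof (cases "fst e \<le> vert y (Suc j)")
        case True
        have v: "vert y n = vert y (Suc j) + (\<Sum>i=Suc j..<n. fst (y i))"
          using step by (intro vert_add_tail) auto
        have "(\<Sum>i=Suc j..<n. fst (y i)) \<le> (\<Sum>i=Suc j..<n. d)" using h(4) by (intro sum_mono) (auto simp: Xp_def)
        moreover have "fst e \<le> d" using e by (simp add: in_edges)
        moreover have "d * (n - j) = d + d * (n - Suc j)" using step by (simp flip: mult_Suc_right add: Suc_diff_Suc)
        ultimately have 1: "vert y (Suc j) - fst e \<le> k" "k \<le> vert y (Suc j) - fst e + d * (n - j)"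
          using v True unfolding k_def by (auto simp: mult.commute)
        show ?thesis using C(2)[of j "n - j" "vert y (Suc j) - fst e" k] 1 step h True by (simp add: f_def k_def)
      qed (use nn in auto)
      have "\<bar>\<Sum>e\<in>?E. ?t e\<bar> \<le> (\<Sum>e\<in>?E. \<bar>?t e\<bar>)" by (rule sum_abs)
      also have "\<dots> \<le> (\<Sum>e\<in>edges a d. \<bar>?t e\<bar>)" by (intro sum_mono2) auto
      also have "\<dots> \<le> (\<Sum>e\<in>edges a d. C * bb (n - j) * rho n k)" using t by (intro sum_mono) auto
      also have "\<dots> = K * (C * bb (n - j) * rho n k)" by (simp add: K_def)
      finally have "\<bar>Fs a d (Suc j) f y\<bar> \<le> \<bar>Fs a d j f y\<bar> + K * (C * bb (n - j) * rho n k)"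
        using Fs_Suc[OF f _ h(4) a0, of j] step by linarith
      thus ?case using step by simp
    qed
    have "(\<Sum>j=N..<j0. bb (n - j)) = (\<Sum>m\<in>(\<lambda>j. n - j) ` {N..<j0}. bb m)"
      using h by (subst sum.reindex) (auto intro!: inj_onI)
    also have "\<dots> \<le> tail (n - j0)" using h by (intro tail_ge) auto
    finally have tl: "(\<Sum>j=N..<j0. bb (n - j)) \<le> tail (n - j0)" .
    have "1 \<le> bb n * rho n k" using bb_rho_ge_1[OF h(3)] vert_le[OF h(4)] by (simp add: k_def)
    also have "\<dots> \<le> tail (n - j0) * rho n k" using tail_ge[of "{n}" "n - j0"] rho0 by (intro mult_right_mono) auto
    finally have one: "1 \<le> tail (n - j0) * rho n k" .
    have "\<bar>Fs a d j0 f y\<bar> \<le> C6 + (\<Sum>j=N..<j0. K * (C * bb (n - j) * rho n k))" by (rule step[OF h(1,2)])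
    also have "\<dots> = C6 * 1 + K * C * (\<Sum>j=N..<j0. bb (n - j)) * rho n k"
      by (simp add: sum_distrib_left sum_distrib_right mult_ac)
    also have "\<dots> \<le> C6 * (tail (n - j0) * rho n k) + K * C * tail (n - j0) * rho n k"
      using one tl C60 C(1) rho0 by (intro add_mono mult_left_mono mult_right_mono) (auto simp: K_def)
    also have "\<dots> \<le> (C6 + K * C + 1) * tail (n - j0) * rho n k"
      using one by (simp add: algebra_simps)
    finally show ?thesis by (simp add: f_def k_def)
  qed
  moreover have "C6 + K * C + 1 > 0" using C60 C(1) by (simp add: K_def add_nonneg_pos)
  ultimately show ?thesis by (intro exI[of _ "C6 + K * C + 1"]) simp
qed

end

section \<open>A compactness criterion for limiting curves\<close>

lemma Fg_of_nat: "Fg a d g x (real j) = Sg a d g x j"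
  by (simp add: Fg_def)

lemma Sg_centered: "Sg a d (\<lambda>x. g x - s) x j = Sg a d g x j - s * real j"
  by (simp add: Sg_def sum_subtractf)

lemma Fg_centered:
  assumes "t \<ge> 0"
  shows "Fg a d g x t = Fg a d (\<lambda>x. g x - s) x t + s * t"
  using assms by (simp add: Fg_def Let_def Sg_centered algebra_simps)

lemma Fg_near:
  assumes "t \<ge> 0" "\<And>j. \<bar>f ((Tp a d ^^ j) x)\<bar> \<le> b"
  shows "\<bar>Fg a d f x t - Sg a d f x (nat \<lfloor>t\<rfloor>)\<bar> \<le> b"
proof -
  define m where "m = nat \<lfloor>t\<rfloor>"
  have m: "real m \<le> t" "t < real m + 1" using assms(1) by (auto simp: m_def)
  have "Fg a d f x t - Sg a d f x m = (t - real m) * f ((Tp a d ^^ m) x)"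
    by (simp add: Fg_def m_def Sg_Suc Let_def)
  also have "\<bar>\<dots>\<bar> = (t - real m) * \<bar>f ((Tp a d ^^ m) x)\<bar>" using m by (simp add: abs_mult)
  also have "\<dots> \<le> 1 * b" using m assms(2)[of m] by (intro mult_mono) auto
  finally show ?thesis by (simp add: m_def)
qed

text \<open>The interpolation as a finite sum of clamped ramps, from which continuity in t is
  immediate.\<close>

lemma Fg_clamp:
  assumes "0 \<le> t" "t \<le> real M"
  shows "Fg a d g x t = (\<Sum>k<M. g ((Tp a d ^^ k) x) * max 0 (min 1 (t - real k)))"
proof -
  define m where "m = nat \<lfloor>t\<rfloor>"
  have m: "real m \<le> t" "t < real m + 1" using assms(1) by (auto simp: m_def)
  have mM: "m \<le> M" using m assms by linarith
  let ?h = "\<lambda>k. g ((Tp a d ^^ k) x) * max 0 (min 1 (t - real k))"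
  have lt: "(\<Sum>k<m. ?h k) = Sg a d g x m" unfolding Sg_def
  proof (rule sum.cong)
    fix k assume "k \<in> {..<m}"
    hence "real k + 1 \<le> real m" by simp
    hence "max 0 (min 1 (t - real k)) = 1" using m by simp
    thus "?h k = g ((Tp a d ^^ k) x)" by simp
  qed simp
  show ?thesis
  proof (cases "m = M")
    case True
    hence "t = real m" using m assms by simp
    thus ?thesis using lt True by (simp add: Fg_of_nat)
  next
    case False
    have "{..<M} = {..<m} \<union> {m..<M}" using mM by auto
    hence "(\<Sum>k<M. ?h k) = (\<Sum>k<m. ?h k) + (\<Sum>k=m..<M. ?h k)"
      by (simp add: sum.union_disjoint ivl_disj_int)
    also have "(\<Sum>k=m..<M. ?h k) = ?h m + (\<Sum>k=Suc m..<M. ?h k)"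
      using False mM by (subst sum.atLeast_Suc_lessThan) auto
    also have "(\<Sum>k=Suc m..<M. ?h k) = 0"
    proof (rule sum.neutral, rule ballI)
      fix k assume "k \<in> {Suc m..<M}"
      hence "real m + 1 \<le> real k" by simp
      hence "max 0 (min 1 (t - real k)) = 0" using m by simp
      thus "?h k = 0" by simp
    qed
    also have "max 0 (min 1 (t - real m)) = t - real m" using m by simp
    finally show ?thesis using lt by (simp add: Fg_def m_def[symmetric] Sg_Suc)
  qed
qed

definition dev :: "(nat \<Rightarrow> nat) \<Rightarrow> nat \<Rightarrow> ((nat \<Rightarrow> nat \<times> nat) \<Rightarrow> real) \<Rightarrow> (nat \<Rightarrow> nat \<times> nat) \<Rightarrow> nat \<Rightarrow> real \<Rightarrow> real" where
  "dev a d g x l t = Fg a d g x (t * real l) - t * Fg a d g x (real l)"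

lemma dev_cont: "continuous_on {0..1} (dev a d g x l)"
proof -
  have "continuous_on {0..1} (\<lambda>t. (\<Sum>k<l. g ((Tp a d ^^ k) x) * max 0 (min 1 (t * real l - real k))) - t * Fg a d g x (real l))"
    by (intro continuous_intros)
  moreover have "dev a d g x l t = (\<Sum>k<l. g ((Tp a d ^^ k) x) * max 0 (min 1 (t * real l - real k))) - t * Fg a d g x (real l)"
    if "t \<in> {0..1}" for t
    using that Fg_clamp[of "t * real l" l a d g x] mult_left_le_one_le[of "real l" t] by (simp add: dev_def)
  ultimately show ?thesis by (subst continuous_on_cong[OF refl]) auto
qed

lemma dev_le_Rg:
  assumes "t \<in> {0..1}"
  shows "\<bar>dev a d g x l t\<bar> \<le> Rg a d g x l"
proof -
  have "bdd_above ((\<lambda>t. \<bar>dev a d g x l t\<bar>) ` {0..1})"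
    by (intro compact_imp_bounded[THEN bounded_imp_bdd_above] compact_continuous_image continuous_intros dev_cont) simp
  thus ?thesis unfolding Rg_def dev_def[symmetric] using assms by (rule cSUP_upper2) auto
qed

lemma Rg_le:
  assumes "\<And>t. t \<in> {0..1} \<Longrightarrow> \<bar>dev a d g x l t\<bar> \<le> B"
  shows "Rg a d g x l \<le> B"
  unfolding Rg_def dev_def[symmetric] using assms by (intro cSUP_least) auto

lemma phig_eq_dev: "phig a d g x l t = dev a d g x l t / Rg a d g x l"
  by (simp add: phig_def dev_def)

text \<open>A constant added to \<open>g\<close> changes \<open>Fg\<close> by a linear function,
  which subtracting the chord removes; so each curve may be centred by its own constant.\<close>

lemma dev_centered:
  assumes "0 \<le> t"
  shows "dev a d g x l t = dev a d (\<lambda>x. g x - s) x l t"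
  using assms Fg_centered[of "t * real l" a d g x s] Fg_centered[of "real l" a d g x s]
  by (simp add: dev_def algebra_simps)

text \<open>The deviation V from the chord over [0, l] differs from \<open>Sg\<close> by a linear
  function, so it yields the same deviation from the chord over [j, j + h]; four values of V, each
  at most R, enter with factors at most 1.\<close>

lemma Rg_three_points:
  assumes "j + h \<le> l" "i \<le> h" "0 < h"
  shows "\<bar>(Sg a d g x (j + i) - Sg a d g x j) - real i / real h * (Sg a d g x (j + h) - Sg a d g x j)\<bar> \<le> 4 * Rg a d g x l"
proof -
  define V where "V = (\<lambda>m. Sg a d g x m - real m / real l * Sg a d g x l)"
  have V: "\<bar>V m\<bar> \<le> Rg a d g x l" if "m \<le> l" for m
  proof -
    have "V m = dev a d g x l (real m / real l)"
      using assms that by (simp add: V_def dev_def Fg_of_nat)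
    thus ?thesis using dev_le_Rg[of "real m / real l" a d g x l] that by (simp add: divide_le_eq)
  qed
  define U where "U = real i / real h * (V (j + h) - V j)"
  have "(Sg a d g x (j + i) - Sg a d g x j) - real i / real h * (Sg a d g x (j + h) - Sg a d g x j)
     = (V (j + i) - V j) - U" (is "?L = _")
    using assms by (simp add: V_def U_def field_simps)
  moreover have "\<bar>U\<bar> \<le> 1 * (2 * Rg a d g x l)"
    unfolding U_def abs_mult using assms V[of "j + h"] V[of j] by (intro mult_mono) auto
  moreover have "\<bar>V (j + i)\<bar> \<le> Rg a d g x l" "\<bar>V j\<bar> \<le> Rg a d g x l" using V assms by auto
  ultimately have "\<bar>?L\<bar> \<le> 4 * Rg a d g x l" by (simp only:)
  thus ?thesis .
qed

text \<open>\<rho> is a common scale: R is at least a multiple of it, and increments over short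
  times are small against it. As \<rho> tends to infinity, the interpolation error 2 * b disappears
  after division.\<close>

lemma limit_curve_criterion:
  fixes l :: "nat \<Rightarrow> nat" and s \<rho> :: "nat \<Rightarrow> real"
  assumes l0: "\<And>i. 0 < l i" and linf: "filterlim l at_top sequentially"
    and r0: "\<And>i. 0 < \<rho> i" and rinf: "filterlim \<rho> at_top sequentially"
    and fb: "\<And>i j. \<bar>g ((Tp a d ^^ j) x) - s i\<bar> \<le> b"
    and eqc: "\<And>\<eta>. \<eta> > 0 \<Longrightarrow> \<exists>\<delta>>0. \<forall>\<^sub>F i in sequentially. \<forall>j j'. j \<le> j' \<longrightarrow> j' \<le> l i \<longrightarrow> real (j' - j) \<le> \<delta> * real (l i) \<longrightarrow>
        \<bar>Sg a d (\<lambda>x. g x - s i) x j' - Sg a d (\<lambda>x. g x - s i) x j\<bar> \<le> \<eta> * \<rho> i"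
    and tot: "\<And>i. \<bar>Sg a d (\<lambda>x. g x - s i) x (l i)\<bar> \<le> C * \<rho> i"
    and low: "\<And>i. c0 * \<rho> i \<le> Rg a d g x (l i)" and c0: "c0 > 0"
  shows "has_limit_curve a d g x"
proof -
  define \<phi> where "\<phi> = (\<lambda>i t. phig a d g x (l i) t)"
  have R0: "Rg a d g x (l i) > 0" for i using less_le_trans[OF mult_pos_pos[OF c0 r0] low] .
  have b0: "b \<ge> 0" using fb[of 0 0] by linarith
  have "0 \<le> C * \<rho> 0" using tot[of 0] by linarith
  hence C0: "C \<ge> 0" using r0[of 0] by (simp add: zero_le_mult_iff)
  have cont: "continuous_on {0..1} (\<phi> i)" for i
    unfolding \<phi>_def phig_eq_dev using R0[of i] by (intro continuous_intros dev_cont) auto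
  have ord: "\<bar>\<phi> i t' - \<phi> i t\<bar> \<le> (\<bar>Sg a d (\<lambda>x. g x - s i) x (nat \<lfloor>t' * real (l i)\<rfloor>) - Sg a d (\<lambda>x. g x - s i) x (nat \<lfloor>t * real (l i)\<rfloor>)\<bar>
      + 2 * b + \<bar>t' - t\<bar> * (C * \<rho> i)) / (c0 * \<rho> i)" if "t \<in> {0..1}" "t' \<in> {0..1}" for i t t'
  proof -
    let ?f = "\<lambda>x. g x - s i"
    have "\<bar>dev a d g x (l i) t' - dev a d g x (l i) t\<bar> =
       \<bar>(Fg a d ?f x (t' * real (l i)) - Fg a d ?f x (t * real (l i))) - (t' - t) * Sg a d ?f x (l i)\<bar>"
      using that dev_centered[of t a d g x "l i" "s i"] dev_centered[of t' a d g x "l i" "s i"]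
      by (simp add: dev_def Fg_of_nat algebra_simps)
    also have "\<dots> \<le> \<bar>Fg a d ?f x (t' * real (l i)) - Fg a d ?f x (t * real (l i))\<bar> + \<bar>t' - t\<bar> * \<bar>Sg a d ?f x (l i)\<bar>"
      by (rule order.trans[OF abs_triangle_ineq4]) (simp add: abs_mult)
    also have "\<dots> \<le> (\<bar>Sg a d ?f x (nat \<lfloor>t' * real (l i)\<rfloor>) - Sg a d ?f x (nat \<lfloor>t * real (l i)\<rfloor>)\<bar> + 2 * b) + \<bar>t' - t\<bar> * (C * \<rho> i)"
    proof (intro add_mono mult_left_mono tot abs_ge_zero)
      show "\<bar>Fg a d ?f x (t' * real (l i)) - Fg a d ?f x (t * real (l i))\<bar>
         \<le> \<bar>Sg a d ?f x (nat \<lfloor>t' * real (l i)\<rfloor>) - Sg a d ?f x (nat \<lfloor>t * real (l i)\<rfloor>)\<bar> + 2 * b"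
        using Fg_near[of "t * real (l i)" ?f a d x b] Fg_near[of "t' * real (l i)" ?f a d x b] fb that by simp
    qed
    finally have "\<bar>dev a d g x (l i) t' - dev a d g x (l i) t\<bar> \<le> \<dots>" .
    hence "\<bar>dev a d g x (l i) t' - dev a d g x (l i) t\<bar> / Rg a d g x (l i) \<le>
       ((\<bar>Sg a d ?f x (nat \<lfloor>t' * real (l i)\<rfloor>) - Sg a d ?f x (nat \<lfloor>t * real (l i)\<rfloor>)\<bar> + 2 * b) + \<bar>t' - t\<bar> * (C * \<rho> i)) / (c0 * \<rho> i)"
      using low[of i] c0 r0[of i] by (intro frac_le) auto
    moreover have "\<bar>\<phi> i t' - \<phi> i t\<bar> = \<bar>dev a d g x (l i) t' - dev a d g x (l i) t\<bar> / Rg a d g x (l i)"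
      using R0[of i] by (simp add: \<phi>_def phig_eq_dev abs_divide flip: diff_divide_distrib)
    ultimately show ?thesis by simp
  qed
  have bound: "norm (\<phi> i t) \<le> 1" if "t \<in> {0..1}" for i t
    using dev_le_Rg[OF that, of a d g x "l i"] R0[of i] by (simp add: \<phi>_def phig_eq_dev abs_divide)
  have equi: "\<exists>e'>0. \<forall>i t'. t' \<in> {0..1} \<and> norm (t - t') < e' \<longrightarrow> norm (\<phi> i t - \<phi> i t') < e"
    if t: "t \<in> {0..1}" and e: "e > 0" for t e
  proof -
    \<comment> \<open>Three errors of size \<eta> * \<rho> i, from the sums, the interpolation and
      the linear term, give 3 * e / 8 after division by c0 * \<rho> i.\<close>
    define \<eta> where "\<eta> = e * c0 / 8"
    have eta: "\<eta> > 0" using e c0 by (simp add: \<eta>_def)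
    obtain \<delta> where d0: "\<delta> > 0" and ev: "\<forall>\<^sub>F i in sequentially. \<forall>j j'. j \<le> j' \<longrightarrow> j' \<le> l i \<longrightarrow> real (j' - j) \<le> \<delta> * real (l i) \<longrightarrow>
        \<bar>Sg a d (\<lambda>x. g x - s i) x j' - Sg a d (\<lambda>x. g x - s i) x j\<bar> \<le> \<eta> * \<rho> i" using eqc[OF eta] by blast
    have ev2: "\<forall>\<^sub>F i in sequentially. 2 * b / \<eta> \<le> \<rho> i" using rinf unfolding filterlim_at_top by blast
    have "filterlim (\<lambda>i. real (l i)) at_top sequentially" by (rule filterlim_compose[OF filterlim_real_sequentially linf])
    hence ev3: "\<forall>\<^sub>F i in sequentially. 2 / \<delta> \<le> real (l i)" unfolding filterlim_at_top by blast
    obtain I where I: "\<And>i j j'. i \<ge> I \<Longrightarrow> j \<le> j' \<Longrightarrow> j' \<le> l i \<Longrightarrow> real (j' - j) \<le> \<delta> * real (l i) \<Longrightarrow>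
        \<bar>Sg a d (\<lambda>x. g x - s i) x j' - Sg a d (\<lambda>x. g x - s i) x j\<bar> \<le> \<eta> * \<rho> i"
      "\<And>i. i \<ge> I \<Longrightarrow> 2 * b / \<eta> \<le> \<rho> i" "\<And>i. i \<ge> I \<Longrightarrow> 2 / \<delta> \<le> real (l i)"
      using eventually_conj[OF ev eventually_conj[OF ev2 ev3]] unfolding eventually_sequentially by blast
    define d1 where "d1 = min (\<delta> / 2) (\<eta> / (C + 1))"
    have d1: "d1 > 0" using d0 eta C0 by (simp add: d1_def)
    have large: "norm (\<phi> i t - \<phi> i t') < e" if i: "i \<ge> I" and t': "t' \<in> {0..1}" "norm (t - t') < d1" for i t'
    proof -
      let ?S = "\<lambda>j. Sg a d (\<lambda>x. g x - s i) x j"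
      have key: "\<bar>?S (nat \<lfloor>v * real (l i)\<rfloor>) - ?S (nat \<lfloor>u * real (l i)\<rfloor>)\<bar> \<le> \<eta> * \<rho> i"
        if uv: "u \<in> {0..1}" "v \<in> {0..1}" "u \<le> v" "v - u < \<delta> / 2" for u v
      proof (rule I(1)[OF i])
        show "nat \<lfloor>u * real (l i)\<rfloor> \<le> nat \<lfloor>v * real (l i)\<rfloor>"
          using uv by (intro nat_mono floor_mono mult_right_mono) auto
        have "v * real (l i) \<le> real (l i)" using uv by (simp add: mult_left_le_one_le)
        thus "nat \<lfloor>v * real (l i)\<rfloor> \<le> l i" by linarith
        have "real (nat \<lfloor>v * real (l i)\<rfloor> - nat \<lfloor>u * real (l i)\<rfloor>) \<le> (v - u) * real (l i) + 1"
        proof -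
          have "0 \<le> u * real (l i)" "0 \<le> v * real (l i)" using uv by auto
          hence "real (nat \<lfloor>v * real (l i)\<rfloor>) \<le> v * real (l i)" "u * real (l i) - 1 \<le> real (nat \<lfloor>u * real (l i)\<rfloor>)"
            by linarith+
          moreover have "(v - u) * real (l i) \<ge> 0" using uv by simp
          ultimately show ?thesis by (auto simp: of_nat_diff_real left_diff_distrib)
        qed
        also have "\<dots> \<le> \<delta> / 2 * real (l i) + \<delta> / 2 * real (l i)"
          using uv I(3)[OF i] d0 by (intro add_mono mult_right_mono) (auto simp: field_simps)
        finally show "real (nat \<lfloor>v * real (l i)\<rfloor> - nat \<lfloor>u * real (l i)\<rfloor>) \<le> \<delta> * real (l i)" by simp
      qed
      have dt: "\<bar>t' - t\<bar> < \<delta> / 2" "\<bar>t' - t\<bar> \<le> \<eta> / (C + 1)" using t' by (auto simp: d1_def abs_minus_commute)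
      have S: "\<bar>?S (nat \<lfloor>t' * real (l i)\<rfloor>) - ?S (nat \<lfloor>t * real (l i)\<rfloor>)\<bar> \<le> \<eta> * \<rho> i"
        using key[of t t'] key[of t' t] t t' dt by (cases "t \<le> t'") auto
      have "2 * b \<le> \<eta> * \<rho> i" using I(2)[OF i] eta by (simp add: field_simps)
      moreover have "\<bar>t' - t\<bar> * (C * \<rho> i) \<le> \<eta> * \<rho> i"
      proof -
        have "\<bar>t' - t\<bar> * C \<le> \<eta> / (C + 1) * C" using dt C0 by (intro mult_right_mono) auto
        also have "\<dots> \<le> \<eta>" using eta C0 by (simp add: field_simps)
        finally show ?thesis using r0[of i] by (simp flip: mult.assoc add: mult_right_mono)
      qed
      ultimately have "\<bar>?S (nat \<lfloor>t' * real (l i)\<rfloor>) - ?S (nat \<lfloor>t * real (l i)\<rfloor>)\<bar> + 2 * b + \<bar>t' - t\<bar> * (C * \<rho> i) \<le> 3 * (\<eta> * \<rho> i)"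
        using S by linarith
      hence "\<bar>\<phi> i t' - \<phi> i t\<bar> \<le> (3 * (\<eta> * \<rho> i)) / (c0 * \<rho> i)"
        using c0 r0[of i] by (intro order.trans[OF ord[OF t t'(1)]] divide_right_mono) auto
      also have "\<dots> = 3 * e / 8" using r0[of i] c0 by (simp add: \<eta>_def field_simps)
      finally show ?thesis using e by (simp add: abs_minus_commute)
    qed
    have "\<exists>e'>0. \<forall>t'\<in>{0..1}. dist t' t < e' \<longrightarrow> dist (\<phi> i t') (\<phi> i t) < e" for i
      using cont[of i] t e unfolding continuous_on_iff by blast
    then obtain dd where dd: "\<And>i. dd i > 0" "\<And>i t'. t' \<in> {0..1} \<Longrightarrow> dist t' t < dd i \<Longrightarrow> dist (\<phi> i t') (\<phi> i t) < e"
      by metis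
    \<comment> \<open>Equicontinuity must cover all curves; the finitely many before I are handled
      by their own continuity.\<close>
    define e' where "e' = Min (insert d1 (dd ` {..<I}))"
    have "e' > 0" using d1 dd(1) by (auto simp: e'_def)
    moreover have "norm (\<phi> i t - \<phi> i t') < e" if "t' \<in> {0..1}" "norm (t - t') < e'" for i t'
    proof (cases "i < I")
      case True
      hence "e' \<le> dd i" by (auto simp: e'_def)
      thus ?thesis using dd(2)[OF that(1), of i] that(2) by (simp add: dist_real_def abs_minus_commute)
    next
      case False
      have "e' \<le> d1" by (auto simp: e'_def)
      thus ?thesis using large[of i t'] False that by simp
    qed
    ultimately show ?thesis by blast
  qed
  obtain G k where G: "continuous_on {0..1} G" "strict_mono (k :: nat \<Rightarrow> nat)"
     "\<And>e. 0 < e \<Longrightarrow> \<exists>N. \<forall>n x. n \<ge> N \<and> x \<in> {0..1} \<longrightarrow> norm (\<phi> (k n) x - G x) < e"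
    using Arzela_Ascoli[of "{0..1::real}" \<phi> 1, OF compact_Icc bound equi] by metis
  have "uniform_limit {0..1} (\<lambda>n. phig a d g x (l (k n))) G sequentially"
    unfolding uniform_limit_iff eventually_sequentially using G(3) by (fastforce simp: \<phi>_def dist_norm)
  moreover have "filterlim (\<lambda>n. l (k n)) at_top sequentially"
    by (rule filterlim_compose[OF linf filterlim_subseq[OF G(2)]])
  ultimately show ?thesis unfolding has_limit_curve_def using l0 R0 G(1)
    by (intro exI[of _ "\<lambda>n. l (k n)"]) blast
qed

section \<open>Limiting curves along typical levels\<close>

context adic_function
begin

text \<open>k grows like n * mean with positive mean; this makes natural subtractions from k
  exact.\<close>

lemma level_at_top:
  assumes n: "filterlim n at_top sequentially"
    and s: "(\<lambda>i. (real (k i) - real (n i) * mean) / sqrt (real (n i))) \<longlonglongrightarrow> s"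
  shows "\<forall>\<^sub>F i in sequentially. K \<le> (k i :: nat)"
proof -
  have sq: "filterlim (\<lambda>i. sqrt (real (n i))) at_top sequentially"
    by (rule filterlim_compose[OF sqrt_at_top], rule filterlim_compose[OF filterlim_real_sequentially n])
  have "\<forall>\<^sub>F i in sequentially. s - 1 < (real (k i) - real (n i) * mean) / sqrt (real (n i))"
    using s by (rule order_tendstoD) simp
  moreover have "\<forall>\<^sub>F i in sequentially. max 1 ((real K + \<bar>s - 1\<bar>) / mean) \<le> sqrt (real (n i))"
    using sq unfolding filterlim_at_top by blast
  ultimately show ?thesis
  proof eventually_elim
    case (elim i)
    let ?q = "sqrt (real (n i))"
    have q: "?q \<ge> 1" "(real K + \<bar>s - 1\<bar>) / mean \<le> ?q" using elim(2) by auto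
    have nq: "real (n i) = ?q * ?q" by simp
    define X where "X = (s - 1) * ?q"
    define Y where "Y = \<bar>s - 1\<bar> * ?q"
    have "X < real (k i) - real (n i) * mean" using elim(1) q unfolding X_def by (simp add: field_simps)
    moreover have "real K * ?q + Y \<le> real (n i) * mean"
    proof -
      have "real K + \<bar>s - 1\<bar> \<le> ?q * mean" using q(2) mean_pos by (simp add: divide_le_eq)
      hence "(real K + \<bar>s - 1\<bar>) * ?q \<le> (?q * mean) * ?q" using q by (intro mult_right_mono) auto
      also have "(?q * mean) * ?q = real (n i) * mean" by (subst nq) (simp only: mult_ac)
      finally show ?thesis by (simp only: distrib_right Y_def)
    qed
    moreover have "- X \<le> Y"
    proof -
      have "(- (s - 1)) * ?q \<le> \<bar>s - 1\<bar> * ?q" using q by (intro mult_right_mono) auto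
      thus ?thesis by (simp add: X_def Y_def algebra_simps)
    qed
    moreover have "real K * 1 \<le> real K * ?q" using q by (intro mult_left_mono) auto
    ultimately have "real K \<le> real (k i)" by linarith
    thus ?case by simp
  qed
qed

text \<open>Shifting k by e amounts to a factor x ^ e, whose value at 1 is 1.\<close>

lemma Ph_limit:
  assumes n: "filterlim n at_top sequentially"
    and s: "(\<lambda>i. (real (k i) - real (n i) * mean) / sqrt (real (n i))) \<longlonglongrightarrow> s"
  shows "(\<lambda>i. sqrt (real (n i)) * Ph (n i - m) (k i - e)) \<longlonglongrightarrow> gr var 0 s"
proof -
  have "(\<lambda>i. sqrt (real (n i)) ^ Suc 0 * coeff (P ^ (n i - m) * ([:1, -1:] ^ 0 * monom 1 e)) (k i))
     \<longlonglongrightarrow> poly (monom 1 e) 1 * gr var 0 s"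
    by (rule local_limit_shift[OF n s])
  hence "(\<lambda>i. sqrt (real (n i)) * coeff (monom 1 e * P ^ (n i - m)) (k i)) \<longlonglongrightarrow> gr var 0 s"
    by (simp add: poly_monom mult.commute)
  thus ?thesis
    by (rule Lim_transform_eventually)
       (use level_at_top[OF n s, of e] in eventually_elim, auto simp: coeff_monom_mult Ph_def)
qed

lemma Ph_lower:
  assumes n: "filterlim n at_top sequentially"
    and s: "(\<lambda>i. (real (k i) - real (n i) * mean) / sqrt (real (n i))) \<longlonglongrightarrow> s"
  shows "\<forall>\<^sub>F i in sequentially. gr var 0 s / 2 / sqrt (real (n i)) \<le> Ph (n i - m) (k i - e) \<and> 0 < Ph (n i - m) (k i - e)
     \<and> Ph (n i - m) (k i - e) \<le> 2 * gr var 0 s / sqrt (real (n i))"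
proof -
  have g0: "gr var 0 s > 0" by (rule gr_0_pos[OF var_pos])
  have n0: "\<forall>\<^sub>F i in sequentially. n i > 0"
    using eventually_compose_filterlim[OF eventually_gt_at_top n] .
  have 1: "\<forall>\<^sub>F i in sequentially. gr var 0 s / 2 < sqrt (real (n i)) * Ph (n i - m) (k i - e)"
    by (rule order_tendstoD(1)[OF Ph_limit[OF n s]]) (use g0 in simp)
  have 2: "\<forall>\<^sub>F i in sequentially. sqrt (real (n i)) * Ph (n i - m) (k i - e) < 2 * gr var 0 s"
    by (rule order_tendstoD(2)[OF Ph_limit[OF n s]]) (use g0 in simp)
  from 1 2 n0 show ?thesis
  proof eventually_elim
    case (elim i)
    have q: "sqrt (real (n i)) > 0" using elim by simp
    have "0 < sqrt (real (n i)) * Ph (n i - m) (k i - e)" using elim(1) g0 by linarith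
    thus ?case using elim q by (simp add: field_simps zero_less_mult_iff)
  qed
qed

lemma Ph_ratio:
  assumes n: "filterlim n at_top sequentially"
    and s: "(\<lambda>i. (real (k i) - real (n i) * mean) / sqrt (real (n i))) \<longlonglongrightarrow> s"
  shows "\<forall>\<^sub>F i in sequentially. Ph (n i) (k i) / 4 \<le> Ph (n i - m) (k i - e)"
proof -
  from Ph_lower[OF n s, of m e] Ph_lower[OF n s, of 0 0] show ?thesis
    by eventually_elim (auto simp: field_simps)
qed

text \<open>The deviation from the chord at the times of \<open>orbit_three_points\<close>. The
  terms with c cancel, and a common denominator leaves the determinant \<open>Wr\<close> divided by
  \<open>Ph (n i - 1) (k i)\<close> and a path weight; \<open>wronskian_limit\<close> is applied
  with n - 1 for n.\<close>

lemma deviation_lower: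
  assumes n: "filterlim n at_top sequentially"
    and s: "(\<lambda>i. (real (k i) - real (n i) * mean) / sqrt (real (n i))) \<longlonglongrightarrow> s"
    and gs: "gr var r s \<noteq> 0" and kd: "\<And>i. k i \<ge> d" and nN: "\<And>i. n i \<ge> N + 3"
  shows "\<exists>c0>0. \<forall>\<^sub>F i in sequentially. c0 * rho (n i) (k i) \<le>
     \<bar>real (a d) * Gs a d g (n i - 2) (k i - d) - real (a d) * Hs (n i - 2) (k i - d) / Hs (n i - 1) (k i) * Gs a d g (n i - 1) (k i)\<bar>"
proof -
  obtain B where B: "monom 1 d - P = [:1, -1:] * B" by (rule step_factor)
  have B1: "poly B 1 < 0" by (rule step_factor_nonzero[OF deg_P d1 B])
  define W0 where "W0 = - (poly E 1 * poly B 1 * (real (Suc r) / var) * gr var 0 s * gr var r s)"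
  have g0: "gr var 0 s > 0" by (rule gr_0_pos[OF var_pos])
  have W0: "W0 \<noteq> 0" using B1 E1 var_pos g0 gs by (simp add: W0_def)
  define Wr where "Wr = (\<lambda>i. Dh (n i - 2) (k i - d) * Ph (n i - 1) (k i) - Dh (n i - 1) (k i) * Ph (n i - 2) (k i - d))"
  note sh = shift_limit[OF n s, of 1]
  have "(\<lambda>i. sqrt (real (n i - 1)) ^ (r + 4) *
     (coeff (P ^ (n i - 1 - Suc N) * ([:1, -1:] ^ Suc r * E)) (k i - d) * coeff (P ^ (n i - 1)) (k i)
      - coeff (P ^ (n i - 1 - N) * ([:1, -1:] ^ Suc r * E)) (k i) * coeff (P ^ (n i - 1 - 1)) (k i - d))) \<longlonglongrightarrow> W0"
    unfolding W0_def
  proof (rule wronskian_limit[OF sh(1,3) kd B])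
    show "n i - 1 > N" for i using nN[of i] by simp
  qed
  moreover have "n i - 1 - Suc N = n i - 2 - N" "n i - 1 - 1 = n i - 2" for i by simp_all
  ultimately have "(\<lambda>i. sqrt (real (n i - 1)) ^ (r + 4) * Wr i) \<longlonglongrightarrow> W0"
    by (simp only: Wr_def Dh_def Ph_def)
  hence "(\<lambda>i. \<bar>sqrt (real (n i - 1)) ^ (r + 4) * Wr i\<bar>) \<longlonglongrightarrow> \<bar>W0\<bar>" by (rule tendsto_rabs)
  hence ev1: "\<forall>\<^sub>F i in sequentially. \<bar>W0\<bar> / 2 < \<bar>sqrt (real (n i - 1)) ^ (r + 4) * Wr i\<bar>"
    by (rule order_tendstoD) (use W0 in simp)
  \<comment> \<open>Half the limit of the determinant over twice that of the scaled
    \<open>Ph\<close>; q ^ 2 * z ^ d converts the weight of (n - 2, k - d) into that of (n,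
    k).\<close>
  define c0 where "c0 = real (a d) * \<bar>W0\<bar> * (q\<^sup>2 * z ^ d) / (4 * gr var 0 s)"
  have c0: "c0 > 0" using W0 g0 q0 z0 apos[of d] by (simp add: c0_def)
  have "\<forall>\<^sub>F i in sequentially. c0 * rho (n i) (k i) \<le>
     \<bar>real (a d) * Gs a d g (n i - 2) (k i - d) - real (a d) * Hs (n i - 2) (k i - d) / Hs (n i - 1) (k i) * Gs a d g (n i - 1) (k i)\<bar>"
    using ev1 Ph_lower[OF sh(1,3), of 0 0]
  proof eventually_elim
    case (elim i)
    define S where "S = sqrt (real (n i - 1))"
    have S: "S > 0" "S \<le> sqrt (real (n i))" using nN[of i] by (auto simp: S_def)
    have ph: "0 < Ph (n i - 1) (k i)" "Ph (n i - 1) (k i) \<le> 2 * gr var 0 s / S" using elim(2) by (auto simp: S_def)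
    have w: "wt (n i - 2) (k i - d) > 0" "wt (n i - 1) (k i) > 0" "wt (n i) (k i) > 0" by (rule wt_pos)+
    have wteq: "wt (n i) (k i) = wt (n i - 2) (k i - d) * (q\<^sup>2 * z ^ d)"
    proof -
      have "n i = (n i - 2) + 2" using nN[of i] by simp
      hence "q ^ n i = q ^ (n i - 2) * q\<^sup>2" by (metis power_add)
      moreover have "z ^ k i = z ^ (k i - d) * z ^ d" using kd[of i] by (simp flip: power_add)
      ultimately show ?thesis by (simp add: wt_def)
    qed
    have N2: "N \<le> n i - 2" "N \<le> n i - 1" using nN[of i] by auto
    have X: "real (a d) * Gs a d g (n i - 2) (k i - d) - real (a d) * Hs (n i - 2) (k i - d) / Hs (n i - 1) (k i) * Gs a d g (n i - 1) (k i)
       = real (a d) / wt (n i - 2) (k i - d) * (Wr i / Ph (n i - 1) (k i))"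
      unfolding Gs_eq[OF N2(1)] Gs_eq[OF N2(2)] Hs_eq Wr_def using w ph(1) by (simp add: field_simps)
    have "\<bar>W0\<bar> / 2 / S ^ (r + 4) \<le> \<bar>Wr i\<bar>"
      using elim(1) S(1) unfolding S_def[symmetric] by (simp add: abs_mult field_simps)
    hence "(\<bar>W0\<bar> / 2 / S ^ (r + 4)) / (2 * gr var 0 s / S) \<le> \<bar>Wr i\<bar> / Ph (n i - 1) (k i)"
      using ph S(1) by (intro frac_le) auto
    also have "(\<bar>W0\<bar> / 2 / S ^ (r + 4)) / (2 * gr var 0 s / S) = \<bar>W0\<bar> / (4 * gr var 0 s) / S ^ (r + 3)"
      using S(1) g0 by (simp add: field_simps eval_nat_numeral)
    finally have 1: "\<bar>W0\<bar> / (4 * gr var 0 s) / S ^ (r + 3) \<le> \<bar>Wr i\<bar> / Ph (n i - 1) (k i)" .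
    have "c0 * rho (n i) (k i) = real (a d) / wt (n i - 2) (k i - d) * (\<bar>W0\<bar> / (4 * gr var 0 s) / sqrt (real (n i)) ^ (r + 3))"
      unfolding rho_def c0_def wteq using w q0 z0 by (simp add: field_simps)
    also have "\<dots> \<le> real (a d) / wt (n i - 2) (k i - d) * (\<bar>W0\<bar> / (4 * gr var 0 s) / S ^ (r + 3))"
      using S g0 w nN[of i] by (intro mult_left_mono divide_left_mono power_mono mult_pos_pos zero_less_power) auto
    also have "\<dots> \<le> real (a d) / wt (n i - 2) (k i - d) * (\<bar>Wr i\<bar> / Ph (n i - 1) (k i))"
      using 1 w by (intro mult_left_mono) auto
    also have "\<dots> = \<bar>real (a d) / wt (n i - 2) (k i - d) * (Wr i / Ph (n i - 1) (k i))\<bar>"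
      using w ph(1) by (simp add: abs_mult abs_divide)
    finally show ?case unfolding X .
  qed
  thus ?thesis using c0 by blast
qed

lemma rho_at_top:
  assumes n: "filterlim n at_top sequentially" and k: "\<And>i. k i \<le> d * n i" and n0: "\<And>i. n i > 0"
  shows "filterlim (\<lambda>i. rho (n i) (k i)) at_top sequentially"
proof (rule filterlim_at_top_mono)
  have "(\<lambda>i. bb (n i)) \<longlonglongrightarrow> 0" by (rule filterlim_compose[OF summable_LIMSEQ_zero[OF summable_bb] n])
  moreover have bp: "bb m > 0" for m using theta by (simp add: bb_def)
  ultimately show "filterlim (\<lambda>i. inverse (bb (n i))) at_top sequentially"
    by (intro filterlim_inverse_at_top) auto
  have "inverse (bb (n i)) \<le> rho (n i) (k i)" for i
    using bb_rho_ge_1[OF n0 k, of i] bp[of "n i"] by (simp add: field_simps)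
  thus "\<forall>\<^sub>F i in sequentially. inverse (bb (n i)) \<le> rho (n i) (k i)" by simp
qed

text \<open>Here l is the time until the orbit leaves the tower of (n, k), the scale is rho and the
  centring is the average over that tower. The edge x (n - 1) guarantees that a complete tower of (n
  - 1, k) is still ahead.\<close>

theorem limit_curve_along:
  assumes x: "x \<in> Xp a d" and n: "filterlim n at_top sequentially"
    and s: "(\<lambda>i. (real (vert x (n i)) - real (n i) * mean) / sqrt (real (n i))) \<longlonglongrightarrow> s"
    and gs: "gr var r s \<noteq> 0" and xe: "\<And>i. x (n i - 1) = (d, 0)"
    and kd: "\<And>i. vert x (n i) \<ge> d" and nN: "\<And>i. n i \<ge> N + 3"
  shows "has_limit_curve a d g x"
proof -
  define k where "k = (\<lambda>i. vert x (n i))"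
  have s: "(\<lambda>i. (real (k i) - real (n i) * mean) / sqrt (real (n i))) \<longlonglongrightarrow> s" using s by (simp add: k_def)
  have kd: "k i \<ge> d" for i using kd by (simp add: k_def)
  have apos': "\<forall>j\<le>d. 0 < a j" using apos by blast
  define \<delta> where "\<delta> = gr var 0 s / 2"
  have dl: "\<delta> > 0" using gr_0_pos[OF var_pos] by (simp add: \<delta>_def)
  obtain c0 where c0: "c0 > 0" and low: "\<forall>\<^sub>F i in sequentially. c0 * rho (n i) (k i) \<le>
     \<bar>real (a d) * Gs a d g (n i - 2) (k i - d) - real (a d) * Hs (n i - 2) (k i - d) / Hs (n i - 1) (k i) * Gs a d g (n i - 1) (k i)\<bar>"
    using deviation_lower[OF n s gs kd nN] by blast
  obtain I where I: "\<And>i. i \<ge> I \<Longrightarrow> c0 * rho (n i) (k i) \<le>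
     \<bar>real (a d) * Gs a d g (n i - 2) (k i - d) - real (a d) * Hs (n i - 2) (k i - d) / Hs (n i - 1) (k i) * Gs a d g (n i - 1) (k i)\<bar>"
     "\<And>i. i \<ge> I \<Longrightarrow> \<delta> / sqrt (real (n i)) \<le> Ph (n i) (k i)"
     "\<And>i. i \<ge> I \<Longrightarrow> 0 < Ph (n i - 1) (k i)" "\<And>i. i \<ge> I \<Longrightarrow> 0 < Ph (n i - 2) (k i - (d - 1))"
    using eventually_conj[OF low eventually_conj[OF Ph_lower[OF n s, of 0 0] eventually_conj[OF Ph_lower[OF n s, of 1 0] Ph_lower[OF n s, of 2 "d - 1"]]]]
    unfolding eventually_sequentially \<delta>_def by (metis diff_zero)
  \<comment> \<open>Drops the first I levels: the criterion wants for every index what is known only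
    eventually.\<close>
  define n' where "n' = (\<lambda>i. n (i + I))"
  define k' where "k' = (\<lambda>i. vert x (n' i))"
  have k'k: "k' i = k (i + I)" for i by (simp add: k'_def n'_def k_def)
  have n': "filterlim n' at_top sequentially" unfolding n'_def
    by (rule filterlim_compose[OF n filterlim_add_const_nat_at_top])
  have s': "(\<lambda>i. (real (k' i) - real (n' i) * mean) / sqrt (real (n' i))) \<longlonglongrightarrow> s"
    using LIMSEQ_ignore_initial_segment[OF s, of I] by (simp add: k'k n'_def)
  have n0: "n' i > 0" "N \<le> n' i" "N + 3 \<le> n' i" for i using nN[of "i + I"] by (auto simp: n'_def)
  have ph: "\<delta> / sqrt (real (n' i)) \<le> Ph (n' i) (k' i)" for i using I(2)[of "i + I"] by (simp add: k'k n'_def)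
  define H where "H = (\<lambda>i. card (cls a d (n' i) x))"
  define l where "l = (\<lambda>i. H i - pos a d (n' i) x)"
  define \<rho> where "\<rho> = (\<lambda>i. rho (n' i) (k' i))"
  define sl where "sl = (\<lambda>i. slope (n' i) (k' i))"
  define f where "f = (\<lambda>i x. g x - sl i)"
  have HHs: "real (H i) = Hs (n' i) (k' i)" for i
    unfolding H_def Hs_def k'_def by (rule card_cls_eq_Gs[of x a d, OF x a0])
  have posH: "pos a d (n' i) x < H i" for i unfolding H_def by (rule pos_less[OF x])
  have l0: "l i > 0" for i using posH[of i] by (simp add: l_def)
  have lH: "pos a d (n' i) x + l i = H i" for i using posH[of i] by (simp add: l_def)
  have r0: "\<rho> i > 0" for i unfolding \<rho>_def by (rule rho_pos[OF n0(1)])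
  have rinf: "filterlim \<rho> at_top sequentially" unfolding \<rho>_def k'_def
    by (rule rho_at_top[OF n' vert_le[OF x] n0(1)])
  obtain B where B: "B > 0" "\<And>x. x \<in> Xp a d \<Longrightarrow> \<bar>g x\<bar> \<le> B" using g_bounded by blast
  have fb: "\<bar>f i y\<bar> \<le> 2 * B" if "y \<in> Xp a d" for i y
    using B(2)[OF that] slope_bound[OF B(2) B(1), of "n' i" "k' i"] unfolding f_def sl_def by linarith
  obtain C where C: "C > 0" "\<And>n j0 y. N \<le> j0 \<Longrightarrow> j0 \<le> n \<Longrightarrow> 0 < n \<Longrightarrow> y \<in> Xp a d \<Longrightarrow> Ph n (vert y n) \<ge> \<delta> / sqrt (real n) \<Longrightarrow>
     \<bar>Fs a d j0 (\<lambda>x. g x - slope n (vert y n)) y\<bar> \<le> C * tail (n - j0) * rho n (vert y n)"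
    using Fs_bound[OF dl] by blast
  have Fb: "\<bar>Fs a d j0 (f i) w\<bar> \<le> C * tail (n' i - j0) * \<rho> i" if "w \<in> cls a d (n' i) x" "N \<le> j0" "j0 \<le> n' i" for i j0 w
  proof -
    have "vert w (n' i) = k' i" "w \<in> Xp a d" using that(1) by (auto simp: cls_def tower_def k'_def)
    thus ?thesis using C(2)[OF that(2,3) n0(1), of w] ph[of i] by (simp add: f_def sl_def \<rho>_def)
  qed
  have tot0: "(\<Sum>y\<in>cls a d (n' i) x. f i y) = 0" for i
  proof -
    have "(\<Sum>y\<in>cls a d (n' i) x. f i y) = Gs a d (f i) (n' i) (k' i)"
      unfolding k'_def using cls_sum_eq_Gs[OF cylindric_diff_const[OF cyl, of "sl i"] n0(2) x a0] by (simp add: f_def)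
    also have "\<dots> = Gs a d g (n' i) (k' i) - sl i * Hs (n' i) (k' i)" unfolding f_def by (rule Gs_centered)
    also have "\<dots> = 0" using HHs[of i] posH[of i] by (simp add: sl_def slope_def)
    finally show ?thesis .
  qed
  have tot: "\<bar>Sg a d (f i) x (l i)\<bar> \<le> (2 * C * tail 0) * \<rho> i" for i
  proof -
    have "\<bar>Sg a d (f i) x (l i)\<bar> \<le> 2 * (C * tail 0 * \<rho> i)"
    proof (rule Sg_in_cls_bound[OF x _ tot0])
      show "pos a d (n' i) x + l i \<le> card (cls a d (n' i) x)" using lH[of i] by (simp add: H_def)
      show "\<bar>Fs a d (n' i) (f i) w\<bar> \<le> C * tail 0 * \<rho> i" if "w \<in> cls a d (n' i) x" for w
        using Fb[OF that n0(2) order.refl] by simp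
    qed
    thus ?thesis by simp
  qed
  have R: "c0 / 4 * \<rho> i \<le> Rg a d g x (l i)" for i
  proof -
    have H1: "Gs a d (\<lambda>_. 1) (n' i - 1) (k' i) > 0" "Gs a d (\<lambda>_. 1) (n' i - 2) (k' i - (d - 1)) > 0"
      using I(3,4)[of "i + I"] wt_pos unfolding Hs_def[symmetric] Hs_eq by (simp_all add: k'k n'_def)
    have n2: "N + 2 \<le> n' i" using n0(3)[of i] by simp
    have xe': "x (n' i - 1) = (d, 0)" using xe by (simp add: n'_def)
    have k'eq: "k' i = vert x (n' i)" by (simp add: k'_def)
    have kk: "d \<le> k' i" using kd by (simp add: k'k)
    obtain j e h where jeh: "real e = real (a d) * Gs a d (\<lambda>_. 1) (n' i - 2) (k' i - d)"
       "real h = Gs a d (\<lambda>_. 1) (n' i - 1) (k' i)" "e \<le> h" "0 < h"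
       "pos a d (n' i) x + j + h \<le> card (cls a d (n' i) x)"
       "Sg a d g x (j + e) - Sg a d g x j = real (a d) * Gs a d g (n' i - 2) (k' i - d)"
       "Sg a d g x (j + h) - Sg a d g x j = Gs a d g (n' i - 1) (k' i)"
      using orbit_three_points[OF x apos' d1 cyl n2 xe' k'eq kk H1] by blast
    have "j + h \<le> l i" using jeh(5) by (simp add: l_def H_def)
    from Rg_three_points[OF this jeh(3,4), of a d g x]
    have "\<bar>real (a d) * Gs a d g (n' i - 2) (k' i - d) - real (a d) * Hs (n' i - 2) (k' i - d) / Hs (n' i - 1) (k' i) * Gs a d g (n' i - 1) (k' i)\<bar>
       \<le> 4 * Rg a d g x (l i)"
      unfolding jeh(6,7) jeh(1,2) Hs_def[symmetric] .
    moreover have "c0 * \<rho> i \<le> \<bar>real (a d) * Gs a d g (n' i - 2) (k' i - d) - real (a d) * Hs (n' i - 2) (k' i - d) / Hs (n' i - 1) (k' i) * Gs a d g (n' i - 1) (k' i)\<bar>"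
      using I(1)[of "i + I"] by (simp add: \<rho>_def k'k n'_def)
    ultimately show ?thesis by linarith
  qed
  have TX: "(Tp a d ^^ j) x \<in> Xp a d" for j by (rule Tp_pow_Xp[OF x])
  have linf: "filterlim l at_top sequentially"
  proof -
    \<comment> \<open>R is at most linear in l and at least of order \<rho>, which tends to
      infinity; hence so does l.\<close>
    have Rl: "Rg a d g x (l i) \<le> 6 * B * real (l i)" for i
    proof (rule Rg_le)
      fix t :: real assume t: "t \<in> {0..1}"
      have Sb: "\<bar>Sg a d (f i) x j\<bar> \<le> real j * (2 * B)" for j
      proof -
        have "\<bar>Sg a d (f i) x j\<bar> \<le> (\<Sum>k<j. \<bar>f i ((Tp a d ^^ k) x)\<bar>)" unfolding Sg_def by (rule sum_abs)
        also have "\<dots> \<le> (\<Sum>k<j. 2 * B)" by (intro sum_mono fb TX)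
        finally show ?thesis by simp
      qed
      have tl: "t * real (l i) \<le> real (l i)" "0 \<le> t * real (l i)" using t by (auto simp: mult_left_le_one_le)
      hence nl: "nat \<lfloor>t * real (l i)\<rfloor> \<le> l i" by linarith
      have "\<bar>Sg a d (f i) x (nat \<lfloor>t * real (l i)\<rfloor>)\<bar> \<le> real (l i) * (2 * B)"
        using Sb[of "nat \<lfloor>t * real (l i)\<rfloor>"] nl B(1) by (smt (verit, best) mult_right_mono of_nat_mono)
      hence 1: "\<bar>Fg a d (f i) x (t * real (l i))\<bar> \<le> real (l i) * (2 * B) + 2 * B"
        using Fg_near[OF tl(2), of "f i" a d x "2 * B"] fb TX by simp
      have "\<bar>t * Sg a d (f i) x (l i)\<bar> \<le> 1 * (real (l i) * (2 * B))"
        unfolding abs_mult using t Sb[of "l i"] by (intro mult_mono) auto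
      moreover have "2 * B * 1 \<le> 2 * B * real (l i)" using B(1) l0[of i] by (intro mult_left_mono) auto
      moreover have "dev a d g x (l i) t = Fg a d (f i) x (t * real (l i)) - t * Sg a d (f i) x (l i)"
        using dev_centered[of t a d g x "l i" "sl i"] t by (simp add: dev_def Fg_of_nat f_def)
      ultimately show "\<bar>dev a d g x (l i) t\<bar> \<le> 6 * B * real (l i)" using 1 by (simp add: algebra_simps)
    qed
    have "filterlim (\<lambda>i. real (l i)) at_top sequentially"
    proof (rule filterlim_at_top_mono)
      show "filterlim (\<lambda>i. (c0 / (24 * B)) * \<rho> i) at_top sequentially"
        by (rule filterlim_tendsto_pos_mult_at_top[OF tendsto_const _ rinf]) (use c0 B in simp)
      have "(c0 / (24 * B)) * \<rho> i \<le> real (l i)" for i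
        using order.trans[OF R Rl, of i] B(1) by (simp add: field_simps)
      thus "\<forall>\<^sub>F i in sequentially. (c0 / (24 * B)) * \<rho> i \<le> real (l i)" by simp
    qed
    thus ?thesis unfolding filterlim_sequentially_iff_filterlim_real .
  qed
  have eqc: "\<exists>\<delta>>0. \<forall>\<^sub>F i in sequentially. \<forall>j j'. j \<le> j' \<longrightarrow> j' \<le> l i \<longrightarrow> real (j' - j) \<le> \<delta> * real (l i) \<longrightarrow>
        \<bar>Sg a d (f i) x j' - Sg a d (f i) x j\<bar> \<le> \<eta> * \<rho> i" if eta: "\<eta> > 0" for \<eta>
  proof -
    have "(\<lambda>M. 3 * C * tail M) \<longlonglongrightarrow> 3 * C * 0" by (intro tendsto_intros tail_tendsto)
    hence "\<forall>\<^sub>F M in sequentially. 3 * C * tail M < \<eta> / 2" by (rule order_tendstoD) (use eta in simp)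
    then obtain M where M: "3 * C * tail M < \<eta> / 2" by (auto simp: eventually_sequentially)
    \<comment> \<open>A lower bound for the weight of M consecutive edges. With the ratio 1 / 4 of
      \<open>Ph_ratio\<close>, every tower met M levels down is at least m0 / 4 times as high as the
      full one, so stretches of length m0 / 8 * l satisfy the height condition of
      \<open>Sg_modulus\<close>.\<close>
    define m0 where "m0 = q ^ M * (min 1 z) ^ (d * M)"
    have m0: "m0 > 0" using q0 z0 by (simp add: m0_def)
    have evr: "\<forall>\<^sub>F i in sequentially. \<forall>e\<in>{..d * M}. Ph (n' i) (k' i) / 4 \<le> Ph (n' i - M) (k' i - e)"
      using Ph_ratio[OF n' s'] by (intro eventually_ball_finite) auto
    have evM: "\<forall>\<^sub>F i in sequentially. N + M \<le> n' i"
      using eventually_compose_filterlim[OF eventually_ge_at_top n'] .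
    have evB: "\<forall>\<^sub>F i in sequentially. 8 * B / \<eta> \<le> \<rho> i" using rinf unfolding filterlim_at_top by blast
    have "\<forall>\<^sub>F i in sequentially. \<forall>j j'. j \<le> j' \<longrightarrow> j' \<le> l i \<longrightarrow> real (j' - j) \<le> m0 / 8 * real (l i) \<longrightarrow>
        \<bar>Sg a d (f i) x j' - Sg a d (f i) x j\<bar> \<le> \<eta> * \<rho> i"
      using evr evM evB
    proof eventually_elim
      case (elim i)
      define j0 where "j0 = n' i - M"
      have j0: "N \<le> j0" "j0 \<le> n' i" "n' i - j0 = M" "n' i = j0 + M" using elim(2) by (auto simp: j0_def)
      have cardw: "real t < real (card (cls a d j0 w))" if w: "w \<in> cls a d (n' i) x" and t: "real t \<le> m0 / 8 * real (l i)" for t w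
      proof -
        have wX: "w \<in> Xp a d" using w cls_Xp by blast
        define e where "e = (\<Sum>i=j0..<n' i. fst (w i))"
        have v: "vert w (n' i) = vert w j0 + e" unfolding e_def by (rule vert_add_tail[OF j0(2)])
        have "e \<le> (\<Sum>i=j0..<n' i. d)" unfolding e_def using wX by (intro sum_mono) (auto simp: Xp_def)
        hence e: "e \<le> d * M" using j0 by (simp add: mult.commute)
        have "vert w (n' i) = k' i" using w by (simp add: cls_def tower_def k'_def)
        hence vk: "vert w j0 = k' i - e" "e \<le> k' i" using v by auto
        have wt: "wt (n' i) (k' i) = wt j0 (k' i - e) * (q ^ M * z ^ e)"
        proof -
          have "z ^ k' i = z ^ (k' i - e) * z ^ e" using vk(2) by (simp flip: power_add)
          thus ?thesis using j0(4) by (simp add: wt_def power_add)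
        qed
        have "min 1 z ^ (d * M) \<le> min 1 z ^ e" using e z0 by (intro power_decreasing) auto
        also have "\<dots> \<le> z ^ e" using z0 by (intro power_mono) auto
        finally have m0le: "m0 \<le> q ^ M * z ^ e" unfolding m0_def using q0 by (intro mult_left_mono) auto
        have Hp: "real (H i) > 0" using posH[of i] by simp
        have "real t \<le> m0 / 8 * real (H i)"
          using t m0 lH[of i] by (intro order.trans[OF t] mult_left_mono) auto
        also have "\<dots> < m0 / 4 * real (H i)" using m0 Hp by simp
        also have "\<dots> \<le> (q ^ M * z ^ e) * (real (H i) / 4)" using m0le Hp by simp
        also have "\<dots> = (q ^ M * z ^ e) * (Ph (n' i) (k' i) / 4) / wt (n' i) (k' i)" unfolding HHs Hs_eq by simp
        also have "\<dots> \<le> (q ^ M * z ^ e) * Ph j0 (k' i - e) / wt (n' i) (k' i)"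
          using elim(1) e q0 z0 wt_pos unfolding j0_def by (intro divide_right_mono mult_left_mono) (auto simp: less_imp_le)
        also have "\<dots> = Hs j0 (k' i - e)" unfolding wt Hs_eq using q0 z0 by simp
        also have "\<dots> = real (card (cls a d j0 w))"
          unfolding Hs_def vk(1)[symmetric] by (rule card_cls_eq_Gs[of w a d, symmetric, OF wX a0])
        finally show ?thesis .
      qed
      have B8: "4 * B \<le> \<eta> / 2 * \<rho> i" using elim(3) eta by (simp add: field_simps)
      have M': "3 * (C * tail M * \<rho> i) \<le> \<eta> / 2 * \<rho> i" using M r0[of i] by simp
      have inner: "\<bar>Sg a d (f i) x j' - Sg a d (f i) x j\<bar> \<le> 3 * (C * tail M * \<rho> i) + 2 * B"
        if jj: "j \<le> j'" "j' < l i" "real (j' - j) \<le> m0 / 8 * real (l i)" for j j'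
      proof -
        define y where "y = (Tp a d ^^ j) x"
        have "pos a d (n' i) x + j < card (cls a d (n' i) x)" using jj lH[of i] by (simp add: H_def)
        from Tp_pow_cls[OF x this] have y: "y \<in> cls a d (n' i) x" "pos a d (n' i) y = pos a d (n' i) x + j" by (auto simp: y_def)
        have yc: "cls a d (n' i) y = cls a d (n' i) x" by (rule cls_eq[OF y(1)])
        have "\<bar>Sg a d (f i) y (j' - j)\<bar> \<le> 3 * (C * tail M * \<rho> i) + 2 * B"
        proof (rule Sg_modulus[of y a d "n' i" "j' - j" j0])
          show "y \<in> Xp a d" by (simp add: y_def TX)
          show "pos a d (n' i) y + (j' - j) < card (cls a d (n' i) y)" using jj lH[of i] y yc by (simp add: H_def)
          show "j' - j < card (cls a d j0 w)" if "w \<in> cls a d (n' i) y" for w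
            using cardw[of w "j' - j"] that yc jj(3) by simp
          show "\<bar>Fs a d j0 (f i) w\<bar> \<le> C * tail M * \<rho> i" if "w \<in> cls a d (n' i) y" for w
            using Fb[of w i j0] that yc j0 by simp
        qed (use j0 fb in auto)
        thus ?thesis using Sg_add[of a d "f i" x j "j' - j"] jj(1) by (simp add: y_def)
      qed
      show ?case
      proof (intro allI impI)
        fix j j' assume jj: "j \<le> j'" "j' \<le> l i" "real (j' - j) \<le> m0 / 8 * real (l i)"
        show "\<bar>Sg a d (f i) x j' - Sg a d (f i) x j\<bar> \<le> \<eta> * \<rho> i"
        proof (cases "j = j'")
          case True
          thus ?thesis using eta r0[of i] by simp
        next
          case False
          \<comment> \<open>For j' = l i the orbit has already left the tower, so the last summand,
            at most 2 * B, is split off.\<close>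
          define p where "p = j' - 1"
          have p: "j \<le> p" "p < l i" "j' = Suc p" "real (p - j) \<le> m0 / 8 * real (l i)"
            using False jj l0[of i] by (auto simp: p_def)
          have "\<bar>Sg a d (f i) x p - Sg a d (f i) x j\<bar> \<le> 3 * (C * tail M * \<rho> i) + 2 * B" by (rule inner[OF p(1,2,4)])
          moreover have "Sg a d (f i) x j' = Sg a d (f i) x p + f i ((Tp a d ^^ p) x)" unfolding p(3) by (rule Sg_Suc)
          moreover have "\<bar>f i ((Tp a d ^^ p) x)\<bar> \<le> 2 * B" by (rule fb[OF TX])
          ultimately have "\<bar>Sg a d (f i) x j' - Sg a d (f i) x j\<bar> \<le> 3 * (C * tail M * \<rho> i) + 4 * B" by linarith
          also have "\<dots> \<le> \<eta> * \<rho> i" using B8 M' by (simp add: field_simps)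
          finally show ?thesis .
        qed
      qed
    qed
    moreover have "m0 / 8 > 0" using m0 by simp
    ultimately show ?thesis by blast
  qed
  show ?thesis
  proof (rule limit_curve_criterion[where l = l and s = sl and \<rho> = \<rho> and b = "2 * B" and C = "2 * C * tail 0" and ?c0.0 = "c0 / 4"])
    show "\<bar>g ((Tp a d ^^ j) x) - sl i\<bar> \<le> 2 * B" for i j using fb[OF TX, of i j] by (simp add: f_def)
  qed (use l0 linf r0 rinf eqc tot R c0 in \<open>auto simp: f_def\<close>)
qed

end

section \<open>The product measure\<close>

context adic_system
begin

text \<open>Substituting t = q * y turns the defining polynomial into q ^ (d - 1) times the total
  edge weight; uniqueness is strict monotonicity, and q * z < 1 follows from the edges of types 0
  and 1.\<close>

lemma tq_eq: "tq a d q = q * z"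
proof -
  let ?p = "\<lambda>t. \<Sum>j\<le>d. real (a j) * q ^ (d - j) * t ^ j"
  have eq: "?p (q * y) = q ^ (d - 1) * (\<Sum>j\<le>d. real (a j) * q * y ^ j)" for y
  proof -
    have "real (a j) * q ^ (d - j) * (q * y) ^ j = q ^ (d - 1) * (real (a j) * q * y ^ j)" if "j \<le> d" for j
    proof -
      have "q ^ (d - j) * q ^ j = q ^ (d - 1) * q"
        using that d1 by (simp flip: power_add power_Suc2)
      thus ?thesis by (simp add: power_mult_distrib algebra_simps)
    qed
    thus ?thesis unfolding sum_distrib_left by (intro sum.cong) auto
  qed
  have mono: "?p t < ?p t'" if "0 < t" "t < t'" for t t'
  proof (rule sum_strict_mono_ex1)
    show "\<forall>j\<in>{..d}. real (a j) * q ^ (d - j) * t ^ j \<le> real (a j) * q ^ (d - j) * t' ^ j"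
      using that q0 by (intro ballI mult_left_mono power_mono) auto
    show "\<exists>j\<in>{..d}. real (a j) * q ^ (d - j) * t ^ j < real (a j) * q ^ (d - j) * t' ^ j"
      using that q0 apos[of d] d1 by (intro bexI[of _ d] mult_strict_left_mono power_strict_mono) auto
  qed simp
  have "(\<Sum>j\<in>{0, 1}. real (a j) * q * z ^ j) \<le> 1"
    unfolding weights[symmetric] using q0 z0 d1 by (intro sum_mono2) auto
  hence "real (a 0) * q + real (a 1) * q * z \<le> 1" by simp
  moreover have "0 < real (a 0) * q" using a0 q0 by simp
  moreover have "1 * (q * z) \<le> real (a 1) * (q * z)" using apos[of 1] d1 q0 z0 by (intro mult_right_mono) auto
  ultimately have lt1: "q * z < 1" by simp
  show ?thesis unfolding tq_def
  proof (rule the_equality)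
    show "0 < q * z \<and> q * z < 1 \<and> ?p (q * z) = q ^ (d - 1)" using eq[of z] weights q0 z0 lt1 by simp
    fix t assume t: "0 < t \<and> t < 1 \<and> ?p t = q ^ (d - 1)"
    show "t = q * z"
      using mono[of t "q * z"] mono[of "q * z" t] t eq[of z] weights q0 z0 by (cases t "q * z" rule: linorder_cases) auto
  qed
qed

lemma edge_weight_eq: "edge_weight a d q e = (if e \<in> edges a d then q * z ^ fst e else 0)"
  using q0 by (simp add: edge_weight_def tq_eq in_edges power_mult_distrib)

lemma sets_edge [simp, measurable_cong]: "sets (edge_measure a d q) = sets (count_space UNIV)"
  by (simp add: edge_measure_def)

lemma space_edge [simp]: "space (edge_measure a d q) = UNIV"
  by (simp add: edge_measure_def)

lemma emeasure_edge: "emeasure (edge_measure a d q) A = ennreal (\<Sum>e\<in>edges a d \<inter> A. q * z ^ fst e)"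
proof -
  have "emeasure (edge_measure a d q) A = (\<integral>\<^sup>+e. ennreal (edge_weight a d q e) * indicator A e \<partial>count_space UNIV)"
    unfolding edge_measure_def by (rule emeasure_density) auto
  also have "\<dots> = (\<Sum>e\<in>edges a d \<inter> A. ennreal (edge_weight a d q e) * indicator A e)"
    by (rule nn_integral_count_space') (auto simp: edge_weight_eq indicator_def)
  also have "\<dots> = (\<Sum>e\<in>edges a d \<inter> A. ennreal (q * z ^ fst e))"
    by (intro sum.cong) (auto simp: edge_weight_eq)
  also have "\<dots> = ennreal (\<Sum>e\<in>edges a d \<inter> A. q * z ^ fst e)"
    using q0 z0 by (intro sum_ennreal) auto
  finally show ?thesis .
qed

lemma measure_edge: "measure (edge_measure a d q) A = (\<Sum>e\<in>edges a d \<inter> A. q * z ^ fst e)"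
  unfolding measure_def emeasure_edge using q0 z0 by (intro enn2real_ennreal sum_nonneg) auto

lemma sum_edges: "(\<Sum>e\<in>edges a d. f (fst e)) = (\<Sum>j\<le>d. real (a j) * f j)"
proof -
  have "(\<Sum>j\<le>d. real (a j) * f j) = (\<Sum>j\<le>d. \<Sum>c<a j. f j)" by simp
  also have "\<dots> = (\<Sum>(j, c)\<in>edges a d. f j)" unfolding edges_def by (rule sum.Sigma) auto
  finally show ?thesis by (simp add: split_beta)
qed

lemma edge_prob: "prob_space (edge_measure a d q)"
proof
  show "emeasure (edge_measure a d q) (space (edge_measure a d q)) = 1"
    unfolding emeasure_edge space_edge
    using sum_edges[of "\<lambda>j. q * z ^ j"] weights by (simp add: mult.assoc)
qed

lemma measure_edge_type: "measure (edge_measure a d q) {e. fst e = j} = coeff P j"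
proof -
  have "measure (edge_measure a d q) {e. fst e = j} = (\<Sum>e\<in>edges a d. if fst e = j then q * z ^ fst e else 0)"
    unfolding measure_edge by (subst sum.inter_restrict) simp_all
  also have "\<dots> = (\<Sum>i\<le>d. real (a i) * (if i = j then q * z ^ i else 0))" by (rule sum_edges)
  also have "\<dots> = coeff P j" by (simp add: coeff_Ppoly if_distrib sum.delta cong: if_cong)
  finally show ?thesis .
qed

lemma mu_prob: "prob_space (mu a d q)"
  unfolding mu_def by (intro prob_space_PiM edge_prob)

lemma space_mu [simp]: "space (mu a d q) = UNIV"
  by (simp add: mu_def space_PiM)

lemma sets_mu [measurable_cong]: "sets (mu a d q) = sets (PiM UNIV (\<lambda>_. edge_measure a d q))"
  by (simp add: mu_def)

lemma coord_measurable: "(\<lambda>x. x i) \<in> measurable (mu a d q) (edge_measure a d q)"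
  unfolding mu_def by (rule measurable_component_singleton) simp

lemma distr_coord: "distr (mu a d q) (edge_measure a d q) (\<lambda>x. x i) = edge_measure a d q"
  unfolding mu_def by (rule distr_PiM_component) (auto intro: edge_prob)

lemma measure_coord: "measure (mu a d q) {x. Q (x i)} = measure (edge_measure a d q) {e. Q e}"
proof -
  have "measure (edge_measure a d q) {e. Q e} = measure (distr (mu a d q) (edge_measure a d q) (\<lambda>x. x i)) {e. Q e}"
    by (simp add: distr_coord)
  also have "\<dots> = measure (mu a d q) {x. Q (x i)}"
    by (subst measure_distr[OF coord_measurable]) (auto intro!: arg_cong[where f = "measure (mu a d q)"])
  finally show ?thesis ..
qed

lemma AE_Xp: "AE x in mu a d q. x \<in> Xp a d"
proof -
  have "AE e in edge_measure a d q. e \<in> edges a d"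
  proof (rule AE_I[where N = "- edges a d"])
    show "emeasure (edge_measure a d q) (- edges a d) = 0" by (simp add: emeasure_edge)
  qed auto
  hence "AE x in mu a d q. x i \<in> edges a d" for i
    unfolding mu_def by (intro AE_PiM_component edge_prob) auto
  hence "AE x in mu a d q. \<forall>i. x i \<in> edges a d" by (simp add: AE_all_countable)
  thus ?thesis by (simp add: Xp_iff)
qed

lemma indep_coords: "prob_space.indep_vars (mu a d q) (\<lambda>_. edge_measure a d q) (\<lambda>i x. x i) UNIV"
proof -
  interpret mu: prob_space "mu a d q" by (rule mu_prob)
  show ?thesis
  proof (subst mu.indep_vars_iff_distr_eq_PiM)
    show "distr (mu a d q) (PiM UNIV (\<lambda>i. edge_measure a d q)) (\<lambda>x. \<lambda>i\<in>UNIV. x i) =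
        PiM UNIV (\<lambda>i. distr (mu a d q) (edge_measure a d q) (\<lambda>x. x i))"
      unfolding distr_coord by (simp add: mu_def restrict_UNIV)
  qed (auto intro: coord_measurable)
qed

lemma indep_two:
  assumes "A \<inter> B = {}"
    and A: "{y \<in> space (PiM A (\<lambda>_. edge_measure a d q)). R1 y} \<in> sets (PiM A (\<lambda>_. edge_measure a d q))"
    and B: "{y \<in> space (PiM B (\<lambda>_. edge_measure a d q)). R2 y} \<in> sets (PiM B (\<lambda>_. edge_measure a d q))"
  shows "measure (mu a d q) {x. R1 (restrict x A) \<and> R2 (restrict x B)} =
     measure (mu a d q) {x. R1 (restrict x A)} * measure (mu a d q) {x. R2 (restrict x B)}"
proof -
  interpret mu: prob_space "mu a d q" by (rule mu_prob)
  have sp: "restrict x C \<in> space (PiM C (\<lambda>_. edge_measure a d q))" for x and C :: "nat set"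
    by (simp add: space_PiM)
  have ind: "mu.indep_var (PiM A (\<lambda>_. edge_measure a d q)) (\<lambda>\<omega>. restrict (\<lambda>i. \<omega> i) A)
      (PiM B (\<lambda>_. edge_measure a d q)) (\<lambda>\<omega>. restrict (\<lambda>i. \<omega> i) B)"
    by (rule mu.indep_var_restrict[OF indep_coords assms(1)]) auto
  from mu.indep_varD[OF ind A B] show ?thesis
    using sp by (simp add: vimage_def)
qed

text \<open>By continuity from above the limsup event has probability at least c > 0, which the
  zero-one law for independent events lifts to 1.\<close>

lemma blocks_infinitely_often:
  assumes K: "disjoint_family K"
    and Q: "\<And>i. {y \<in> space (PiM (K i) (\<lambda>_. edge_measure a d q)). Q i y} \<in> sets (PiM (K i) (\<lambda>_. edge_measure a d q))"
    and c: "c > 0" "\<forall>\<^sub>F i in sequentially. c \<le> measure (mu a d q) {x. Q i (restrict x (K i))}"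
  shows "AE x in mu a d q. infinite {i. Q i (restrict x (K i))}"
proof -
  interpret mu: prob_space "mu a d q" by (rule mu_prob)
  define F where "F = (\<lambda>i. {x. Q i (restrict x (K i))})"
  have iv: "mu.indep_vars (\<lambda>i. PiM (K i) (\<lambda>_. edge_measure a d q)) (\<lambda>i \<omega>. restrict (\<lambda>j. \<omega> j) (K i)) UNIV"
    by (rule mu.indep_vars_restrict[OF indep_coords]) (use K in auto)
  have ie: "mu.indep_events F UNIV"
    using mu.indep_eventsI_indep_vars[OF iv, of Q] Q by (simp add: F_def)
  hence Fm: "F i \<in> sets (mu a d q)" for i by (auto simp: mu.indep_events_def)
  have lim: "(\<lambda>n. mu.prob (\<Union>m\<in>{n..}. F m)) \<longlonglongrightarrow> mu.prob (\<Inter>n. \<Union>m\<in>{n..}. F m)"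
  proof (rule mu.finite_Lim_measure_decseq)
    show "range (\<lambda>n. \<Union>m\<in>{n..}. F m) \<subseteq> sets (mu a d q)" using Fm by auto
    show "decseq (\<lambda>n. \<Union>m\<in>{n..}. F m)" unfolding decseq_def by force
  qed
  have ge: "c \<le> mu.prob (\<Union>m\<in>{n..}. F m)" for n
  proof -
    obtain i where i: "i \<ge> n" "c \<le> mu.prob (F i)"
      using c(2) unfolding eventually_sequentially F_def by (meson nle_le)
    have "mu.prob (F i) \<le> mu.prob (\<Union>m\<in>{n..}. F m)"
      using i Fm by (intro mu.finite_measure_mono) auto
    thus ?thesis using i by simp
  qed
  have "c \<le> mu.prob (\<Inter>n. \<Union>m\<in>{n..}. F m)"
    by (rule LIMSEQ_le_const[OF lim]) (use ge in auto)
  hence "mu.prob (\<Inter>n. \<Union>m\<in>{n..}. F m) = 1"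
    using mu.borel_0_1_law[OF ie] c(1) by auto
  hence "AE x in mu a d q. x \<in> (\<Inter>n. \<Union>m\<in>{n..}. F m)"
    using Fm by (subst mu.prob_eq_1[symmetric]) auto
  thus ?thesis
    by eventually_elim (auto simp: infinite_nat_iff_unbounded_le F_def)
qed

lemma type_measurable:
  assumes "j \<in> K"
  shows "(\<lambda>y. real (fst (y j))) \<in> borel_measurable (PiM K (\<lambda>_. edge_measure a d q))"
proof -
  have "(\<lambda>e. real (fst e)) \<in> borel_measurable (edge_measure a d q)"
    by (subst measurable_cong_sets[OF sets_edge refl]) simp
  from measurable_compose[OF measurable_component_singleton[OF assms] this] show ?thesis .
qed

lemma type_sum_measurable:
  assumes "S \<subseteq> K"
  shows "(\<lambda>y. \<Sum>j\<in>S. real (fst (y j))) \<in> borel_measurable (PiM K (\<lambda>_. edge_measure a d q))"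
  using assms by (intro borel_measurable_sum type_measurable) auto

lemma type_sum_event:
  assumes "S \<subseteq> K"
  shows "{y \<in> space (PiM K (\<lambda>_. edge_measure a d q)). (\<Sum>j\<in>S. real (fst (y j))) \<in> {u..v}} \<in> sets (PiM K (\<lambda>_. edge_measure a d q))"
  using measurable_sets[OF type_sum_measurable[OF assms], of "{u..v}"] by (simp add: vimage_def Int_def conj_commute)

text \<open>One more coordinate convolves the law with that of a single edge type, which is
  multiplication by \<open>P\<close>.\<close>

lemma measure_type_sum:
  assumes "finite S"
  shows "measure (mu a d q) {x. (\<Sum>j\<in>S. real (fst (x j))) = real k} = coeff (P ^ card S) k"
  using assms
proof (induction S arbitrary: k rule: finite_induct)
  case empty
  interpret mu: prob_space "mu a d q" by (rule mu_prob)
  have "{x. (\<Sum>j\<in>{}. real (fst (x j))) = real k} = (if k = 0 then space (mu a d q) else {})"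
    for x :: "nat \<Rightarrow> nat \<times> nat" by auto
  thus ?case using mu.prob_space by (auto simp: coeff_1)
next
  case (insert i S)
  interpret mu: prob_space "mu a d q" by (rule mu_prob)
  define ev where "ev = (\<lambda>e. {x :: nat \<Rightarrow> nat \<times> nat. real (fst (x i)) = real e \<and> (\<Sum>j\<in>S. real (fst (x j))) = real (k - e)})"
  have ev_prob: "mu.prob (ev e) = coeff P e * coeff (P ^ card S) (k - e)" for e
  proof -
    have "mu.prob (ev e) = mu.prob {x. (\<Sum>j\<in>{i}. real (fst (restrict x {i} j))) \<in> {real e..real e}
        \<and> (\<Sum>j\<in>S. real (fst (restrict x S j))) \<in> {real (k - e)..real (k - e)}}"
      by (rule arg_cong[where f = mu.prob]) (auto simp: ev_def cong: sum.cong)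
    also have "\<dots> = mu.prob {x. (\<Sum>j\<in>{i}. real (fst (restrict x {i} j))) \<in> {real e..real e}}
        * mu.prob {x. (\<Sum>j\<in>S. real (fst (restrict x S j))) \<in> {real (k - e)..real (k - e)}}"
      using insert by (intro indep_two[where ?R1.0 = "\<lambda>y. (\<Sum>j\<in>{i}. real (fst (y j))) \<in> {real e..real e}"
         and ?R2.0 = "\<lambda>y. (\<Sum>j\<in>S. real (fst (y j))) \<in> {real (k - e)..real (k - e)}"] type_sum_event) auto
    also have "{x :: nat \<Rightarrow> nat \<times> nat. (\<Sum>j\<in>{i}. real (fst (restrict x {i} j))) \<in> {real e..real e}} = {x. fst (x i) = e}"
      by auto
    also have "{x :: nat \<Rightarrow> nat \<times> nat. (\<Sum>j\<in>S. real (fst (restrict x S j))) \<in> {real (k - e)..real (k - e)}}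
       = {x. (\<Sum>j\<in>S. real (fst (x j))) = real (k - e)}"
      by (auto cong: sum.cong)
    also have "mu.prob {x. fst (x i) = e} = coeff P e"
      using measure_coord[of "\<lambda>e'. fst e' = e" i] measure_edge_type[of e] by simp
    also have "mu.prob {x. (\<Sum>j\<in>S. real (fst (x j))) = real (k - e)} = coeff (P ^ card S) (k - e)"
      by (rule insert.IH)
    finally show ?thesis .
  qed
  have meas: "{x. (\<Sum>j\<in>S. real (fst (x j))) = real k'} \<in> sets (mu a d q)" for S :: "nat set" and k'
    using type_sum_event[of S UNIV "real k'" "real k'"] by (simp add: mu_def space_PiM)
  have evm: "ev e \<in> sets (mu a d q)" for e
  proof -
    have "ev e = {x. (\<Sum>j\<in>{i}. real (fst (x j))) = real e} \<inter> {x. (\<Sum>j\<in>S. real (fst (x j))) = real (k - e)}"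
      by (auto simp: ev_def)
    thus ?thesis using meas by auto
  qed
  have "{x. (\<Sum>j\<in>insert i S. real (fst (x j))) = real k} = (\<Union>e\<le>k. ev e)"
  proof (intro set_eqI iffI)
    fix x :: "nat \<Rightarrow> nat \<times> nat"
    assume "x \<in> {x. (\<Sum>j\<in>insert i S. real (fst (x j))) = real k}"
    hence "fst (x i) + (\<Sum>j\<in>S. fst (x j)) = k"
      using insert by (simp flip: of_nat_sum of_nat_add add: of_nat_eq_iff)
    hence "x \<in> ev (fst (x i))" "fst (x i) \<le> k" by (auto simp: ev_def simp flip: of_nat_sum)
    thus "x \<in> (\<Union>e\<le>k. ev e)" by blast
  next
    fix x assume "x \<in> (\<Union>e\<le>k. ev e)"
    thus "x \<in> {x. (\<Sum>j\<in>insert i S. real (fst (x j))) = real k}"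
      using insert by (auto simp: ev_def of_nat_diff)
  qed
  also have "mu.prob \<dots> = (\<Sum>e\<le>k. mu.prob (ev e))"
  proof (rule mu.finite_measure_finite_Union)
    show "ev ` {..k} \<subseteq> mu.events" using evm by blast
    show "disjoint_family_on ev {..k}" by (auto simp: disjoint_family_on_def ev_def)
  qed simp
  also have "\<dots> = coeff (P * P ^ card S) k" by (simp add: ev_prob coeff_mult)
  finally show ?case using insert by simp
qed

end

section \<open>Coboundaries\<close>

text \<open>Finite changes of a path, indexed by the countable set of lists; by
  \<open>cls_ovr\<close> every member of a class arises so.\<close>

definition ovr :: "(nat \<times> nat) list \<Rightarrow> (nat \<Rightarrow> nat \<times> nat) \<Rightarrow> (nat \<Rightarrow> nat \<times> nat)" where
  "ovr us x = (\<lambda>i. if i < length us then us ! i else x i)"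

lemma ovr_snoc: "ovr (us @ [e]) x = ovr us (x(length us := e))"
  by (auto simp: ovr_def fun_eq_iff nth_append)

lemma cls_ovr:
  assumes "y \<in> cls a d n x"
  shows "y = ovr (map y [0..<n]) x" "set (map y [0..<n]) \<subseteq> edges a d"
  using assms by (auto simp: ovr_def fun_eq_iff cls_def tower_def Xp_iff)

section \<open>Null sets under finite changes of a path\<close>

context adic_system
begin

text \<open>For a null set Z, the event that x(n := e) lies in Z is independent of x n = e. Their
  intersection lies in Z, and x n = e has positive probability, so the event is null.\<close>

lemma AE_upd:
  assumes Q: "AE x in mu a d q. Q x" and e: "e \<in> edges a d"
  shows "AE x in mu a d q. Q (x(n := e))"
proof -
  interpret mu: prob_space "mu a d q" by (rule mu_prob)
  let ?M = "\<lambda>_::nat. edge_measure a d q"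
  obtain Z where Z: "Z \<in> null_sets (mu a d q)" "{x \<in> space (mu a d q). \<not> Q x} \<subseteq> Z"
    using Q unfolding eventually_ae_filter by blast
  have Zs: "Z \<in> sets (PiM UNIV ?M)" using Z(1) by (simp add: null_sets_def mu_def)
  have m1: "(\<lambda>y i. if i = n then e else y i) \<in> measurable (PiM (- {n}) ?M) (PiM UNIV ?M)"
  proof (rule measurable_PiM_single')
    show "(\<lambda>y. if i = n then e else y i) \<in> measurable (PiM (- {n}) ?M) (edge_measure a d q)" for i
      by (cases "i = n") (auto intro!: measurable_component_singleton)
  qed (auto simp: space_PiM)
  have m2: "(\<lambda>x. x(n := e)) \<in> measurable (mu a d q) (PiM UNIV ?M)"
    unfolding fun_upd_def
  proof (rule measurable_PiM_single')
    show "(\<lambda>y. if i = n then e else y i) \<in> measurable (mu a d q) (edge_measure a d q)" for i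
      by (cases "i = n") (auto intro!: coord_measurable)
  qed (auto simp: space_PiM)
  define Y where "Y = {x. x(n := e) \<in> Z}"
  have Ys: "Y \<in> sets (mu a d q)"
    using measurable_sets[OF m2 Zs] by (simp add: Y_def vimage_def)
  have eq: "(\<lambda>i. if i = n then e else restrict x (- {n}) i) = x(n := e)" for x :: "nat \<Rightarrow> nat \<times> nat"
    by (auto simp: fun_eq_iff)
  have "mu.prob {x. restrict x {n} n = e \<and> (\<lambda>i. if i = n then e else restrict x (- {n}) i) \<in> Z} =
     mu.prob {x. restrict x {n} n = e} * mu.prob {x. (\<lambda>i. if i = n then e else restrict x (- {n}) i) \<in> Z}"
  proof (rule indep_two)
    have "(\<lambda>y. y n) \<in> measurable (PiM {n} ?M) (edge_measure a d q)" by (rule measurable_component_singleton) simp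
    from measurable_sets[OF this, of "{e}"]
    show "{y \<in> space (PiM {n} ?M). y n = e} \<in> sets (PiM {n} ?M)" by (simp add: vimage_def Int_def conj_commute)
    show "{y \<in> space (PiM (- {n}) ?M). (\<lambda>i. if i = n then e else y i) \<in> Z} \<in> sets (PiM (- {n}) ?M)"
      using measurable_sets[OF m1 Zs] by (simp add: vimage_def Int_def conj_commute)
  qed simp
  hence "mu.prob {x. x n = e \<and> x(n := e) \<in> Z} = mu.prob {x. x n = e} * mu.prob Y"
    unfolding eq Y_def by simp
  moreover have "mu.prob {x. x n = e \<and> x(n := e) \<in> Z} \<le> mu.prob Z"
    using Z(1) by (intro mu.finite_measure_mono) auto
  moreover have "mu.prob Z = 0" using Z(1) by (simp add: measure_def null_sets_def)
  moreover have "mu.prob {x. x n = e} = q * z ^ fst e"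
    using measure_coord[of "\<lambda>e'. e' = e" n] measure_edge[of "{e}"] e by simp
  ultimately have "(q * z ^ fst e) * mu.prob Y \<le> 0" by simp
  moreover have "q * z ^ fst e > 0" using q0 z0 by simp
  ultimately have "mu.prob Y = 0" by (metis less_eq_real_def measure_nonneg mult_pos_pos not_less)
  hence "Y \<in> null_sets (mu a d q)" using Ys by (simp add: mu.emeasure_eq_measure null_sets_def)
  moreover have "{x \<in> space (mu a d q). \<not> Q (x(n := e))} \<subseteq> Y" using Z(2) by (auto simp: Y_def)
  ultimately show ?thesis unfolding eventually_ae_filter by blast
qed

lemma AE_ovr:
  assumes "AE x in mu a d q. Q x" "set us \<subseteq> edges a d"
  shows "AE x in mu a d q. Q (ovr us x)"
  using assms
proof (induction us arbitrary: Q rule: rev_induct)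
  case Nil
  thus ?case by (simp add: ovr_def)
next
  case (snoc e us)
  hence "AE x in mu a d q. Q (ovr us x)" by simp
  hence "AE x in mu a d q. Q (ovr us (x(length us := e)))"
    by (rule AE_upd[where Q = "\<lambda>x. Q (ovr us x)"]) (use snoc in simp)
  thus ?case by (simp add: ovr_snoc)
qed

text \<open>The map changes only a finite initial segment of x, with countably many possible
  replacements, or fixes a maximal path; so exceptional null sets pull back to null sets.\<close>

lemma AE_Tp:
  assumes Q: "AE x in mu a d q. Q x"
  shows "AE x in mu a d q. Q (Tp a d x)"
proof -
  have "AE x in mu a d q. \<forall>us. set us \<subseteq> edges a d \<longrightarrow> Q (ovr us x)"
    unfolding AE_all_countable
  proof
    fix us show "AE x in mu a d q. set us \<subseteq> edges a d \<longrightarrow> Q (ovr us x)"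
      using AE_ovr[OF Q, of us] by (cases "set us \<subseteq> edges a d") auto
  qed
  with Q AE_Xp show ?thesis
  proof eventually_elim
    case (elim x)
    from Tp_cls_or_fixed[OF elim(2)] show ?case
    proof
      assume "\<exists>n. Tp a d x \<in> cls a d n x"
      then obtain n where n: "Tp a d x \<in> cls a d n x" by blast
      have "Q (ovr (map (Tp a d x) [0..<n]) x)" using elim(3) cls_ovr(2)[OF n] by blast
      thus ?thesis using cls_ovr(1)[OF n] by simp
    qed (use elim in simp)
  qed
qed

lemma AE_Tp_pow:
  assumes Q: "AE x in mu a d q. Q x"
  shows "AE x in mu a d q. \<forall>k. Q ((Tp a d ^^ k) x)"
  unfolding AE_all_countable
proof
  fix k show "AE x in mu a d q. Q ((Tp a d ^^ k) x)"
  proof (induction k)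
    case (Suc k)
    from AE_Tp[OF Suc] show ?case by (simp add: funpow_swap1)
  qed (use Q in simp)
qed

end

text \<open>A coboundary has bounded discrepancy, so a single step of size bounded away from zero
  survives the normalisation and becomes a jump in the limit.\<close>

lemma no_limit_curve_of_coboundary:
  assumes h: "\<And>k. \<bar>h ((Tp a d ^^ k) x)\<bar> \<le> B"
    and g: "\<And>k. g ((Tp a d ^^ k) x) = c + h ((Tp a d ^^ Suc k) x) - h ((Tp a d ^^ k) x)"
  shows "\<not> has_limit_curve a d g x"
proof
  assume "has_limit_curve a d g x"
  then obtain l \<phi> where l: "\<And>n. 0 < l n" "filterlim l at_top sequentially" "\<And>n. 0 < Rg a d g x (l n)"
    and \<phi>: "continuous_on {0..1} \<phi>" "uniform_limit {0..1} (\<lambda>n. phig a d g x (l n)) \<phi> sequentially"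
    unfolding has_limit_curve_def by blast
  define f where "f = (\<lambda>x. g x - c)"
  have B0: "B \<ge> 0" using h[of 0] by linarith
  have Sf: "Sg a d f x j = h ((Tp a d ^^ j) x) - h x" for j
  proof (induction j)
    case (Suc j)
    thus ?case using g[of j] by (simp add: Sg_Suc f_def)
  qed (simp add: Sg_def)
  have Sb: "\<bar>Sg a d f x j\<bar> \<le> 2 * B" for j using h[of j] h[of 0] unfolding Sf by simp
  have fb: "\<bar>f ((Tp a d ^^ j) x)\<bar> \<le> 2 * B" for j
    using g[of j] h[of j] h[of "Suc j"] by (simp add: f_def)
  have dev: "dev a d g x m t = Fg a d f x (t * real m) - t * Sg a d f x m" if "0 \<le> t" for m t
    using dev_centered[OF that, of a d g x m c] by (simp add: dev_def Fg_of_nat f_def)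
  have Rb: "Rg a d g x m \<le> 6 * B" for m
  proof (rule Rg_le)
    fix t :: real assume t: "t \<in> {0..1}"
    have "\<bar>t * Sg a d f x m\<bar> \<le> 1 * (2 * B)"
      unfolding abs_mult using t Sb[of m] by (intro mult_mono) auto
    moreover have "\<bar>Fg a d f x (t * real m)\<bar> \<le> 4 * B"
      using Fg_near[of "t * real m" f a d x "2 * B"] fb t Sb[of "nat \<lfloor>t * real m\<rfloor>"] by simp
    ultimately show "\<bar>dev a d g x m t\<bar> \<le> 6 * B" using dev[of t m] t by simp
  qed
  have B1: "B > 0" using Rb[of "l 0"] l(3)[of 0] by simp
  show False
  \<comment> \<open>If g = c along the whole orbit, the deviation is zero and R = 0, against the
    choice of l. Otherwise one nonzero step is followed.\<close>
  proof (cases "\<exists>k0. f ((Tp a d ^^ k0) x) \<noteq> 0")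
    case False
    have "Sg a d f x j = 0" for j using False by (simp add: Sg_def)
    hence "dev a d g x (l 0) t = 0" if "0 \<le> t" for t unfolding dev[OF that] by (simp add: Fg_def)
    hence "Rg a d g x (l 0) \<le> 0" by (intro Rg_le) auto
    thus False using l(3)[of 0] by simp
  next
    case True
    then obtain k0 where k0: "f ((Tp a d ^^ k0) x) \<noteq> 0" by blast
    define \<epsilon> where "\<epsilon> = \<bar>f ((Tp a d ^^ k0) x)\<bar>"
    have eps: "\<epsilon> > 0" using k0 by (simp add: \<epsilon>_def)
    \<comment> \<open>Both ends of the step from k0 to k0 + 1 sit at times tending to 0, so the
      curve values there share the limit \<phi> 0; but they differ by at least \<epsilon> / 2
      divided by R, and R \<le> 6 * B.\<close>
    define t where "t = (\<lambda>j n. real j / real (l n))"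
    have lr: "filterlim (\<lambda>n. real (l n)) at_top sequentially" by (rule filterlim_compose[OF filterlim_real_sequentially l(2)])
    have t0: "t j \<longlonglongrightarrow> 0" for j unfolding t_def by (rule real_tendsto_divide_at_top[OF tendsto_const lr])
    have evl: "\<forall>\<^sub>F n in sequentially. real j \<le> real (l n)" for j using lr unfolding filterlim_at_top by blast
    have tin: "\<forall>\<^sub>F n in sequentially. t j n \<in> {0..1}" for j
      using evl[of j] by eventually_elim (use l(1) in \<open>auto simp: t_def divide_le_eq\<close>)
    have conv: "(\<lambda>n. phig a d g x (l n) (t j n)) \<longlonglongrightarrow> \<phi> 0" for j
    proof -
      have "(\<lambda>n. \<phi> (t j n)) \<longlonglongrightarrow> \<phi> 0"
        by (rule continuous_on_tendsto_compose[OF \<phi>(1) t0 _ tin]) simp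
      moreover have "(\<lambda>n. phig a d g x (l n) (t j n) - \<phi> (t j n)) \<longlonglongrightarrow> 0"
      proof (rule tendstoI)
        fix e :: real assume "e > 0"
        with \<phi>(2) have "\<forall>\<^sub>F n in sequentially. \<forall>s\<in>{0..1}. dist (phig a d g x (l n) s) (\<phi> s) < e"
          unfolding uniform_limit_iff by blast
        with tin[of j] show "\<forall>\<^sub>F n in sequentially. dist (phig a d g x (l n) (t j n) - \<phi> (t j n)) 0 < e"
          by eventually_elim (auto simp: dist_real_def)
      qed
      ultimately show ?thesis using tendsto_add by fastforce
    qed
    have "(\<lambda>n. \<bar>phig a d g x (l n) (t (Suc k0) n) - phig a d g x (l n) (t k0 n)\<bar>) \<longlonglongrightarrow> \<bar>\<phi> 0 - \<phi> 0\<bar>"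
      by (intro tendsto_intros conv)
    hence "\<forall>\<^sub>F n in sequentially. \<bar>phig a d g x (l n) (t (Suc k0) n) - phig a d g x (l n) (t k0 n)\<bar> < \<epsilon> / (12 * B)"
      by (rule order_tendstoD) (use eps B1 in simp)
    moreover have "\<forall>\<^sub>F n in sequentially. 4 * B / \<epsilon> \<le> real (l n)" using lr unfolding filterlim_at_top by blast
    ultimately have "\<forall>\<^sub>F n in sequentially. False"
    proof eventually_elim
      case (elim n)
      have ln: "real (l n) > 0" using l(1) by simp
      have dv: "dev a d g x (l n) (t j n) = Sg a d f x j - t j n * Sg a d f x (l n)" for j
        using dev[of "t j n" "l n"] ln Fg_of_nat[of a d f x j] by (simp add: t_def)
      have "dev a d g x (l n) (t (Suc k0) n) - dev a d g x (l n) (t k0 n) = f ((Tp a d ^^ k0) x) - Sg a d f x (l n) / real (l n)"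
        unfolding dv Sg_Suc using ln by (simp add: t_def field_simps)
      moreover have "\<bar>Sg a d f x (l n) / real (l n)\<bar> \<le> \<epsilon> / 2"
      proof -
        have "\<bar>Sg a d f x (l n) / real (l n)\<bar> \<le> 2 * B / real (l n)" using Sb[of "l n"] ln by (simp add: abs_divide divide_right_mono)
        also have "\<dots> \<le> \<epsilon> / 2" using elim(2) ln eps by (simp add: field_simps)
        finally show ?thesis .
      qed
      ultimately have dd: "\<bar>dev a d g x (l n) (t (Suc k0) n) - dev a d g x (l n) (t k0 n)\<bar> \<ge> \<epsilon> / 2"
        unfolding \<epsilon>_def by linarith
      have "\<epsilon> / 2 / (6 * B) \<le> \<bar>dev a d g x (l n) (t (Suc k0) n) - dev a d g x (l n) (t k0 n)\<bar> / Rg a d g x (l n)"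
        using dd Rb[of "l n"] l(3)[of n] eps by (intro frac_le) auto
      also have "\<dots> = \<bar>phig a d g x (l n) (t (Suc k0) n) - phig a d g x (l n) (t k0 n)\<bar>"
        using l(3)[of n] by (simp add: phig_eq_dev abs_divide flip: diff_divide_distrib)
      finally show False using elim(1) by simp
    qed
    thus False by simp
  qed
qed

context adic_system
begin

theorem cohom_no_limit_curve:
  assumes "cohom_const a d q g"
  shows "AE x in mu a d q. \<not> has_limit_curve a d g x"
proof -
  obtain c h B where h: "AE x in mu a d q. \<bar>h x\<bar> \<le> B" and g: "AE x in mu a d q. g x = c + h (Tp a d x) - h x"
    using assms unfolding cohom_const_def by blast
  from AE_Tp_pow[OF h] AE_Tp_pow[OF g] show ?thesis
  proof eventually_elim
    case (elim x)
    show ?case by (rule no_limit_curve_of_coboundary[of h a d x B g c]) (use elim in auto)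
  qed
qed

end

section \<open>The transfer function when all level-N averages agree\<close>

lemma adic_less_tail:
  assumes "adic_less y x" "\<forall>i\<ge>m. y i = x i" "\<forall>i\<ge>m. y' i = x' i"
    and "\<forall>i<m. y' i = y i" "\<forall>i<m. x' i = x i"
  shows "adic_less y' x'"
proof -
  obtain i where i: "edge_prec (y i) (x i)" "\<forall>j>i. y j = x j" "vert y (Suc i) = vert x (Suc i)"
    using assms(1) adic_less_iff by metis
  have im: "i < m"
  proof (rule ccontr)
    assume "\<not> i < m"
    hence "y i = x i" using assms(2) by simp
    thus False using i(1) edge_prec_irrefl by simp
  qed
  have "vert y' (Suc i) = vert y (Suc i)" "vert x' (Suc i) = vert x (Suc i)"
    using im assms(4,5) by (auto intro!: vert_cong)
  moreover have "y' j = x' j" if "j > i" for j using that i(2) assms by (cases "j < m") auto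
  ultimately show ?thesis using i im assms(4,5) unfolding adic_less_iff by (intro exI[of _ i]) auto
qed

text \<open>The order inside a level-N tower depends on the first N edges only, so exchanging tails
  matches the two initial segments. This makes the transfer function bounded and measurable.\<close>

lemma Fs_tail:
  assumes f: "cylindric a d N f" and x: "x \<in> Xp a d" and x': "x' \<in> Xp a d" and eq: "\<forall>i<N. x i = x' i"
  shows "Fs a d N f x = Fs a d N f x'"
proof -
  have v: "vert x N = vert x' N" using eq by (intro vert_cong) auto
  have mem: "(\<lambda>i. if i < N then y i else w' i) \<in> below a d N w'"
    if y: "y \<in> below a d N w" and w': "w' \<in> Xp a d" and ww: "\<forall>i<N. w i = w' i" for y w w'
  proof -
    have y': "y \<in> Xp a d" "vert y N = vert w N" "\<forall>i\<ge>N. y i = w i" "adic_less y w" using y by (auto simp: below_def cls_def tower_def)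
    have "adic_less (\<lambda>i. if i < N then y i else w' i) w'"
      using ww by (intro adic_less_tail[OF y'(4) y'(3)]) auto
    moreover have "vert (\<lambda>i. if i < N then y i else w' i) N = vert y N" by (rule vert_cong) simp
    moreover have "vert w N = vert w' N" using ww by (intro vert_cong) auto
    ultimately show ?thesis using y' w' by (auto simp: below_def cls_def tower_def Xp_iff)
  qed
  show ?thesis unfolding Fs_def
  proof (rule sum.reindex_bij_witness[where i = "\<lambda>y i. if i < N then y i else x i"
      and j = "\<lambda>y i. if i < N then y i else x' i"])
    fix y assume y: "y \<in> below a d N x"
    have yt: "y \<in> Xp a d" "\<forall>i\<ge>N. y i = x i" using y by (auto simp: below_def cls_def tower_def)
    show "(\<lambda>i. if i < N then if i < N then y i else x' i else x i) = y" using yt by (auto simp: fun_eq_iff)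
    show m: "(\<lambda>i. if i < N then y i else x' i) \<in> below a d N x'" by (rule mem[OF y x' eq])
    have "(\<lambda>i. if i < N then y i else x' i) \<in> Xp a d" using yt x' by (simp add: Xp_iff)
    thus "f (\<lambda>i. if i < N then y i else x' i) = f y" using yt(1) by (rule cylindricD[OF f]) simp
  next
    fix y assume y: "y \<in> below a d N x'"
    have yt: "\<forall>i\<ge>N. y i = x' i" using y by (auto simp: below_def cls_def tower_def)
    show "(\<lambda>i. if i < N then if i < N then y i else x i else x' i) = y" using yt by (auto simp: fun_eq_iff)
    show "(\<lambda>i. if i < N then y i else x i) \<in> below a d N x" using eq by (intro mem[OF y x]) auto
  qed
qed

text \<open>Swapping the two edges keeps the vertex, and the later one moves from type d, first in
  the order, to type 0.\<close>

lemma swap_successor: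
  assumes x: "x \<in> Xp a d" and d: "d \<ge> 1" "0 < a 0" "0 < a d" and sw: "x i = (0, 0)" "x (Suc i) = (d, 0)"
  shows "\<exists>y\<in>Xp a d. adic_less x y"
proof -
  define y where "y = x(i := (d, 0), Suc i := (0, 0))"
  have "y \<in> Xp a d" using x d by (auto simp: y_def Xp_iff in_edges)
  moreover have "vert y i = vert x i" by (rule vert_cong) (simp add: y_def)
  hence "vert x (Suc (Suc i)) = vert y (Suc (Suc i))" using sw by (simp add: vert_Suc y_def)
  hence "adic_less x y" unfolding adic_less_iff
    using sw d by (intro exI[of _ "Suc i"]) (auto simp: y_def edge_prec_def)
  ultimately show ?thesis by blast
qed

context adic_system
begin

text \<open>The pattern of \<open>swap_successor\<close> has a fixed positive probability on
  disjoint pairs of coordinates, so it occurs almost surely.\<close>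

lemma AE_has_successor: "AE x in mu a d q. \<exists>y\<in>Xp a d. adic_less x y"
proof -
  let ?M = "\<lambda>_::nat. edge_measure a d q"
  define K where "K = (\<lambda>i::nat. {2 * i, 2 * i + 1})"
  define Q where "Q = (\<lambda>i (y :: nat \<Rightarrow> nat \<times> nat). y (2 * i) = (0, 0) \<and> y (2 * i + 1) = (d, 0))"
  have cm: "{y \<in> space (PiM L ?M). y j = e} \<in> sets (PiM L ?M)" if "j \<in> L" for j L e
    using measurable_sets[OF measurable_component_singleton[OF that, of ?M], of "{e}"]
    by (simp add: vimage_def Int_def conj_commute)
  define c where "c = q * (q * z ^ d)"
  have c: "c > 0" using q0 z0 by (simp add: c_def)
  have pr: "measure (mu a d q) {x. x j = e} = q * z ^ fst e" if "e \<in> edges a d" for j e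
    using measure_coord[of "\<lambda>e'. e' = e" j] measure_edge[of "{e}"] that by simp
  have "AE x in mu a d q. infinite {i. Q i (restrict x (K i))}"
  proof (rule blocks_infinitely_often[OF _ _ c])
    show "disjoint_family K" by (auto simp: disjoint_family_on_def K_def)
    show "{y \<in> space (PiM (K i) ?M). Q i y} \<in> sets (PiM (K i) ?M)" for i
    proof -
      have "{y \<in> space (PiM (K i) ?M). Q i y} =
        {y \<in> space (PiM (K i) ?M). y (2 * i) = (0, 0)} \<inter> {y \<in> space (PiM (K i) ?M). y (2 * i + 1) = (d, 0)}"
        by (auto simp: Q_def)
      thus ?thesis using cm[of "2 * i" "K i"] cm[of "2 * i + 1" "K i"] by (simp add: K_def)
    qed
    have "c \<le> measure (mu a d q) {x. Q i (restrict x (K i))}" for i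
    proof -
      have seq: "{x. Q i (restrict x (K i))} = {x. restrict x {2 * i} (2 * i) = (0, 0) \<and> restrict x {2 * i + 1} (2 * i + 1) = (d, 0)}"
        by (auto simp: Q_def K_def)
      have "measure (mu a d q) {x. Q i (restrict x (K i))} = measure (mu a d q) {x. restrict x {2 * i} (2 * i) = (0, 0)}
          * measure (mu a d q) {x. restrict x {2 * i + 1} (2 * i + 1) = (d, 0)}"
        unfolding seq
        by (rule indep_two[where ?R1.0 = "\<lambda>y. y (2 * i) = (0, 0)" and ?R2.0 = "\<lambda>y. y (2 * i + 1) = (d, 0)"]) (auto intro!: cm)
      also have "\<dots> = c" using pr[of "(0, 0)" "2 * i"] pr[of "(d, 0)" "2 * i + 1"] a0 apos[of d] by (simp add: in_edges c_def)
      finally show ?thesis by simp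
    qed
    thus "\<forall>\<^sub>F i in sequentially. c \<le> measure (mu a d q) {x. Q i (restrict x (K i))}" by simp
  qed
  with AE_Xp show ?thesis
  proof eventually_elim
    case (elim x)
    then obtain i where "Q i (restrict x (K i))" using infinite_imp_nonempty by blast
    hence "x (2 * i) = (0, 0)" "x (Suc (2 * i)) = (d, 0)" by (auto simp: Q_def K_def)
    thus ?case using swap_successor[OF elim(1) d1 a0 apos] by blast
  qed
qed

text \<open>Inside a tower this is \<open>Fs_Tp\<close>. At the top the full tower sum 0 is reached,
  which agrees with the empty sum at the bottom of the next tower.\<close>

lemma Tp_cocycle:
  assumes f: "cylindric a d N f" and x: "x \<in> Xp a d" and ex: "\<exists>y\<in>Xp a d. adic_less x y"
    and z: "\<And>k. Gs a d f N k = 0"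
  shows "Fs a d N f (Tp a d x) = Fs a d N f x + f x"
proof (cases "\<exists>y\<in>cls a d N x. adic_less x y")
  case True
  thus ?thesis by (rule Fs_Tp(1)[OF x])
next
  case False
  have "Fs a d N f x + f x = Gs a d f N (vert x N)"
    using Fs_plus_max[OF x False, of f] cls_sum_eq_Gs[OF f order.refl x a0] by simp
  thus ?thesis using z below_Tp_of_max[OF x False ex] by (simp add: Fs_def)
qed

theorem cohom_of_Gs_eq_0:
  assumes g: "cylindric a d N g" and z: "\<And>k. Gs a d (\<lambda>x. g x - c) N k = 0"
  shows "cohom_const a d q g"
proof -
  define f where "f = (\<lambda>x. g x - c)"
  have f: "cylindric a d N f" unfolding f_def by (rule cylindric_diff_const[OF g])
  \<comment> \<open>A function of the first N edges on the whole space, hence measurable; it agrees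
    with \<open>Fs\<close> on \<open>Xp a d\<close>.\<close>
  define h where "h = (\<lambda>x. Fs a d N f (ovr (map x [0..<N]) (\<lambda>_. (0, 0))))"
  have heq: "h x = Fs a d N f x" if x: "x \<in> Xp a d" for x
  proof -
    have "ovr (map x [0..<N]) (\<lambda>_. (0, 0)) \<in> Xp a d"
      using x const_path_Xp[of a d, OF a0] by (auto simp: ovr_def Xp_iff)
    thus ?thesis unfolding h_def using x by (intro Fs_tail[OF f]) (auto simp: ovr_def)
  qed
  have hm: "h \<in> borel_measurable (mu a d q)"
  proof -
    have "(\<lambda>x. map x [0..<N]) \<in> measurable (mu a d q) (count_space UNIV)"
    proof (rule measurableI)
      fix A :: "(nat \<times> nat) list set"
      have one: "{x. map x [0..<N] = us} \<in> sets (mu a d q)" for us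
      proof (cases "length us = N")
        case True
        have "{x. map x [0..<N] = us} = (\<Inter>i\<in>{..<N}. {x. x i = us ! i}) \<inter> UNIV"
          using True by (auto simp: list_eq_iff_nth_eq)
        moreover have "{x. x i = us ! i} \<in> sets (mu a d q)" for i
          using measurable_sets[OF coord_measurable[of i], of "{us ! i}"] by (simp add: vimage_def)
        moreover have "UNIV \<in> sets (mu a d q)" using sets.top[of "mu a d q"] by simp
        ultimately show ?thesis by (cases "N = 0") (auto intro!: sets.finite_INT sets.Int)
      next
        case False
        hence "{x. map x [0..<N] = us} = {}" by auto
        thus ?thesis by simp
      qed
      have "(\<lambda>x. map x [0..<N]) -` A \<inter> space (mu a d q) = (\<Union>us\<in>A. {x. map x [0..<N] = us})" by auto
      also have "\<dots> \<in> sets (mu a d q)" using one by (intro sets.countable_UN') auto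
      finally show "(\<lambda>x. map x [0..<N]) -` A \<inter> space (mu a d q) \<in> sets (mu a d q)" .
    qed simp
    from measurable_compose[OF this, of "\<lambda>us. Fs a d N f (ovr us (\<lambda>_. (0, 0)))" borel] show ?thesis
      unfolding h_def by simp
  qed
  define S where "S = (\<lambda>us. Fs a d N f (ovr us (\<lambda>_. (0, 0)))) ` {us. set us \<subseteq> edges a d \<and> length us = N}"
  have finS: "finite S" unfolding S_def by (intro finite_imageI finite_lists_length_eq) simp
  have hb: "\<bar>h x\<bar> \<le> (\<Sum>s\<in>S. \<bar>s\<bar>)" if "x \<in> Xp a d" for x
  proof -
    have "h x \<in> S" unfolding S_def h_def using that by (intro imageI) (auto simp: Xp_iff)
    thus ?thesis using finS by (intro member_le_sum[of "h x" S abs]) auto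
  qed
  have "AE x in mu a d q. \<bar>h x\<bar> \<le> (\<Sum>s\<in>S. \<bar>s\<bar>)" using AE_Xp by eventually_elim (rule hb)
  moreover have "AE x in mu a d q. g x = c + h (Tp a d x) - h x"
    using AE_Xp AE_has_successor
  proof eventually_elim
    case (elim x)
    have "Fs a d N f (Tp a d x) = Fs a d N f x + f x"
      by (rule Tp_cocycle[OF f elim]) (use z in \<open>simp add: f_def\<close>)
    thus ?case using heq[OF elim(1)] heq[OF Tp_Xp[OF elim(1)]] by (simp add: f_def)
  qed
  ultimately show ?thesis unfolding cohom_const_def using hm by blast
qed

end

section \<open>Recurrence and the main theorem\<close>

context lattice_law
begin

text \<open>Uniformity comes from compactness: counterexamples at levels tending to infinity would
  have convergent positions along a subsequence, against the local limit theorem, as \<delta> is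
  half a lower bound of the density on the window.\<close>

lemma coeff_lower:
  "\<exists>\<delta>>0. \<forall>\<^sub>F L in sequentially. \<forall>k. (real k - real L * mean) / sqrt (real L) \<in> {u..v} \<longrightarrow>
      \<delta> \<le> sqrt (real L) * coeff (P ^ L) k"
proof -
  define b where "b = max \<bar>u\<bar> \<bar>v\<bar>"
  define \<delta> where "\<delta> = exp (- b\<^sup>2 / (2 * var)) / sqrt (2 * pi * var) / 2"
  have dl: "\<delta> > 0" using var_pos by (simp add: \<delta>_def)
  have g: "2 * \<delta> \<le> gr var 0 s" if "s \<in> {u..v}" for s
  proof -
    have "\<bar>s\<bar> \<le> b" using that by (auto simp: b_def)
    hence "s\<^sup>2 \<le> b\<^sup>2" by (metis abs_ge_zero power2_abs power_mono)
    hence "- b\<^sup>2 / (2 * var) \<le> - s\<^sup>2 / (2 * var)" using var_pos by (simp add: divide_right_mono)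
    thus ?thesis using var_pos by (simp add: \<delta>_def gr_def divide_right_mono)
  qed
  have "\<forall>\<^sub>F L in sequentially. \<forall>k. (real k - real L * mean) / sqrt (real L) \<in> {u..v} \<longrightarrow>
      \<delta> \<le> sqrt (real L) * coeff (P ^ L) k"
  proof (rule ccontr)
    assume "\<not> ?thesis"
    from not_eventually_sequentiallyD[OF this]
    obtain l :: "nat \<Rightarrow> nat" where l0: "strict_mono l"
      "\<forall>i. \<not> (\<forall>k. (real k - real (l i) * mean) / sqrt (real (l i)) \<in> {u..v} \<longrightarrow> \<delta> \<le> sqrt (real (l i)) * coeff (P ^ l i) k)"
      by blast
    have l: "strict_mono l"
      "\<And>i. \<exists>k. (real k - real (l i) * mean) / sqrt (real (l i)) \<in> {u..v} \<and> sqrt (real (l i)) * coeff (P ^ l i) k < \<delta>"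
      using l0 by (auto simp: not_le)
    then obtain k where k: "\<And>i. (real (k i) - real (l i) * mean) / sqrt (real (l i)) \<in> {u..v}"
      "\<And>i. sqrt (real (l i)) * coeff (P ^ l i) (k i) < \<delta>" by metis
    define F where "F = (\<lambda>i. (real (k i) - real (l i) * mean) / sqrt (real (l i)))"
    have "\<forall>i. F i \<in> {u..v}" using k(1) by (simp add: F_def)
    from seq_compactE[OF compact_imp_seq_compact[OF compact_Icc] this]
    obtain s r where r: "s \<in> {u..v}" "strict_mono (r :: nat \<Rightarrow> nat)" "(F \<circ> r) \<longlonglongrightarrow> s" .
    have "(\<lambda>i. sqrt (real (l (r i))) ^ Suc 0 * coeff (P ^ l (r i) * ([:1, -1:] ^ 0 * 1)) (k (r i))) \<longlonglongrightarrow> poly 1 1 * gr var 0 s"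
    proof (rule local_limit_real)
      show "filterlim (\<lambda>i. l (r i)) sequentially sequentially"
        by (rule filterlim_compose[OF filterlim_subseq[OF l(1)] filterlim_subseq[OF r(2)]])
      show "(\<lambda>i. (real (k (r i)) - real (l (r i)) * mean) / sqrt (real (l (r i)))) \<longlonglongrightarrow> s"
        using r(3) by (simp add: o_def F_def)
    qed
    hence "(\<lambda>i. sqrt (real (l (r i))) * coeff (P ^ l (r i)) (k (r i))) \<longlonglongrightarrow> gr var 0 s" by simp
    hence "gr var 0 s \<le> \<delta>" by (rule LIMSEQ_le_const2) (use k(2) in \<open>auto intro: less_imp_le\<close>)
    thus False using g[OF r(1)] dl by simp
  qed
  thus ?thesis using dl by blast
qed

text \<open>About (v - u) * sqrt L lattice points, each of mass at least \<delta> / sqrt L.\<close>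

lemma interval_mass:
  assumes uv: "u < v"
  shows "\<exists>c>0. \<forall>\<^sub>F L in sequentially. \<exists>A. finite A \<and> (\<forall>k\<in>A. (real k - real L * mean) / sqrt (real L) \<in> {u..v})
      \<and> c \<le> (\<Sum>k\<in>A. coeff (P ^ L) k)"
proof -
  obtain \<delta> where dl: "\<delta> > 0" and ev: "\<forall>\<^sub>F L in sequentially. \<forall>k. (real k - real L * mean) / sqrt (real L) \<in> {u..v} \<longrightarrow>
      \<delta> \<le> sqrt (real L) * coeff (P ^ L) k" using coeff_lower by blast
  have mp: "mean > 0" by (rule mean_pos)
  have sq: "filterlim (\<lambda>L::nat. sqrt (real L)) at_top sequentially"
    by (rule filterlim_compose[OF sqrt_at_top filterlim_real_sequentially])
  \<comment> \<open>The first threshold makes the window at least 2 long, so that rounding loses at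
    most half of its points; the second keeps its left end nonnegative.\<close>
  hence e1: "\<forall>\<^sub>F L in sequentially. max (2 / (v - u)) (\<bar>u\<bar> / mean) \<le> sqrt (real L)"
    unfolding filterlim_at_top by blast
  define c where "c = (v - u) * \<delta> / 2"
  have c: "c > 0" using uv dl by (simp add: c_def)
  have "\<forall>\<^sub>F L in sequentially. \<exists>A. finite A \<and> (\<forall>k\<in>A. (real k - real L * mean) / sqrt (real L) \<in> {u..v})
      \<and> c \<le> (\<Sum>k\<in>A. coeff (P ^ L) k)"
    using ev e1 eventually_gt_at_top[of 0]
  proof eventually_elim
    case (elim L)
    define S where "S = sqrt (real L)"
    have S: "S > 0" "S * S = real L" "2 / (v - u) \<le> S" "\<bar>u\<bar> / mean \<le> S" using elim by (auto simp: S_def)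
    define lo where "lo = real L * mean + u * S"
    have "\<bar>u\<bar> \<le> S * mean" using S mp by (simp add: divide_le_eq)
    hence "\<bar>u\<bar> * S \<le> (S * mean) * S" using S by (intro mult_right_mono) auto
    moreover have "(S * mean) * S = real L * mean" unfolding S(2)[symmetric] by (simp only: mult_ac)
    moreover have "- u * S \<le> \<bar>u\<bar> * S" using S by (intro mult_right_mono) auto
    ultimately have lo0: "lo \<ge> 0" unfolding lo_def by simp
    define k0 where "k0 = nat \<lceil>lo\<rceil>"
    have k0: "lo \<le> real k0" "real k0 < lo + 1" using lo0 by (auto simp: k0_def) linarith+
    define M where "M = nat \<lfloor>(v - u) * S\<rfloor>"
    have vS: "(v - u) * S \<ge> 2" using S(3) uv by (simp add: field_simps)
    have M: "real M \<le> (v - u) * S" "(v - u) * S - 1 \<le> real M" using vS by (auto simp: M_def)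
    have mem: "(real k - real L * mean) / sqrt (real L) \<in> {u..v}" if "k \<in> {k0..<k0 + M}" for k
    proof -
      have "real k \<le> real k0 + real M - 1" "real k0 \<le> real k" using that by auto
      hence "u * S \<le> real k - real L * mean" "real k - real L * mean \<le> v * S"
        using k0 M unfolding lo_def by (auto simp: algebra_simps)
      thus ?thesis using S(1) by (simp add: S_def[symmetric] field_simps)
    qed
    have "c \<le> real M * (\<delta> / S)"
    proof -
      have "(v - u) * S / 2 \<le> real M" using M(2) vS by linarith
      hence "(v - u) * S / 2 * (\<delta> / S) \<le> real M * (\<delta> / S)" using dl S by (intro mult_right_mono) auto
      thus ?thesis using S by (simp add: c_def)
    qed
    also have "\<dots> = (\<Sum>k\<in>{k0..<k0 + M}. \<delta> / S)" by simp
    also have "\<dots> \<le> (\<Sum>k\<in>{k0..<k0 + M}. coeff (P ^ L) k)"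
    proof (rule sum_mono)
      fix k assume "k \<in> {k0..<k0 + M}"
      hence "\<delta> \<le> S * coeff (P ^ L) k" using elim(1) mem by (simp add: S_def)
      thus "\<delta> / S \<le> coeff (P ^ L) k" using S(1) by (simp add: field_simps)
    qed
    finally show ?case using mem by (intro exI[of _ "{k0..<k0 + M}"]) auto
  qed
  thus ?thesis using c by blast
qed

end

text \<open>Along these levels a path forgets its past: the first blk i edges are negligible at the
  scale sqrt (blk (Suc i)) of the fluctuations.\<close>

fun blk :: "nat \<Rightarrow> nat" where
  "blk 0 = 1" | "blk (Suc i) = (blk i + 2) ^ 4"

lemma blk_gap: "blk i + 2 \<le> blk (Suc i)"
  using self_le_power[of "blk i + 2" 4] by simp

lemma blk_strict: "strict_mono blk"
  unfolding strict_mono_Suc_iff using blk_gap by (metis add_2_eq_Suc' Suc_le_lessD Suc_leD)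

lemma blk_disjoint: "disjoint_family (\<lambda>i. {blk i..<blk (Suc i)})"
proof -
  have "{blk i..<blk (Suc i)} \<inter> {blk j..<blk (Suc j)} = {}" if "i < j" for i j
  proof -
    have "blk (Suc i) \<le> blk j" using strict_mono_less_eq[OF blk_strict, of "Suc i" j] that by (simp del: blk.simps)
    thus ?thesis by auto
  qed
  thus ?thesis unfolding disjoint_family_on_def by (metis inf_commute linorder_neqE_nat)
qed

context adic_system
begin

text \<open>The events prescribe the last edge of a block and a window for the normalised sum of its
  other types. They live on disjoint blocks, so infinitely many occur; compactness of [u, v] selects
  those along which the sums converge.\<close>

lemma AE_recurrence:
  assumes uv: "u < v"
  shows "AE x in mu a d q. \<exists>n s. filterlim n at_top sequentially \<and> s \<in> {u..v} \<and>
     (\<lambda>i. (real (vert x (n i)) - real (n i) * mean) / sqrt (real (n i))) \<longlonglongrightarrow> s \<and> (\<forall>i::nat. x (n i - 1) = (d, 0))"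
proof -
  interpret mu: prob_space "mu a d q" by (rule mu_prob)
  let ?M = "\<lambda>_::nat. edge_measure a d q"
  define K where "K = (\<lambda>i. {blk i..<blk (Suc i)})"
  \<comment> \<open>The last edge of block i leads into level n = \<open>blk (Suc i)\<close>, so it
    is the edge x (n - 1).\<close>
  define T where "T = (\<lambda>i. blk (Suc i) - 1)"
  define S where "S = (\<lambda>i. {blk i..<T i})"
  define L where "L = (\<lambda>i. card (S i))"
  have L: "L i = T i - blk i" "T i > blk i" "L i > 0" "T i \<in> K i" "S i \<subseteq> K i" "T i \<notin> S i" "blk (Suc i) = Suc (T i)" for i
    using blk_gap[of i] by (auto simp: L_def S_def T_def K_def)
  define lo where "lo = (\<lambda>i. real (L i) * mean + u * sqrt (real (L i)))"
  define hi where "hi = (\<lambda>i. real (L i) * mean + v * sqrt (real (L i)))"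
  define Q where "Q = (\<lambda>i (y :: nat \<Rightarrow> nat \<times> nat). y (T i) = (d, 0) \<and> (\<Sum>j\<in>S i. real (fst (y j))) \<in> {lo i..hi i})"
  have lohi: "w \<in> {lo i..hi i} \<longleftrightarrow> (w - real (L i) * mean) / sqrt (real (L i)) \<in> {u..v}" for w i
    using L(3)[of i] by (auto simp: lo_def hi_def field_simps)
  have Linf: "filterlim L at_top sequentially"
  proof (rule filterlim_at_top_mono[OF filterlim_subseq[OF blk_strict]])
    have "blk i \<le> L i" for i
    proof -
      have "(blk i + 2) * (blk i + 2) * 1 \<le> (blk i + 2) * (blk i + 2) * ((blk i + 2) * (blk i + 2))"
        by (intro mult_le_mono2) simp
      hence "blk (Suc i) \<ge> (blk i + 2) * (blk i + 2)" by (simp add: power4_eq_xxxx mult.assoc)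
      moreover have "(blk i + 2) * (blk i + 2) \<ge> blk i + blk i + 1" by (simp add: algebra_simps)
      ultimately show ?thesis using L(1,7)[of i] by linarith
    qed
    thus "\<forall>\<^sub>F i in sequentially. blk i \<le> L i" by simp
  qed
  have cm: "{y \<in> space (PiM J ?M). y j = e} \<in> sets (PiM J ?M)" if "j \<in> J" for j J e
    using measurable_sets[OF measurable_component_singleton[OF that, of ?M], of "{e}"]
    by (simp add: vimage_def Int_def conj_commute)
  obtain c where c: "c > 0" and evc: "\<forall>\<^sub>F L in sequentially. \<exists>A. finite A \<and> (\<forall>k\<in>A. (real k - real L * mean) / sqrt (real L) \<in> {u..v})
      \<and> c \<le> (\<Sum>k\<in>A. coeff (P ^ L) k)" using interval_mass[OF uv] by blast
  define c' where "c' = q * z ^ d * c"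
  have c': "c' > 0" using c q0 z0 by (simp add: c'_def)
  have "AE x in mu a d q. infinite {i. Q i (restrict x (K i))}"
  proof (rule blocks_infinitely_often[OF _ _ c'])
    show "disjoint_family K" unfolding K_def by (rule blk_disjoint)
    show "{y \<in> space (PiM (K i) ?M). Q i y} \<in> sets (PiM (K i) ?M)" for i
    proof -
      have "{y \<in> space (PiM (K i) ?M). Q i y} = {y \<in> space (PiM (K i) ?M). y (T i) = (d, 0)} \<inter>
         {y \<in> space (PiM (K i) ?M). (\<Sum>j\<in>S i. real (fst (y j))) \<in> {lo i..hi i}}"
        by (auto simp: Q_def)
      thus ?thesis using cm[OF L(4)[of i]] type_sum_event[OF L(5)[of i]] by simp
    qed
    show "\<forall>\<^sub>F i in sequentially. c' \<le> measure (mu a d q) {x. Q i (restrict x (K i))}"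
      using eventually_compose_filterlim[OF evc Linf]
    proof eventually_elim
      case (elim i)
      then obtain A where A: "finite A" "\<forall>k\<in>A. real k \<in> {lo i..hi i}" "c \<le> (\<Sum>k\<in>A. coeff (P ^ L i) k)"
        unfolding lohi by blast
      have seq: "{x. Q i (restrict x (K i))} = {x. restrict x {T i} (T i) = (d, 0) \<and> (\<Sum>j\<in>S i. real (fst (restrict x (S i) j))) \<in> {lo i..hi i}}"
      proof -
        have "(\<Sum>j\<in>S i. real (fst (restrict x (K i) j))) = (\<Sum>j\<in>S i. real (fst (restrict x (S i) j)))" for x :: "nat \<Rightarrow> nat \<times> nat"
          using L(5)[of i] by (intro sum.cong) auto
        thus ?thesis using L(4)[of i] by (auto simp: Q_def)
      qed
      have m: "{x. (\<Sum>j\<in>S i. real (fst (x j))) = real k} \<in> sets (mu a d q)" for k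
        using type_sum_event[of "S i" UNIV "real k" "real k"] by (simp add: mu_def space_PiM)
      have m2: "{x. (\<Sum>j\<in>S i. real (fst (x j))) \<in> {lo i..hi i}} \<in> sets (mu a d q)"
        using type_sum_event[of "S i" UNIV "lo i" "hi i"] by (simp add: mu_def space_PiM)
      have req: "{x :: nat \<Rightarrow> nat \<times> nat. (\<Sum>j\<in>S i. real (fst (restrict x (S i) j))) \<in> {lo i..hi i}} = {x. (\<Sum>j\<in>S i. real (fst (x j))) \<in> {lo i..hi i}}"
        by (auto cong: sum.cong)
      have "c \<le> (\<Sum>k\<in>A. mu.prob {x. (\<Sum>j\<in>S i. real (fst (x j))) = real k})"
        using A(3) measure_type_sum[of "S i"] by (simp add: L_def S_def)
      also have "\<dots> = mu.prob (\<Union>k\<in>A. {x. (\<Sum>j\<in>S i. real (fst (x j))) = real k})"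
      proof (rule mu.finite_measure_finite_Union[symmetric, OF A(1)])
        show "(\<lambda>k. {x. (\<Sum>j\<in>S i. real (fst (x j))) = real k}) ` A \<subseteq> mu.events" using m by blast
        show "disjoint_family_on (\<lambda>k. {x. (\<Sum>j\<in>S i. real (fst (x j))) = real k}) A"
          by (auto simp: disjoint_family_on_def)
      qed
      also have "\<dots> \<le> mu.prob {x. (\<Sum>j\<in>S i. real (fst (x j))) \<in> {lo i..hi i}}"
        using A(2) m2 by (intro mu.finite_measure_mono) auto
      finally have p2: "c \<le> mu.prob {x. (\<Sum>j\<in>S i. real (fst (x j))) \<in> {lo i..hi i}}" .
      have p1: "mu.prob {x. restrict x {T i} (T i) = (d, 0)} = q * z ^ d"
        using measure_coord[of "\<lambda>e'. e' = (d, 0)" "T i"] measure_edge[of "{(d, 0)}"] apos[of d] by (simp add: in_edges)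
      have "c' \<le> mu.prob {x. restrict x {T i} (T i) = (d, 0)} * mu.prob {x. (\<Sum>j\<in>S i. real (fst (x j))) \<in> {lo i..hi i}}"
        unfolding p1 c'_def using p2 q0 z0 by (intro mult_left_mono) auto
      also have "\<dots> = measure (mu a d q) {x. Q i (restrict x (K i))}"
        unfolding seq req[symmetric]
      proof (rule indep_two[symmetric, where ?R1.0 = "\<lambda>y. y (T i) = (d, 0)" and ?R2.0 = "\<lambda>y. (\<Sum>j\<in>S i. real (fst (y j))) \<in> {lo i..hi i}"])
        show "{T i} \<inter> S i = {}" using L(6) by simp
      qed (auto intro!: cm type_sum_event simp del: atLeastAtMost_iff)
      finally show ?case .
    qed
  qed
  with AE_Xp show ?thesis
  proof eventually_elim
    case (elim x)
    define b where "b = (\<lambda>i. ((\<Sum>j\<in>S i. real (fst (x j))) - real (L i) * mean) / sqrt (real (L i)))"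
    obtain r where r: "strict_mono (r :: nat \<Rightarrow> nat)" "\<And>i. Q (r i) (restrict x (K (r i)))"
      using infinite_enumerate[OF elim(2)] by auto
    have Qr: "x (T (r i)) = (d, 0)" "b (r i) \<in> {u..v}" for i
    proof -
      have "(\<Sum>j\<in>S (r i). real (fst (restrict x (K (r i)) j))) = (\<Sum>j\<in>S (r i). real (fst (x j)))"
        using L(5)[of "r i"] by (intro sum.cong) auto
      thus "x (T (r i)) = (d, 0)" "b (r i) \<in> {u..v}"
        using r(2)[of i] L(4)[of "r i"] lohi[of "\<Sum>j\<in>S (r i). real (fst (x j))" "r i"] by (auto simp: Q_def b_def)
    qed
    have "\<forall>i. b (r i) \<in> {u..v}" using Qr(2) by blast
    from seq_compactE[OF compact_imp_seq_compact[OF compact_Icc] this]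
    obtain s r' where r': "s \<in> {u..v}" "strict_mono (r' :: nat \<Rightarrow> nat)" "((\<lambda>i. b (r i)) \<circ> r') \<longlonglongrightarrow> s" .
    define w where "w = (\<lambda>i. r (r' i))"
    have w: "strict_mono w" using strict_mono_compose[OF r(1) r'(2)] by (simp add: w_def)
    have bw: "(\<lambda>i. b (w i)) \<longlonglongrightarrow> s" using r'(3) by (simp add: w_def o_def)
    define n where "n = (\<lambda>i. blk (Suc (w i)))"
    define m where "m = (\<lambda>i. blk (w i))"
    have minf: "filterlim m at_top sequentially" unfolding m_def
      by (rule filterlim_compose[OF filterlim_subseq[OF blk_strict] filterlim_subseq[OF w]])
    have ninf: "filterlim n at_top sequentially"
    proof (rule filterlim_at_top_mono[OF minf])
      have "m i \<le> n i" for i using blk_gap[of "w i"] unfolding n_def m_def by linarith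
      thus "\<forall>\<^sub>F i in sequentially. m i \<le> n i" by simp
    qed
    have mr: "filterlim (\<lambda>i. real (m i)) at_top sequentially" by (rule filterlim_compose[OF filterlim_real_sequentially minf])
    have nm: "real (n i) = (real (m i) + 2) ^ 4" for i by (simp add: n_def m_def add.commute)
    have sn: "sqrt (real (n i)) = (real (m i) + 2)\<^sup>2" for i
      by (rule real_sqrt_unique) (simp_all add: nm)
    have Ln: "real (L (w i)) = (real (m i) + 2) ^ 4 - 1 - real (m i)" for i
    proof -
      have "n i = L (w i) + m i + 1" using L(1,2,7)[of "w i"] by (simp add: n_def m_def del: blk.simps)
      hence "real (n i) = real (L (w i)) + real (m i) + 1" by simp
      thus ?thesis using nm[of i] by simp
    qed
    have ratio: "(\<lambda>i. sqrt (real (L (w i))) / sqrt (real (n i))) \<longlonglongrightarrow> 1"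
    proof -
      have "((\<lambda>y::real. sqrt ((y + 2) ^ 4 - 1 - y) / (y + 2)\<^sup>2) \<longlongrightarrow> 1) at_top" by real_asymp
      from filterlim_compose[OF this mr] show ?thesis by (simp add: Ln sn)
    qed
    \<comment> \<open>The first m edges and the last one contribute O(m), against sqrt n = (m + 2) ^
      2.\<close>
    define err where "err = (\<lambda>i. (real (vert x (m i)) + real d - (real (m i) + 1) * mean) / sqrt (real (n i)))"
    have mean0: "mean \<ge> 0" using mean_pos by simp
    have err: "err \<longlonglongrightarrow> 0"
    proof (rule Lim_null_comparison)
      have "((\<lambda>y::real. (y + 1) / (y + 2)\<^sup>2) \<longlongrightarrow> 0) at_top" by real_asymp
      hence "((\<lambda>y::real. (real d + mean) * (y + 1) / (y + 2)\<^sup>2) \<longlongrightarrow> 0) at_top"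
        using tendsto_mult_right_zero[of "\<lambda>y::real. (y + 1) / (y + 2)\<^sup>2" at_top "real d + mean"] by simp
      from filterlim_compose[OF this mr] show "(\<lambda>i. (real d + mean) * (real (m i) + 1) / (real (m i) + 2)\<^sup>2) \<longlonglongrightarrow> 0" .
      have "norm (err i) \<le> (real d + mean) * (real (m i) + 1) / (real (m i) + 2)\<^sup>2" for i
      proof -
        have "real (vert x (m i)) \<le> real d * real (m i)"
          using vert_le[OF elim(1), of "m i"] by (metis of_nat_le_iff of_nat_mult)
        moreover have "0 \<le> (real (m i) + 1) * mean" using mean0 by simp
        moreover have "0 \<le> real d * real (m i) + real d" by simp
        ultimately have "\<bar>real (vert x (m i)) + real d - (real (m i) + 1) * mean\<bar> \<le> (real d * real (m i) + real d) + (real (m i) + 1) * mean"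
          by linarith
        also have "\<dots> = (real d + mean) * (real (m i) + 1)" by (simp add: algebra_simps)
        finally show ?thesis unfolding err_def sn by (simp add: abs_divide divide_right_mono)
      qed
      thus "\<forall>\<^sub>F i in sequentially. norm (err i) \<le> (real d + mean) * (real (m i) + 1) / (real (m i) + 2)\<^sup>2" by simp
    qed
    have dec: "(real (vert x (n i)) - real (n i) * mean) / sqrt (real (n i)) =
       b (w i) * (sqrt (real (L (w i))) / sqrt (real (n i))) + err i" for i
    proof -
      have "vert x (n i) = vert x (T (w i)) + d"
        unfolding n_def L(7) vert_Suc using Qr(1)[of "r' i"] by (simp add: w_def)
      also have "vert x (T (w i)) = vert x (m i) + (\<Sum>j\<in>S (w i). fst (x j))"
        unfolding m_def S_def by (rule vert_add_tail) (use L(2)[of "w i"] in simp)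
      finally have "real (vert x (n i)) = real (vert x (m i)) + (\<Sum>j\<in>S (w i). real (fst (x j))) + real d" by simp
      moreover have "real (n i) = real (L (w i)) + real (m i) + 1" unfolding Ln nm by simp
      moreover have "b (w i) * sqrt (real (L (w i))) = (\<Sum>j\<in>S (w i). real (fst (x j))) - real (L (w i)) * mean"
        using L(3)[of "w i"] by (simp add: b_def)
      ultimately have "real (vert x (n i)) - real (n i) * mean =
         b (w i) * sqrt (real (L (w i))) + (real (vert x (m i)) + real d - (real (m i) + 1) * mean)"
        by (simp add: algebra_simps)
      thus ?thesis by (simp add: err_def add_divide_distrib)
    qed
    have "(\<lambda>i. b (w i) * (sqrt (real (L (w i))) / sqrt (real (n i))) + err i) \<longlonglongrightarrow> s * 1 + 0"
      by (intro tendsto_intros bw ratio err)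
    hence "(\<lambda>i. (real (vert x (n i)) - real (n i) * mean) / sqrt (real (n i))) \<longlonglongrightarrow> s" unfolding dec by simp
    moreover have "x (n i - 1) = (d, 0)" for i
      unfolding n_def L(7) using Qr(1)[of "r' i"] by (simp add: w_def)
    ultimately show ?case using ninf r'(1) by blast
  qed
qed

end

context adic_function
begin

text \<open>The window is a closed interval free of zeros of the Hermite polynomial, so that the
  limit of the positions, possibly an endpoint, is still good.\<close>

theorem AE_limit_curve: "AE x in mu a d q. has_limit_curve a d g x"
proof -
  have "hermite var r \<noteq> 0" using hermite_degree[OF var_pos] by blast
  then obtain s0 where s0: "poly (hermite var r) s0 \<noteq> 0" using poly_all_0_iff_0 by blast
  have "isCont (poly (hermite var r)) s0" by simp
  from continuous_at_avoid[OF this s0]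
  obtain e where e: "e > 0" "\<And>y. dist s0 y < e \<Longrightarrow> poly (hermite var r) y \<noteq> 0" by blast
  have gr: "gr var r s \<noteq> 0" if "s \<in> {s0..s0 + e / 2}" for s
    using e(2)[of s] that e(1) var_pos by (simp add: gr_def dist_real_def)
  have "s0 < s0 + e / 2" using e(1) by simp
  from AE_recurrence[OF this] AE_Xp show ?thesis
  proof eventually_elim
    case (elim x)
    then obtain n s where n: "filterlim n at_top sequentially" "s \<in> {s0..s0 + e / 2}"
       "(\<lambda>i. (real (vert x (n i)) - real (n i) * mean) / sqrt (real (n i))) \<longlonglongrightarrow> s" "\<And>i::nat. x (n i - 1) = (d, 0)" by blast
    have "\<forall>\<^sub>F i in sequentially. N + 3 \<le> n i" using eventually_compose_filterlim[OF eventually_ge_at_top n(1)] .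
    from eventually_conj[OF this level_at_top[OF n(1,3), of d]]
    obtain I where I: "\<And>i. i \<ge> I \<Longrightarrow> N + 3 \<le> n i \<and> d \<le> vert x (n i)" unfolding eventually_sequentially by blast
    show ?case
    proof (rule limit_curve_along[OF elim(2)])
      show "filterlim (\<lambda>i. n (i + I)) sequentially sequentially"
        by (rule filterlim_compose[OF n(1) filterlim_add_const_nat_at_top])
      show "(\<lambda>i. (real (vert x (n (i + I))) - real (n (i + I)) * mean) / sqrt (real (n (i + I)))) \<longlonglongrightarrow> s"
        using LIMSEQ_ignore_initial_segment[OF n(3), of I] .
    qed (use n gr I in auto)
  qed
qed

end

text \<open>Intermediate value theorem for the total edge weight, which is a 0 * q < 1 at z = 0 and
  at least a 1 \<ge> 1 at z = 1 / q.\<close>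

lemma ex_adic_system:
  assumes "d \<ge> 1" "\<forall>j\<le>d. 0 < a j" "0 < q" "q < 1 / real (a 0)"
  shows "\<exists>z. adic_system a d q z"
proof -
  define h where "h = (\<lambda>z. \<Sum>j\<le>d. real (a j) * q * z ^ j)"
  have a0: "0 < a 0" using assms by simp
  have cont: "continuous_on {0..1 / q} h" unfolding h_def by (intro continuous_intros)
  have "h 0 = real (a 0) * q" unfolding h_def by (subst sum.remove[of _ 0]) (auto simp: power_0_left)
  hence h0: "h 0 < 1" using assms(4) a0 by (simp add: field_simps)
  have "(\<Sum>j\<in>{1}. real (a j) * q * (1 / q) ^ j) \<le> h (1 / q)"
    unfolding h_def using assms by (intro sum_mono2) auto
  hence "real (a 1) \<le> h (1 / q)" using assms by simp
  moreover have "1 \<le> real (a 1)" using assms by (metis One_nat_def Suc_leI of_nat_1 of_nat_mono)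
  ultimately have h1: "1 \<le> h (1 / q)" by simp
  obtain z where z: "0 \<le> z" "h z = 1" using IVT'[of h 0 1 "1 / q", OF _ h1 _ cont] h0 assms by auto
  have "z \<noteq> 0" using z h0 by auto
  hence "adic_system a d q z" using z assms unfolding adic_system_def h_def by auto
  thus ?thesis by blast
qed

theorem mainTheorem6:
  fixes a :: "nat \<Rightarrow> nat" and d N :: nat and q :: real
    and g :: "(nat \<Rightarrow> nat \<times> nat) \<Rightarrow> real"
  assumes "d \<ge> 1"
    and "\<forall>j\<le>d. 0 < a j"
    and "0 < q" and "q < 1 / real (a 0)"
    and "cylindric a d N g"
  shows "(\<not> cohom_const a d q g \<longrightarrow> (AE x in mu a d q. has_limit_curve a d g x))
       \<and> (cohom_const a d q g \<longrightarrow> (AE x in mu a d q. \<not> has_limit_curve a d g x))"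
proof (intro conjI impI)
  obtain z where z: "adic_system a d q z" using ex_adic_system[OF assms(1-4)] by blast
  interpret adic_system a d q z by (rule z)
  show "AE x in mu a d q. \<not> has_limit_curve a d g x" if "cohom_const a d q g"
    using that by (rule cohom_no_limit_curve)
  assume nc: "\<not> cohom_const a d q g"
  \<comment> \<open>The integral of \<open>g\<close>; with this choice D vanishes at 1, so the order
    of its zero there is of the form \<open>Suc r\<close>.\<close>
  define c where "c = poly (Gpoly a d q z g N) 1"
  define D where "D = Gpoly a d q z g N - smult c (P ^ N)"
  \<comment> \<open>D = 0 would make the sum of g - c over every level-N tower vanish, and
    \<open>g\<close> would be a coboundary plus a constant.\<close>
  have D0: "D \<noteq> 0"
  proof
    assume D: "D = 0"
    have "Gs a d (\<lambda>x. g x - c) N k = 0" for k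
    proof -
      have "coeff D k = 0" using D by simp
      hence "wt N k * (Gs a d g N k - c * Hs N k) = 0"
        by (simp add: D_def coeff_Gpoly coeff_P_power wt_def algebra_simps)
      hence "Gs a d g N k - c * Hs N k = 0" using wt_pos[of N k] by simp
      thus ?thesis using Gs_diff[of a d g c "\<lambda>_. 1" N k] by (simp add: Hs_def)
    qed
    thus False using cohom_of_Gs_eq_0[OF assms(5)] nc by blast
  qed
  have "poly D 1 = 0" by (simp add: D_def c_def poly_power poly_1)
  hence "order 1 D \<noteq> 0" using D0 order_root by blast
  then obtain r where r: "order 1 D = Suc r" by (metis not0_implies_Suc)
  obtain E' where E': "D = [:- 1, 1:] ^ Suc r * E'" "\<not> [:- 1, 1:] dvd E'"
    using order_decomp[OF D0, of 1] r by auto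
  \<comment> \<open>\<open>order\<close> counts factors x - 1; the sign is moved into E to match the
    differences 1 - x.\<close>
  define E where "E = smult ((- 1) ^ Suc r) E'"
  have "[:- 1, 1:] ^ Suc r = smult ((- 1) ^ Suc r) ([:1, - 1:] ^ Suc r :: real poly)"
  proof -
    have "[:- 1, 1 :: real:] = smult (- 1) [:1, - 1:]" by simp
    thus ?thesis by (simp only: smult_power)
  qed
  hence "D = [:1, -1:] ^ Suc r * E" unfolding E'(1) E_def by simp
  moreover have "poly E 1 \<noteq> 0" using E'(2) unfolding E_def by (simp add: poly_eq_0_iff_dvd)
  ultimately interpret adic_function a d q z N g c r E
    by unfold_locales (use assms(5) in \<open>auto simp: D_def\<close>)
  show "AE x in mu a d q. has_limit_curve a d g x" by (rule AE_limit_curve)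
qed

end
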